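(* Let $M$ be a module over a commutative ring $\Bbbk$ and let $k\ge1$ be a natural number. Assume that one of the following holds: 1. $\Bbbk$ is a principal ideal domain; 2. $M$ is flat; 3. $k\cdot1_\Bbbk$ is invertible in $\Bbbk$. Then the complex $\mathrm{Kos}_\bullet(M,k)$, $$0\to\Lambda^kM\to M\otimes\Lambda^{k-1}M\to\dots\to S^{k-1}M\otimes M\to S^kM\to0,$$ is pure acyclic. Moreover, in case (3) it is contractible.
   Context: $\otimes=\otimes_\Bbbk$; $S^n$ and $\Lambda^n$ denote symmetric and exterior powers over $\Bbbk$. The complex $\mathrm{Kos}_\bullet(M,k)$ has components $\mathrm{Kos}_n(M,k)=S^{k-n}M\otimes\Lambda^nM$ and differential $$\partial(\alpha\otimes a_1\wedge\dots\wedge a_n)=\sum_{i=1}^n(-1)^{i+1}\alpha a_i\otimes a_1\wedge\dots\wedge\hat a_i\wedge\dots\wedge a_n.$$ A complex $C_\bullet$ of $\Bbbk$-modules is pure acyclic if $C_\bullet\otimes N$ is acyclic for every $\Bbbk$-module $N$. *)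

theory Defs
  imports "HOL-Algebra.Module" "HOL-Algebra.AbelCoset" "HOL-Algebra.Ring_Divisibility"
    "HOL-Library.Multiset"
begin

section \<open>Modules by generators and relations\<close>

text \<open>
  The record type of modules extends that of rings, so it has fields \<open>mult\<close> and \<open>one\<close>
  that play no role for a module; they are left \<open>undefined\<close> below.
\<close>

definition linear_maps ::
  "('r, 's) ring_scheme \<Rightarrow> ('r, 'a, 't) module_scheme \<Rightarrow> ('r, 'b, 'u) module_scheme \<Rightarrow> ('a \<Rightarrow> 'b) set"
where
  "linear_maps R M N = {f. f \<in> carrier M \<rightarrow> carrier N \<and>
     (\<forall>x \<in> carrier M. \<forall>y \<in> carrier M. f (x \<oplus>\<^bsub>M\<^esub> y) = f x \<oplus>\<^bsub>N\<^esub> f y) \<and>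
     (\<forall>r \<in> carrier R. \<forall>x \<in> carrier M. f (r \<odot>\<^bsub>M\<^esub> x) = r \<odot>\<^bsub>N\<^esub> f x)}"

definition free_module :: "('r, 's) ring_scheme \<Rightarrow> 'x set \<Rightarrow> ('r, 'x \<Rightarrow> 'r) module" where
  "free_module R X =
     \<lparr>carrier = {f. (\<forall>x. f x \<in> carrier R) \<and> finite {x. f x \<noteq> \<zero>\<^bsub>R\<^esub>} \<and> {x. f x \<noteq> \<zero>\<^bsub>R\<^esub>} \<subseteq> X},
      mult = undefined, one = undefined,
      zero = (\<lambda>x. \<zero>\<^bsub>R\<^esub>), add = (\<lambda>f g x. f x \<oplus>\<^bsub>R\<^esub> g x),
      smult = (\<lambda>r f x. r \<otimes>\<^bsub>R\<^esub> f x)\<rparr>"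

definition free_gen :: "('r, 's) ring_scheme \<Rightarrow> 'x \<Rightarrow> 'x \<Rightarrow> 'r" where
  "free_gen R x = (\<lambda>y. if y = x then \<one>\<^bsub>R\<^esub> else \<zero>\<^bsub>R\<^esub>)"

definition submodule_generated ::
  "('r, 's) ring_scheme \<Rightarrow> ('r, 'a, 't) module_scheme \<Rightarrow> 'a set \<Rightarrow> 'a set" where
  "submodule_generated R M S = \<Inter>{H. submodule H R M \<and> S \<subseteq> H}"

definition quotient_module :: "('r, 'a, 't) module_scheme \<Rightarrow> 'a set \<Rightarrow> ('r, 'a set) module" where
  "quotient_module M H =
     \<lparr>carrier = a_rcosets\<^bsub>M\<^esub> H, mult = undefined, one = undefined, zero = H, add = set_add M,
      smult = (\<lambda>r C. \<Union>x\<in>C. H +>\<^bsub>M\<^esub> (r \<odot>\<^bsub>M\<^esub> x))\<rparr>"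

definition pres_module ::
  "('r, 's) ring_scheme \<Rightarrow> 'x set \<Rightarrow> ('x \<Rightarrow> 'r) set \<Rightarrow> ('r, ('x \<Rightarrow> 'r) set) module" where
  "pres_module R X Rel =
     quotient_module (free_module R X) (submodule_generated R (free_module R X) Rel)"

definition pres_class ::
  "('r, 's) ring_scheme \<Rightarrow> 'x set \<Rightarrow> ('x \<Rightarrow> 'r) set \<Rightarrow> 'x \<Rightarrow> ('x \<Rightarrow> 'r) set" where
  "pres_class R X Rel x =
     submodule_generated R (free_module R X) Rel +>\<^bsub>free_module R X\<^esub> free_gen R x"

definition free_lift ::
  "('r, 's) ring_scheme \<Rightarrow> ('r, 'b, 't) module_scheme \<Rightarrow> ('x \<Rightarrow> 'b) \<Rightarrow> ('x \<Rightarrow> 'r) \<Rightarrow> 'b" where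
  "free_lift R W \<phi> f = (\<Oplus>\<^bsub>W\<^esub>x \<in> {x. f x \<noteq> \<zero>\<^bsub>R\<^esub>}. f x \<odot>\<^bsub>W\<^esub> \<phi> x)"

text \<open>
  The linear map from a module given by generators and relations to \<open>W\<close> that sends the class of
  each generator \<open>x\<close> to \<open>\<phi> x\<close>.  It is meaningful whenever the linear extension of
  \<open>\<phi>\<close> to the free module kills the relations: that extension is then constant on each coset
  \<open>C\<close>, and \<open>the_elem\<close> picks its value.
\<close>

definition pres_lift ::
  "('r, 's) ring_scheme \<Rightarrow> ('r, 'b, 't) module_scheme \<Rightarrow> ('x \<Rightarrow> 'b) \<Rightarrow> ('x \<Rightarrow> 'r) set \<Rightarrow> 'b" where
  "pres_lift R W \<phi> C = the_elem (free_lift R W \<phi> ` C)"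


section \<open>Tensor products, symmetric and exterior powers\<close>

definition bilinear_rels ::
  "('r, 's) ring_scheme \<Rightarrow> ('r, 'a, 't) module_scheme \<Rightarrow> ('r, 'b, 'u) module_scheme
     \<Rightarrow> ('a \<times> 'b \<Rightarrow> 'r) set" where
  "bilinear_rels R M N = (let F = free_module R (carrier M \<times> carrier N) in
     {free_gen R (x \<oplus>\<^bsub>M\<^esub> x', y) \<ominus>\<^bsub>F\<^esub> (free_gen R (x, y) \<oplus>\<^bsub>F\<^esub> free_gen R (x', y)) | x x' y.
        x \<in> carrier M \<and> x' \<in> carrier M \<and> y \<in> carrier N} \<union>
     {free_gen R (x, y \<oplus>\<^bsub>N\<^esub> y') \<ominus>\<^bsub>F\<^esub> (free_gen R (x, y) \<oplus>\<^bsub>F\<^esub> free_gen R (x, y')) | x y y'.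
        x \<in> carrier M \<and> y \<in> carrier N \<and> y' \<in> carrier N} \<union>
     {free_gen R (r \<odot>\<^bsub>M\<^esub> x, y) \<ominus>\<^bsub>F\<^esub> (r \<odot>\<^bsub>F\<^esub> free_gen R (x, y)) | r x y.
        r \<in> carrier R \<and> x \<in> carrier M \<and> y \<in> carrier N} \<union>
     {free_gen R (x, r \<odot>\<^bsub>N\<^esub> y) \<ominus>\<^bsub>F\<^esub> (r \<odot>\<^bsub>F\<^esub> free_gen R (x, y)) | r x y.
        r \<in> carrier R \<and> x \<in> carrier M \<and> y \<in> carrier N})"

definition tensor_module ::
  "('r, 's) ring_scheme \<Rightarrow> ('r, 'a, 't) module_scheme \<Rightarrow> ('r, 'b, 'u) module_scheme
     \<Rightarrow> ('r, ('a \<times> 'b \<Rightarrow> 'r) set) module" where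
  "tensor_module R M N = pres_module R (carrier M \<times> carrier N) (bilinear_rels R M N)"

definition pure_tensor ::
  "('r, 's) ring_scheme \<Rightarrow> ('r, 'a, 't) module_scheme \<Rightarrow> ('r, 'b, 'u) module_scheme
     \<Rightarrow> 'a \<Rightarrow> 'b \<Rightarrow> ('a \<times> 'b \<Rightarrow> 'r) set" where
  "pure_tensor R M N x y = pres_class R (carrier M \<times> carrier N) (bilinear_rels R M N) (x, y)"

text \<open>The map \<open>f \<otimes> g\<close>; the modules \<open>M'\<close> and \<open>N'\<close> are the codomains of \<open>f\<close> and \<open>g\<close>.\<close>

definition tensor_map ::
  "('r, 's) ring_scheme \<Rightarrow> ('r, 'c, 't) module_scheme \<Rightarrow> ('r, 'd, 'u) module_scheme
     \<Rightarrow> ('a \<Rightarrow> 'c) \<Rightarrow> ('b \<Rightarrow> 'd) \<Rightarrow> ('a \<times> 'b \<Rightarrow> 'r) set \<Rightarrow> ('c \<times> 'd \<Rightarrow> 'r) set" where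
  "tensor_map R M' N' f g =
     pres_lift R (tensor_module R M' N') (\<lambda>(x, y). pure_tensor R M' N' (f x) (g y))"

text \<open>
  Powers are indexed by integers.  In a negative degree there are no tuples, hence no generators,
  and the symmetric and exterior powers are the zero module.
\<close>

definition tuples :: "('r, 'a, 't) module_scheme \<Rightarrow> int \<Rightarrow> 'a list set" where
  "tuples M j = {xs. set xs \<subseteq> carrier M \<and> int (length xs) = j}"

definition multilinear_rels ::
  "('r, 's) ring_scheme \<Rightarrow> ('r, 'a, 't) module_scheme \<Rightarrow> int \<Rightarrow> ('a list \<Rightarrow> 'r) set" where
  "multilinear_rels R M j = (let F = free_module R (tuples M j) in
     {free_gen R (xs @ (a \<oplus>\<^bsub>M\<^esub> b) # ys) \<ominus>\<^bsub>F\<^esub>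
        (free_gen R (xs @ a # ys) \<oplus>\<^bsub>F\<^esub> free_gen R (xs @ b # ys)) | xs a b ys.
        xs @ a # ys \<in> tuples M j \<and> b \<in> carrier M} \<union>
     {free_gen R (xs @ (r \<odot>\<^bsub>M\<^esub> a) # ys) \<ominus>\<^bsub>F\<^esub> (r \<odot>\<^bsub>F\<^esub> free_gen R (xs @ a # ys)) | xs r a ys.
        xs @ a # ys \<in> tuples M j \<and> r \<in> carrier R})"

definition sym_rels ::
  "('r, 's) ring_scheme \<Rightarrow> ('r, 'a, 't) module_scheme \<Rightarrow> int \<Rightarrow> ('a list \<Rightarrow> 'r) set" where
  "sym_rels R M j = multilinear_rels R M j \<union>
     {free_gen R xs \<ominus>\<^bsub>free_module R (tuples M j)\<^esub> free_gen R ys | xs ys.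
        xs \<in> tuples M j \<and> ys \<in> tuples M j \<and> mset xs = mset ys}"

definition ext_rels ::
  "('r, 's) ring_scheme \<Rightarrow> ('r, 'a, 't) module_scheme \<Rightarrow> int \<Rightarrow> ('a list \<Rightarrow> 'r) set" where
  "ext_rels R M j = multilinear_rels R M j \<union>
     {free_gen R xs | xs. xs \<in> tuples M j \<and> \<not> distinct xs}"

definition sym_power ::
  "('r, 's) ring_scheme \<Rightarrow> ('r, 'a, 't) module_scheme \<Rightarrow> int \<Rightarrow> ('r, ('a list \<Rightarrow> 'r) set) module"
where
  "sym_power R M j = pres_module R (tuples M j) (sym_rels R M j)"

definition ext_power ::
  "('r, 's) ring_scheme \<Rightarrow> ('r, 'a, 't) module_scheme \<Rightarrow> int \<Rightarrow> ('r, ('a list \<Rightarrow> 'r) set) module"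
where
  "ext_power R M j = pres_module R (tuples M j) (ext_rels R M j)"

definition sym_product ::
  "('r, 's) ring_scheme \<Rightarrow> ('r, 'a, 't) module_scheme \<Rightarrow> 'a list \<Rightarrow> ('a list \<Rightarrow> 'r) set" where
  "sym_product R M xs =
     (let j = int (length xs) in pres_class R (tuples M j) (sym_rels R M j) xs)"

definition wedge ::
  "('r, 's) ring_scheme \<Rightarrow> ('r, 'a, 't) module_scheme \<Rightarrow> 'a list \<Rightarrow> ('a list \<Rightarrow> 'r) set" where
  "wedge R M xs =
     (let j = int (length xs) in pres_class R (tuples M j) (ext_rels R M j) xs)"

text \<open>The product \<open>\<alpha> a\<close> in degree \<open>j + 1\<close> of \<open>\<alpha>\<close> of degree \<open>j\<close> and \<open>a \<in> M\<close>.\<close>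

definition sym_mult ::
  "('r, 's) ring_scheme \<Rightarrow> ('r, 'a, 't) module_scheme \<Rightarrow> int \<Rightarrow> ('a list \<Rightarrow> 'r) set \<Rightarrow> 'a
     \<Rightarrow> ('a list \<Rightarrow> 'r) set" where
  "sym_mult R M j \<alpha> a = pres_lift R (sym_power R M (j + 1)) (\<lambda>xs. sym_product R M (xs @ [a])) \<alpha>"


section \<open>Complexes\<close>

record ('r, 'c) module_complex =
  component :: "int \<Rightarrow> ('r, 'c) module"
  differential :: "int \<Rightarrow> 'c \<Rightarrow> 'c"  \<comment> \<open>from degree \<open>n\<close> to degree \<open>n - 1\<close>\<close>

definition is_complex :: "('r, 's) ring_scheme \<Rightarrow> ('r, 'c) module_complex \<Rightarrow> bool" where
  "is_complex R C \<longleftrightarrow>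
     (\<forall>n. module R (component C n)) \<and>
     (\<forall>n. differential C n \<in> linear_maps R (component C n) (component C (n - 1))) \<and>
     (\<forall>n. \<forall>x \<in> carrier (component C n).
        differential C (n - 1) (differential C n x) = \<zero>\<^bsub>component C (n - 2)\<^esub>)"

definition acyclic_complex :: "('r, 's) ring_scheme \<Rightarrow> ('r, 'c) module_complex \<Rightarrow> bool" where
  "acyclic_complex R C \<longleftrightarrow> is_complex R C \<and>
     (\<forall>n. a_kernel (component C n) (component C (n - 1)) (differential C n) =
          differential C (n + 1) ` carrier (component C (n + 1)))"

definition tensor_complex ::
  "('r, 's) ring_scheme \<Rightarrow> ('r, 'c) module_complex \<Rightarrow> ('r, 'b, 't) module_scheme
     \<Rightarrow> ('r, ('c \<times> 'b \<Rightarrow> 'r) set) module_complex" where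
  "tensor_complex R C N =
     \<lparr>component = (\<lambda>n. tensor_module R (component C n) N),
      differential = (\<lambda>n. tensor_map R (component C (n - 1)) N (differential C n) id)\<rparr>"

text \<open>
  Quantification over all modules is quantification over the modules whose carrier is a set of
  elements of a type \<open>'b\<close>, which is passed as a parameter.  A theorem that concludes
  \<open>pure_acyclic TYPE('b)\<close> with a type variable \<open>'b\<close> covers all modules.
\<close>

definition pure_acyclic ::
  "'b itself \<Rightarrow> ('r, 's) ring_scheme \<Rightarrow> ('r, 'c) module_complex \<Rightarrow> bool" where
  "pure_acyclic (_ :: 'b itself) R C \<longleftrightarrow> is_complex R C \<and>
     (\<forall>N :: ('r, 'b) module. module R N \<longrightarrow> acyclic_complex R (tensor_complex R C N))"

definition contractible_complex :: "('r, 's) ring_scheme \<Rightarrow> ('r, 'c) module_complex \<Rightarrow> bool" where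
  "contractible_complex R C \<longleftrightarrow> is_complex R C \<and>
     (\<exists>h. (\<forall>n. h n \<in> linear_maps R (component C n) (component C (n + 1))) \<and>
          (\<forall>n. \<forall>x \<in> carrier (component C n).
             differential C (n + 1) (h n x) \<oplus>\<^bsub>component C n\<^esub> h (n - 1) (differential C n x) = x))"


section \<open>Flat modules\<close>

text \<open>
  Flatness occurs as a hypothesis, so the type \<open>'u\<close> of the test modules has to be fixed where the
  notion is used.  Enlarging \<open>'u\<close> can only strengthen the condition.  If all finitely
  generated modules over \<open>R\<close> occur, up to isomorphism, on subsets of \<open>'u\<close> (as they do for
  \<open>'u = nat \<Rightarrow> 'r\<close>), the condition is flatness in the usual sense, because an element of a
  tensor product and a relation between tensors involve only finitely many elements.
\<close>

definition flat_module ::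
  "'u itself \<Rightarrow> ('r, 's) ring_scheme \<Rightarrow> ('r, 'a, 't) module_scheme \<Rightarrow> bool" where
  "flat_module (_ :: 'u itself) R M \<longleftrightarrow> module R M \<and>
     (\<forall>(A :: ('r, 'u) module) (B :: ('r, 'u) module) f.
        module R A \<and> module R B \<and> f \<in> linear_maps R A B \<and> inj_on f (carrier A) \<longrightarrow>
        inj_on (tensor_map R M B id f) (carrier (tensor_module R M A)))"


section \<open>The Koszul complex\<close>

text \<open>
  With lists indexed from \<open>0\<close>, the sign of the term that omits the entry \<open>i\<close> is \<open>(-1)^i\<close>.
  The components vanish unless \<open>0 \<le> n \<le> k\<close>, since one of the two powers then has negative degree.
\<close>

definition koszul_component ::
  "('r, 's) ring_scheme \<Rightarrow> ('r, 'a, 't) module_scheme \<Rightarrow> nat \<Rightarrow> int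
     \<Rightarrow> ('r, (('a list \<Rightarrow> 'r) set \<times> ('a list \<Rightarrow> 'r) set \<Rightarrow> 'r) set) module" where
  "koszul_component R M k n = tensor_module R (sym_power R M (int k - n)) (ext_power R M n)"

definition koszul_term ::
  "('r, 's) ring_scheme \<Rightarrow> ('r, 'a, 't) module_scheme \<Rightarrow> nat \<Rightarrow> int
     \<Rightarrow> ('a list \<Rightarrow> 'r) set \<Rightarrow> 'a list
     \<Rightarrow> (('a list \<Rightarrow> 'r) set \<times> ('a list \<Rightarrow> 'r) set \<Rightarrow> 'r) set" where
  "koszul_term R M k n \<alpha> as =
     (\<Oplus>\<^bsub>koszul_component R M k (n - 1)\<^esub> i \<in> {..<length as}.
        ((\<ominus>\<^bsub>R\<^esub> \<one>\<^bsub>R\<^esub>) [^]\<^bsub>R\<^esub> i) \<odot>\<^bsub>koszul_component R M k (n - 1)\<^esub>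
        pure_tensor R (sym_power R M (int k - n + 1)) (ext_power R M (n - 1))
          (sym_mult R M (int k - n) \<alpha> (as ! i))
          (wedge R M (take i as @ drop (Suc i) as)))"

definition koszul_complex ::
  "('r, 's) ring_scheme \<Rightarrow> ('r, 'a, 't) module_scheme \<Rightarrow> nat
     \<Rightarrow> ('r, (('a list \<Rightarrow> 'r) set \<times> ('a list \<Rightarrow> 'r) set \<Rightarrow> 'r) set) module_complex" where
  "koszul_complex R M k =
     \<lparr>component = koszul_component R M k,
      differential = (\<lambda>n. pres_lift R (koszul_component R M k (n - 1))
        (\<lambda>(\<alpha>, \<omega>). pres_lift R (koszul_component R M k (n - 1)) (koszul_term R M k n \<alpha>) \<omega>))\<rparr>"

end

theory Submission
  imports Defs
begin

text \<open>
  Let \<open>f, g : M \<rightarrow> M\<close> be linear such that \<open>f - g\<close> takes values in a cyclic submodule.  Then \<open>f\<close> and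
  \<open>g\<close> induce homotopic endomorphisms of the Koszul complex, by an explicit homotopy.  Since
  the zero map of \<open>M\<close> induces zero for \<open>k \<ge> 1\<close>, the complex is contractible whenever the identity of \<open>M\<close>
  is a finite sum of such rank one maps, in particular for a finite direct sum of cyclic modules.  A single cycle and the fact that its boundary vanishes
  involve only finitely many linear relations between finitely many elements of \<open>M\<close>, so for exactness
  it is enough to decompose the identity into functions that respect these relations.  Over a
  principal ideal domain the decomposition comes from the structure of finitely generated modules,
  and for a flat module from the equational criterion for flatness.  Everything happens after tensoring
  with a module \<open>N\<close>.  If \<open>k\<close> is invertible, the transposed differential
  \<open>\<alpha> \<otimes> \<omega> \<mapsto> \<Sum> (\<alpha> / x\<^sub>i) \<otimes> x\<^sub>i \<and> \<omega>\<close> is a homotopy between \<open>0\<close> and multiplication by \<open>k\<close>.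

  Degrees are avoided by working in one module that contains all the products
  \<open>S\<^sup>iM \<otimes> \<Lambda>\<^sup>jM \<otimes> N\<close> and of which every component is a retract.
\<close>

section \<open>Abelian groups\<close>

lemma (in abelian_group) minus_eq_zero_iff:
  "x \<in> carrier G \<Longrightarrow> y \<in> carrier G \<Longrightarrow> x \<ominus> y = \<zero> \<longleftrightarrow> x = y"
  unfolding minus_eq by (metis add.inv_closed add.m_comm minus_equality minus_minus r_neg)

lemma (in abelian_group) cancel_simps:
  assumes "l \<in> carrier G" "x \<in> carrier G" "y \<in> carrier G"
  shows "l \<oplus> (x \<oplus> \<ominus> l) = x" "\<ominus> l \<oplus> (x \<oplus> l) = x"
    and "l \<oplus> (\<ominus> l \<oplus> x) = x" "\<ominus> l \<oplus> (l \<oplus> x) = x"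
    and "l \<oplus> (x \<oplus> (y \<oplus> \<ominus> l)) = x \<oplus> y" "\<ominus> l \<oplus> (x \<oplus> (y \<oplus> l)) = x \<oplus> y"
    and "l \<oplus> (x \<oplus> (\<ominus> l \<oplus> y)) = x \<oplus> y" "\<ominus> l \<oplus> (x \<oplus> (l \<oplus> y)) = x \<oplus> y"
proof -
  have 1: "l \<oplus> (\<ominus> l \<oplus> z) = z" "\<ominus> l \<oplus> (l \<oplus> z) = z" if "z \<in> carrier G" for z
    using that assms by (simp_all add: a_assoc[symmetric] r_neg l_neg)
  show "l \<oplus> (\<ominus> l \<oplus> x) = x" "\<ominus> l \<oplus> (l \<oplus> x) = x"
    using 1 assms by auto
  show "l \<oplus> (x \<oplus> \<ominus> l) = x" "\<ominus> l \<oplus> (x \<oplus> l) = x"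
    using 1 assms by (simp_all add: a_comm[of x])
  have 2: "x \<oplus> (y \<oplus> z) = z \<oplus> (x \<oplus> y)" "x \<oplus> (z \<oplus> y) = z \<oplus> (x \<oplus> y)" if "z \<in> carrier G" for z
    using that assms by (simp_all add: a_ac)
  show "l \<oplus> (x \<oplus> (y \<oplus> \<ominus> l)) = x \<oplus> y" "\<ominus> l \<oplus> (x \<oplus> (y \<oplus> l)) = x \<oplus> y"
    using 1[of "x \<oplus> y"] 2(1)[of l] 2(1)[of "\<ominus> l"] assms by simp_all
  show "l \<oplus> (x \<oplus> (\<ominus> l \<oplus> y)) = x \<oplus> y" "\<ominus> l \<oplus> (x \<oplus> (l \<oplus> y)) = x \<oplus> y"
    using 1[of "x \<oplus> y"] 2(2)[of l] 2(2)[of "\<ominus> l"] assms by simp_all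
qed

lemma (in abelian_group) cancel_far:
  assumes "l \<in> carrier G" "x \<in> carrier G" "y \<in> carrier G" "z \<in> carrier G" "w \<in> carrier G"
  shows "l \<oplus> (x \<oplus> (y \<oplus> (z \<oplus> (\<ominus> l \<oplus> w)))) = x \<oplus> (y \<oplus> (z \<oplus> w))"
proof -
  have "l \<oplus> (x \<oplus> (y \<oplus> (z \<oplus> (\<ominus> l \<oplus> w)))) = l \<oplus> (\<ominus> l \<oplus> (x \<oplus> (y \<oplus> (z \<oplus> w))))"
    using assms by (simp add: a_ac)
  then show ?thesis
    using assms by (simp add: cancel_simps)
qed

lemma finsum_lessThan_Suc2:
  assumes "abelian_group G" "\<And>i. i < Suc n \<Longrightarrow> f i \<in> carrier G"
  shows "(\<Oplus>\<^bsub>G\<^esub>i\<in>{..<Suc n}. f i) = f 0 \<oplus>\<^bsub>G\<^esub> (\<Oplus>\<^bsub>G\<^esub>i\<in>{..<n}. f (Suc i))"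
proof -
  interpret G: abelian_group G by fact
  have "(\<Oplus>\<^bsub>G\<^esub>i\<in>Suc ` {..<n}. f i) = (\<Oplus>\<^bsub>G\<^esub>i\<in>{..<n}. f (Suc i))"
    by (rule G.finsum_reindex) (use assms(2) in auto)
  moreover have "(\<Oplus>\<^bsub>G\<^esub>i\<in>insert 0 (Suc ` {..<n}). f i) = f 0 \<oplus>\<^bsub>G\<^esub> (\<Oplus>\<^bsub>G\<^esub>i\<in>Suc ` {..<n}. f i)"
    by (rule G.finsum_insert) (use assms(2) in auto)
  ultimately show ?thesis
    by (simp add: lessThan_Suc_eq_insert_0)
qed

lemma finsum_insert_lessThan:
  assumes "abelian_monoid G" "\<And>i. i < Suc n \<Longrightarrow> f i \<in> carrier G"
  shows "(\<Oplus>\<^bsub>G\<^esub>i\<in>{..<Suc n}. f i) = f n \<oplus>\<^bsub>G\<^esub> (\<Oplus>\<^bsub>G\<^esub>i\<in>{..<n}. f i)"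
proof -
  interpret G: abelian_monoid G by fact
  have "(\<Oplus>\<^bsub>G\<^esub>i\<in>insert n {..<n}. f i) = f n \<oplus>\<^bsub>G\<^esub> (\<Oplus>\<^bsub>G\<^esub>i\<in>{..<n}. f i)"
    by (rule G.finsum_insert) (use assms(2) in auto)
  then show ?thesis
    by (simp add: lessThan_Suc)
qed

lemma (in abelian_monoid) finsum_swap:
  assumes "finite I" "finite J" "\<And>i j. i \<in> I \<Longrightarrow> j \<in> J \<Longrightarrow> f i j \<in> carrier G"
  shows "(\<Oplus>i\<in>I. \<Oplus>j\<in>J. f i j) = (\<Oplus>j\<in>J. \<Oplus>i\<in>I. f i j)"
  using assms(1,3)
proof (induction I)
  case empty
  then show ?case by (simp add: finsum_zero)
next
  case (insert a I)
  have 1: "(\<lambda>j. f a j) \<in> J \<rightarrow> carrier G" "(\<lambda>j. \<Oplus>i\<in>I. f i j) \<in> J \<rightarrow> carrier G"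
    using insert.prems by (auto intro!: finsum_closed)
  have "(\<Oplus>i\<in>insert a I. \<Oplus>j\<in>J. f i j) = (\<Oplus>j\<in>J. f a j) \<oplus> (\<Oplus>j\<in>J. \<Oplus>i\<in>I. f i j)"
    using insert by (subst finsum_insert) (auto intro!: finsum_closed)
  also have "\<dots> = (\<Oplus>j\<in>J. f a j \<oplus> (\<Oplus>i\<in>I. f i j))"
    by (rule finsum_addf[symmetric]) (use 1 in auto)
  also have "\<dots> = (\<Oplus>j\<in>J. \<Oplus>i\<in>insert a I. f i j)"
    by (rule finsum_cong') (use insert in \<open>auto intro!: finsum_closed finsum_insert[symmetric]\<close>)
  finally show ?case .
qed

section \<open>Linear maps\<close>

lemma linear_mapsI:
  assumes "\<And>x. x \<in> carrier M \<Longrightarrow> f x \<in> carrier N"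
    and "\<And>x y. x \<in> carrier M \<Longrightarrow> y \<in> carrier M \<Longrightarrow> f (x \<oplus>\<^bsub>M\<^esub> y) = f x \<oplus>\<^bsub>N\<^esub> f y"
    and "\<And>r x. r \<in> carrier R \<Longrightarrow> x \<in> carrier M \<Longrightarrow> f (r \<odot>\<^bsub>M\<^esub> x) = r \<odot>\<^bsub>N\<^esub> f x"
  shows "f \<in> linear_maps R M N"
  using assms unfolding linear_maps_def by auto

lemma linear_mapsD:
  assumes "f \<in> linear_maps R M N"
  shows lin_closed: "x \<in> carrier M \<Longrightarrow> f x \<in> carrier N"
    and lin_add: "x \<in> carrier M \<Longrightarrow> y \<in> carrier M \<Longrightarrow> f (x \<oplus>\<^bsub>M\<^esub> y) = f x \<oplus>\<^bsub>N\<^esub> f y"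
    and lin_smult: "r \<in> carrier R \<Longrightarrow> x \<in> carrier M \<Longrightarrow> f (r \<odot>\<^bsub>M\<^esub> x) = r \<odot>\<^bsub>N\<^esub> f x"
  using assms unfolding linear_maps_def by auto

lemma (in module) finsum_smult_rdistr:
  assumes "finite I" "\<And>i. i \<in> I \<Longrightarrow> c i \<in> carrier R" "x \<in> carrier M"
  shows "(\<Oplus>i\<in>I. c i) \<odot>\<^bsub>M\<^esub> x = (\<Oplus>\<^bsub>M\<^esub>i\<in>I. c i \<odot>\<^bsub>M\<^esub> x)"
  using assms(1,2)
proof (induction I)
  case (insert a I)
  then have "(\<Oplus>i\<in>insert a I. c i) = c a \<oplus> (\<Oplus>i\<in>I. c i)"
    by (intro R.finsum_insert) auto
  moreover have "(\<Oplus>\<^bsub>M\<^esub>i\<in>insert a I. c i \<odot>\<^bsub>M\<^esub> x) = c a \<odot>\<^bsub>M\<^esub> x \<oplus>\<^bsub>M\<^esub> (\<Oplus>\<^bsub>M\<^esub>i\<in>I. c i \<odot>\<^bsub>M\<^esub> x)"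
    using insert assms(3) by (intro M.finsum_insert) auto
  moreover have "(\<Oplus>i\<in>I. c i) \<in> carrier R"
    using insert by (intro R.finsum_closed) auto
  ultimately show ?case
    using insert assms(3) by (simp add: smult_l_distr)
qed (use assms in simp)

lemma lin_zero:
  assumes "module R M" "module R N" "f \<in> linear_maps R M N"
  shows "f \<zero>\<^bsub>M\<^esub> = \<zero>\<^bsub>N\<^esub>"
proof -
  interpret M: module R M by fact
  interpret N: module R N by fact
  have "f (\<zero>\<^bsub>R\<^esub> \<odot>\<^bsub>M\<^esub> \<zero>\<^bsub>M\<^esub>) = \<zero>\<^bsub>R\<^esub> \<odot>\<^bsub>N\<^esub> f \<zero>\<^bsub>M\<^esub>"
    by (rule lin_smult[OF assms(3)]) auto
  then show ?thesis
    using lin_closed[OF assms(3)] by simp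
qed

lemma (in module) uminus_eq_smult: "x \<in> carrier M \<Longrightarrow> \<ominus>\<^bsub>M\<^esub> x = (\<ominus> \<one>) \<odot>\<^bsub>M\<^esub> x"
  by (simp add: smult_l_minus)

lemma lin_neg:
  assumes "module R M" "module R N" "f \<in> linear_maps R M N" "x \<in> carrier M"
  shows "f (\<ominus>\<^bsub>M\<^esub> x) = \<ominus>\<^bsub>N\<^esub> f x"
proof -
  interpret M: module R M by fact
  interpret N: module R N by fact
  show ?thesis
    using assms(4) lin_closed[OF assms(3)] lin_smult[OF assms(3)]
    by (simp add: M.uminus_eq_smult N.uminus_eq_smult)
qed

lemma lin_minus:
  assumes "module R M" "module R N" "f \<in> linear_maps R M N" "x \<in> carrier M" "y \<in> carrier M"
  shows "f (x \<ominus>\<^bsub>M\<^esub> y) = f x \<ominus>\<^bsub>N\<^esub> f y"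
proof -
  interpret M: module R M by fact
  interpret N: module R N by fact
  show ?thesis
    using assms lin_add[OF assms(3)] lin_neg[OF assms(1-3)]
    by (simp add: M.minus_eq N.minus_eq)
qed

lemma lin_finsum:
  assumes "module R M" "module R N" "f \<in> linear_maps R M N" "g \<in> A \<rightarrow> carrier M" "finite A"
  shows "f (\<Oplus>\<^bsub>M\<^esub>i\<in>A. g i) = (\<Oplus>\<^bsub>N\<^esub>i\<in>A. f (g i))"
proof -
  interpret M: module R M by fact
  interpret N: module R N by fact
  show ?thesis
    using assms(5,4)
  proof (induction A)
    case empty
    then show ?case using lin_zero[OF assms(1-3)] by simp
  next
    case (insert a A)
    then have "g a \<in> carrier M" "g \<in> A \<rightarrow> carrier M"
      by auto
    with insert show ?case
      using lin_closed[OF assms(3)] lin_add[OF assms(3)] by (simp add: Pi_iff)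
  qed
qed

lemma linear_maps_comp:
  assumes "f \<in> linear_maps R M N" "g \<in> linear_maps R N P"
  shows "(\<lambda>x. g (f x)) \<in> linear_maps R M P"
  using linear_mapsD[OF assms(1)] linear_mapsD[OF assms(2)] by (intro linear_mapsI) auto

lemma linear_maps_id: "(\<lambda>x. x) \<in> linear_maps R M M"
  unfolding linear_maps_def by auto

lemma linear_maps_add:
  assumes "module R N" "f \<in> linear_maps R M N" "g \<in> linear_maps R M N"
  shows "(\<lambda>x. f x \<oplus>\<^bsub>N\<^esub> g x) \<in> linear_maps R M N"
proof -
  interpret N: module R N by fact
  show ?thesis
    using linear_mapsD[OF assms(2)] linear_mapsD[OF assms(3)]
    by (intro linear_mapsI) (auto simp: N.a_ac N.smult_r_distr)
qed

lemma linear_maps_smult: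
  assumes "module R N" "f \<in> linear_maps R M N" "r \<in> carrier R"
  shows "(\<lambda>x. r \<odot>\<^bsub>N\<^esub> f x) \<in> linear_maps R M N"
proof -
  interpret N: module R N by fact
  show ?thesis
    using linear_mapsD[OF assms(2)] assms(3)
    by (intro linear_mapsI) (auto simp: N.smult_r_distr N.smult_assoc1[symmetric] N.R.m_comm)
qed

lemma linear_maps_zero:
  assumes "module R N"
  shows "(\<lambda>x. \<zero>\<^bsub>N\<^esub>) \<in> linear_maps R M N"
proof -
  interpret N: module R N by fact
  show ?thesis
    by (intro linear_mapsI) auto
qed

lemma linear_maps_neg:
  assumes "module R N" "f \<in> linear_maps R M N"
  shows "(\<lambda>x. \<ominus>\<^bsub>N\<^esub> f x) \<in> linear_maps R M N"
proof -
  interpret N: module R N by fact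
  have "(\<lambda>x. (\<ominus>\<^bsub>R\<^esub> \<one>\<^bsub>R\<^esub>) \<odot>\<^bsub>N\<^esub> f x) \<in> linear_maps R M N"
    by (rule linear_maps_smult) (use assms in auto)
  then show ?thesis
    using linear_mapsD[OF assms(2)] unfolding linear_maps_def
    by (auto simp: N.uminus_eq_smult)
qed

lemma linear_maps_minus:
  assumes "module R N" "f \<in> linear_maps R M N" "g \<in> linear_maps R M N"
  shows "(\<lambda>x. f x \<ominus>\<^bsub>N\<^esub> g x) \<in> linear_maps R M N"
  using linear_maps_add[OF assms(1,2) linear_maps_neg[OF assms(1,3)]]
  by (simp add: a_minus_def)

lemma linear_maps_cong:
  assumes "f \<in> linear_maps R M N" "module R M" "\<And>x. x \<in> carrier M \<Longrightarrow> g x = f x"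
  shows "g \<in> linear_maps R M N"
proof -
  interpret M: module R M by fact
  show ?thesis
    using assms(3) linear_mapsD[OF assms(1)] by (intro linear_mapsI) auto
qed

lemma linear_maps_finsum:
  assumes "module R M" "module R N" "finite I" "\<And>i. i \<in> I \<Longrightarrow> g i \<in> linear_maps R M N"
  shows "(\<lambda>x. \<Oplus>\<^bsub>N\<^esub>i\<in>I. g i x) \<in> linear_maps R M N"
proof -
  interpret M: module R M by fact
  interpret N: module R N by fact
  have "(\<lambda>x. \<Oplus>\<^bsub>N\<^esub>i\<in>J. g i x) \<in> linear_maps R M N" if "J \<subseteq> I" for J
    using finite_subset[OF that assms(3)] that
  proof (induction J rule: finite_induct)
    case empty
    show ?case using linear_maps_zero[OF assms(2)] by simp
  next
    case (insert j J)
    then have l: "(\<lambda>x. g j x \<oplus>\<^bsub>N\<^esub> (\<Oplus>\<^bsub>N\<^esub>i\<in>J. g i x)) \<in> linear_maps R M N"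
      by (intro linear_maps_add assms) auto
    show ?case
      by (rule linear_maps_cong[OF l assms(1)])
        (use insert lin_closed[OF assms(4)] in \<open>auto intro!: N.finsum_insert\<close>)
  qed
  then show ?thesis by blast
qed

definition ring_module :: "('r, 's) ring_scheme \<Rightarrow> ('r, 'r) module" where
  "ring_module R = \<lparr>carrier = carrier R, mult = mult R, one = one R, zero = zero R, add = add R, smult = mult R\<rparr>"

lemma ring_module_simps [simp]:
  "carrier (ring_module R) = carrier R" "add (ring_module R) = add R" "zero (ring_module R) = zero R"
  "smult (ring_module R) = mult R"
  by (simp_all add: ring_module_def)

lemma module_ring_module:
  assumes "cring R"
  shows "module R (ring_module R)"
proof -
  interpret R: cring R by fact
  have "abelian_group (ring_module R)"
    by (rule abelian_groupI) (auto simp: R.a_ac intro: R.a_inv_closed R.l_neg)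
  then show ?thesis
    by (intro moduleI assms) (auto simp: R.l_distr R.r_distr R.m_assoc)
qed

lemma finsum_ring_module:
  assumes "cring R" "finite J" "\<And>j. j \<in> J \<Longrightarrow> f j \<in> carrier R"
  shows "(\<Oplus>\<^bsub>ring_module R\<^esub>j\<in>J. f j) = (\<Oplus>\<^bsub>R\<^esub>j\<in>J. f j)"
proof -
  interpret R: cring R by fact
  interpret N: module R "ring_module R" by (rule module_ring_module[OF assms(1)])
  show ?thesis
    using assms(2,3)
  proof (induction J)
    case (insert a J)
    have "(\<Oplus>\<^bsub>ring_module R\<^esub>j\<in>insert a J. f j) = f a \<oplus>\<^bsub>ring_module R\<^esub> (\<Oplus>\<^bsub>ring_module R\<^esub>j\<in>J. f j)"
      using insert by (intro N.M.finsum_insert) auto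
    moreover have "(\<Oplus>\<^bsub>R\<^esub>j\<in>insert a J. f j) = f a \<oplus>\<^bsub>R\<^esub> (\<Oplus>\<^bsub>R\<^esub>j\<in>J. f j)"
      using insert by (intro R.finsum_insert) auto
    ultimately show ?case using insert by simp
  qed simp
qed

section \<open>Free modules\<close>

lemma free_module_simps [simp]:
  "\<zero>\<^bsub>free_module R X\<^esub> = (\<lambda>x. \<zero>\<^bsub>R\<^esub>)"
  "f \<oplus>\<^bsub>free_module R X\<^esub> g = (\<lambda>x. f x \<oplus>\<^bsub>R\<^esub> g x)"
  "r \<odot>\<^bsub>free_module R X\<^esub> f = (\<lambda>x. r \<otimes>\<^bsub>R\<^esub> f x)"
  by (simp_all add: free_module_def)

lemma free_module_carrier:
  "f \<in> carrier (free_module R X) \<longleftrightarrow>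
     (\<forall>x. f x \<in> carrier R) \<and> finite {x. f x \<noteq> \<zero>\<^bsub>R\<^esub>} \<and> {x. f x \<noteq> \<zero>\<^bsub>R\<^esub>} \<subseteq> X"
  by (simp add: free_module_def)

lemma module_free_module:
  assumes "cring R"
  shows "module R (free_module R X)"
proof -
  interpret R: cring R by fact
  let ?F = "free_module R X"
  have add: "(\<lambda>x. f x \<oplus>\<^bsub>R\<^esub> g x) \<in> carrier ?F" if "f \<in> carrier ?F" "g \<in> carrier ?F" for f g
  proof -
    have "{x. f x \<oplus>\<^bsub>R\<^esub> g x \<noteq> \<zero>\<^bsub>R\<^esub>} \<subseteq> {x. f x \<noteq> \<zero>\<^bsub>R\<^esub>} \<union> {x. g x \<noteq> \<zero>\<^bsub>R\<^esub>}"
      by auto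
    with that show ?thesis
      unfolding free_module_carrier by (meson R.a_closed finite_UnI finite_subset le_sup_iff order_trans)
  qed
  have sm: "(\<lambda>x. r \<otimes>\<^bsub>R\<^esub> f x) \<in> carrier ?F" if "f \<in> carrier ?F" "r \<in> carrier R" for f r
  proof -
    have "{x. r \<otimes>\<^bsub>R\<^esub> f x \<noteq> \<zero>\<^bsub>R\<^esub>} \<subseteq> {x. f x \<noteq> \<zero>\<^bsub>R\<^esub>}"
      using that by auto
    with that show ?thesis
      unfolding free_module_carrier by (meson R.m_closed finite_subset order_trans)
  qed
  have ab: "abelian_group ?F"
  proof (rule abelian_groupI)
    fix f assume f: "f \<in> carrier ?F"
    have "(\<lambda>x. (\<ominus>\<^bsub>R\<^esub> \<one>\<^bsub>R\<^esub>) \<otimes>\<^bsub>R\<^esub> f x) \<in> carrier ?F"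
      by (rule sm[OF f]) simp
    moreover have "(\<lambda>x. (\<ominus>\<^bsub>R\<^esub> \<one>\<^bsub>R\<^esub>) \<otimes>\<^bsub>R\<^esub> f x) \<oplus>\<^bsub>?F\<^esub> f = \<zero>\<^bsub>?F\<^esub>"
      using f by (auto simp: free_module_carrier R.l_minus R.l_neg)
    ultimately show "\<exists>g\<in>carrier ?F. g \<oplus>\<^bsub>?F\<^esub> f = \<zero>\<^bsub>?F\<^esub>"
      by blast
  next
    fix f g assume "f \<in> carrier ?F" "g \<in> carrier ?F"
    then show "f \<oplus>\<^bsub>?F\<^esub> g \<in> carrier ?F" using add by simp
  qed (auto simp: free_module_carrier R.a_ac)
  show ?thesis
    by (rule moduleI)
      (use assms ab sm in \<open>auto simp: free_module_carrier R.l_distr R.r_distr R.m_assoc\<close>)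
qed

lemma free_gen_closed:
  assumes "cring R" "x \<in> X"
  shows "free_gen R x \<in> carrier (free_module R X)"
proof -
  interpret R: cring R by fact
  have "{y. free_gen R x y \<noteq> \<zero>\<^bsub>R\<^esub>} \<subseteq> {x}"
    by (auto simp: free_gen_def)
  with assms(2) show ?thesis
    unfolding free_module_carrier by (auto simp: free_gen_def intro: finite_subset)
qed

lemma free_module_induct [consumes 2, case_names zero add smult gen]:
  assumes "cring R" "f \<in> carrier (free_module R X)"
    and zero: "P (\<lambda>x. \<zero>\<^bsub>R\<^esub>)"
    and add: "\<And>f g. f \<in> carrier (free_module R X) \<Longrightarrow> g \<in> carrier (free_module R X) \<Longrightarrow>
      P f \<Longrightarrow> P g \<Longrightarrow> P (\<lambda>x. f x \<oplus>\<^bsub>R\<^esub> g x)"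
    and smult: "\<And>r f. r \<in> carrier R \<Longrightarrow> f \<in> carrier (free_module R X) \<Longrightarrow> P f \<Longrightarrow> P (\<lambda>x. r \<otimes>\<^bsub>R\<^esub> f x)"
    and gen: "\<And>x. x \<in> X \<Longrightarrow> P (free_gen R x)"
  shows "P f"
proof -
  interpret R: cring R by fact
  interpret F: module R "free_module R X" by (rule module_free_module[OF assms(1)])
  have "finite S \<Longrightarrow> f \<in> carrier (free_module R X) \<Longrightarrow> {x. f x \<noteq> \<zero>\<^bsub>R\<^esub>} \<subseteq> S \<Longrightarrow> S \<subseteq> X \<Longrightarrow> P f"
    for S f
  proof (induction S arbitrary: f rule: finite_induct)
    case empty
    then have "f = (\<lambda>x. \<zero>\<^bsub>R\<^esub>)" by auto
    then show ?case using zero by simp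
  next
    case (insert a S)
    define f1 where "f1 = (\<lambda>x. if x = a then \<zero>\<^bsub>R\<^esub> else f x)"
    define f2 where "f2 = (\<lambda>x. f a \<otimes>\<^bsub>R\<^esub> free_gen R a x)"
    have fR: "f x \<in> carrier R" for x
      using insert.prems by (auto simp: free_module_carrier)
    have sub: "{x. f1 x \<noteq> \<zero>\<^bsub>R\<^esub>} \<subseteq> {x. f x \<noteq> \<zero>\<^bsub>R\<^esub>}"
      by (auto simp: f1_def)
    have f1: "f1 \<in> carrier (free_module R X)"
      using insert.prems(1) finite_subset[OF sub] sub unfolding free_module_carrier
      by (auto simp: f1_def)
    have "P f1"
      by (rule insert.IH[OF f1]) (use insert.prems in \<open>auto simp: f1_def\<close>)
    have ga: "free_gen R a \<in> carrier (free_module R X)"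
      using insert.prems by (intro free_gen_closed assms) auto
    then have f2: "f2 \<in> carrier (free_module R X)"
      using F.smult_closed[OF fR ga] by (simp add: f2_def)
    have "P f2"
      unfolding f2_def using insert.prems by (intro smult[OF fR ga] gen) auto
    have "f = (\<lambda>x. f1 x \<oplus>\<^bsub>R\<^esub> f2 x)"
      using fR by (auto simp: f1_def f2_def free_gen_def)
    then show ?case
      using add[OF f1 f2 \<open>P f1\<close> \<open>P f2\<close>] by simp
  qed
  then show ?thesis
    using assms(2) unfolding free_module_carrier by blast
qed

lemma free_lift_superset:
  assumes "module R W" "\<phi> \<in> X \<rightarrow> carrier W" "f \<in> carrier (free_module R X)"
    and "finite S" "{x. f x \<noteq> \<zero>\<^bsub>R\<^esub>} \<subseteq> S" "S \<subseteq> X"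
  shows "free_lift R W \<phi> f = (\<Oplus>\<^bsub>W\<^esub>x\<in>S. f x \<odot>\<^bsub>W\<^esub> \<phi> x)"
proof -
  interpret W: module R W by fact
  show ?thesis
    unfolding free_lift_def
    by (rule W.add.finprod_mono_neutral_cong_left)
      (use assms in \<open>auto simp: free_module_carrier Pi_iff subset_iff\<close>)
qed

lemma free_lift_linear:
  assumes "module R W" "\<phi> \<in> X \<rightarrow> carrier W"
  shows "free_lift R W \<phi> \<in> linear_maps R (free_module R X) W"
proof (rule linear_mapsI)
  interpret W: module R W by fact
  interpret F: module R "free_module R X" by (rule module_free_module) (rule W.R.cring_axioms)
  let ?F = "free_module R X"
  have cl: "(\<lambda>x. f x \<odot>\<^bsub>W\<^esub> \<phi> x) \<in> S \<rightarrow> carrier W" if "f \<in> carrier ?F" "S \<subseteq> X" for f S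
    using that assms(2) by (auto simp: free_module_carrier Pi_iff)
  fix f assume f: "f \<in> carrier ?F"
  show "free_lift R W \<phi> f \<in> carrier W"
    unfolding free_lift_def using f cl[OF f] by (auto simp: free_module_carrier)
  {
    fix g assume g: "g \<in> carrier ?F"
    let ?S = "{x. f x \<noteq> \<zero>\<^bsub>R\<^esub>} \<union> {x. g x \<noteq> \<zero>\<^bsub>R\<^esub>}"
    have S: "finite ?S" "?S \<subseteq> X"
      using f g by (auto simp: free_module_carrier)
    have fg: "f \<oplus>\<^bsub>?F\<^esub> g \<in> carrier ?F"
      using f g by (rule F.a_closed)
    have "free_lift R W \<phi> (f \<oplus>\<^bsub>?F\<^esub> g) = (\<Oplus>\<^bsub>W\<^esub>x\<in>?S. (f x \<oplus>\<^bsub>R\<^esub> g x) \<odot>\<^bsub>W\<^esub> \<phi> x)"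
      by (subst free_lift_superset[OF assms fg S(1) _ S(2)]) auto
    also have "\<dots> = (\<Oplus>\<^bsub>W\<^esub>x\<in>?S. f x \<odot>\<^bsub>W\<^esub> \<phi> x \<oplus>\<^bsub>W\<^esub> g x \<odot>\<^bsub>W\<^esub> \<phi> x)"
      by (rule W.finsum_cong')
        (use f g assms(2) S in \<open>auto simp: free_module_carrier W.smult_l_distr Pi_iff subset_iff\<close>)
    also have "\<dots> = (\<Oplus>\<^bsub>W\<^esub>x\<in>?S. f x \<odot>\<^bsub>W\<^esub> \<phi> x) \<oplus>\<^bsub>W\<^esub> (\<Oplus>\<^bsub>W\<^esub>x\<in>?S. g x \<odot>\<^bsub>W\<^esub> \<phi> x)"
      by (rule W.finsum_addf) (use cl[OF f S(2)] cl[OF g S(2)] in auto)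
    also have "\<dots> = free_lift R W \<phi> f \<oplus>\<^bsub>W\<^esub> free_lift R W \<phi> g"
      using free_lift_superset[OF assms f S(1) _ S(2)] free_lift_superset[OF assms g S(1) _ S(2)]
      by auto
    finally show "free_lift R W \<phi> (f \<oplus>\<^bsub>?F\<^esub> g) = free_lift R W \<phi> f \<oplus>\<^bsub>W\<^esub> free_lift R W \<phi> g" .
  }
  fix r assume r: "r \<in> carrier R"
  let ?S = "{x. f x \<noteq> \<zero>\<^bsub>R\<^esub>}"
  have S: "finite ?S" "?S \<subseteq> X"
    using f by (auto simp: free_module_carrier)
  have rf: "r \<odot>\<^bsub>?F\<^esub> f \<in> carrier ?F"
    using r f by (rule F.smult_closed)
  have "free_lift R W \<phi> (r \<odot>\<^bsub>?F\<^esub> f) = (\<Oplus>\<^bsub>W\<^esub>x\<in>?S. (r \<otimes>\<^bsub>R\<^esub> f x) \<odot>\<^bsub>W\<^esub> \<phi> x)"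
    by (subst free_lift_superset[OF assms rf S(1) _ S(2)]) (use r in auto)
  also have "\<dots> = (\<Oplus>\<^bsub>W\<^esub>x\<in>?S. r \<odot>\<^bsub>W\<^esub> (f x \<odot>\<^bsub>W\<^esub> \<phi> x))"
    by (rule W.finsum_cong')
      (use f r assms(2) S in \<open>auto simp: free_module_carrier W.smult_assoc1 Pi_iff subset_iff\<close>)
  also have "\<dots> = r \<odot>\<^bsub>W\<^esub> free_lift R W \<phi> f"
    unfolding free_lift_def by (rule W.finsum_smult_ldistr[symmetric]) (use S r cl[OF f S(2)] in auto)
  finally show "free_lift R W \<phi> (r \<odot>\<^bsub>?F\<^esub> f) = r \<odot>\<^bsub>W\<^esub> free_lift R W \<phi> f" .
qed

lemma free_lift_gen:
  assumes "module R W" "\<phi> \<in> X \<rightarrow> carrier W" "x \<in> X"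
  shows "free_lift R W \<phi> (free_gen R x) = \<phi> x"
proof -
  interpret W: module R W by fact
  have g: "free_gen R x \<in> carrier (free_module R X)"
    by (rule free_gen_closed) (use assms W.R.cring_axioms in auto)
  have "free_lift R W \<phi> (free_gen R x) = (\<Oplus>\<^bsub>W\<^esub>y\<in>{x}. free_gen R x y \<odot>\<^bsub>W\<^esub> \<phi> y)"
    by (rule free_lift_superset[OF assms(1,2) g]) (use assms in \<open>auto simp: free_gen_def\<close>)
  then show ?thesis
    using assms by (simp add: free_gen_def Pi_iff)
qed

lemma free_module_linear_eqI:
  assumes "module R W" "f \<in> linear_maps R (free_module R X) W" "g \<in> linear_maps R (free_module R X) W"
    and "\<And>x. x \<in> X \<Longrightarrow> f (free_gen R x) = g (free_gen R x)" "Z \<in> carrier (free_module R X)"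
  shows "f Z = g Z"
proof -
  interpret W: module R W by fact
  note F = module_free_module[OF W.R.cring_axioms, of X]
  note mD = linear_mapsD[of _ R "free_module R X" W, simplified]
  show ?thesis
    using W.R.cring_axioms assms(5)
  proof (induction rule: free_module_induct)
    case zero
    show ?case
      using lin_zero[OF F assms(1,2)] lin_zero[OF F assms(1,3)] by simp
  next
    case (add a b)
    then show ?case
      using mD(2)[OF assms(2)] mD(2)[OF assms(3)] by simp
  next
    case (smult r a)
    then show ?case
      using mD(3)[OF assms(2)] mD(3)[OF assms(3)] by simp
  qed (rule assms(4))
qed

lemma free_lift_finsum:
  assumes "module R W" "v \<in> U \<rightarrow> carrier W" "q \<in> carrier (free_module R U)" "finite U"
  shows "(\<Oplus>\<^bsub>W\<^esub>x\<in>U. q x \<odot>\<^bsub>W\<^esub> v x) = free_lift R W v q"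
  using free_lift_superset[OF assms _ order_refl] assms(3) by (simp add: free_module_carrier)

section \<open>Submodules and quotients\<close>

lemma submodule_Int_family:
  assumes "module R M" "\<H> \<noteq> {}" "\<And>H. H \<in> \<H> \<Longrightarrow> submodule H R M"
  shows "submodule (\<Inter>\<H>) R M"
proof -
  interpret M: module R M by fact
  note E = M.submoduleE[OF assms(3)]
  have z: "\<zero>\<^bsub>M\<^esub> \<in> H" if "H \<in> \<H>" for H
  proof -
    interpret H: submodule H R M using assms(3)[OF that] .
    show ?thesis using H.one_closed by simp
  qed
  show ?thesis
    by (rule M.submoduleI) (use assms(2) E z in \<open>auto simp: subset_iff\<close>)
qed

lemma (in module) submodule_generated_submodule:
  assumes "S \<subseteq> carrier M"
  shows "submodule (submodule_generated R M S) R M"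
  unfolding submodule_generated_def
  by (rule submodule_Int_family) (use module_axioms carrier_is_submodule assms in auto)

lemma submodule_generated_incl: "S \<subseteq> submodule_generated R M S"
  unfolding submodule_generated_def by auto

lemma submodule_generated_minimal:
  "submodule H R M \<Longrightarrow> S \<subseteq> H \<Longrightarrow> submodule_generated R M S \<subseteq> H"
  unfolding submodule_generated_def by auto

lemma (in module) submoduleI':
  assumes "H \<subseteq> carrier M" "\<zero>\<^bsub>M\<^esub> \<in> H"
    and "\<And>a b. a \<in> H \<Longrightarrow> b \<in> H \<Longrightarrow> a \<oplus>\<^bsub>M\<^esub> b \<in> H"
    and "\<And>r a. r \<in> carrier R \<Longrightarrow> a \<in> H \<Longrightarrow> r \<odot>\<^bsub>M\<^esub> a \<in> H"
  shows "submodule H R M"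
proof (rule submoduleI)
  fix a assume "a \<in> H"
  with assms(4)[of "\<ominus> \<one>" a] assms(1) show "\<ominus>\<^bsub>M\<^esub> a \<in> H"
    by (auto simp: uminus_eq_smult)
qed (use assms in auto)

lemma (in module) submodule_generated_induct [consumes 2, case_names incl zero add smult]:
  assumes "S \<subseteq> carrier M" "x \<in> submodule_generated R M S"
    and "\<And>x. x \<in> S \<Longrightarrow> P x" "P \<zero>\<^bsub>M\<^esub>"
    and "\<And>x y. x \<in> carrier M \<Longrightarrow> y \<in> carrier M \<Longrightarrow> P x \<Longrightarrow> P y \<Longrightarrow> P (x \<oplus>\<^bsub>M\<^esub> y)"
    and "\<And>r x. r \<in> carrier R \<Longrightarrow> x \<in> carrier M \<Longrightarrow> P x \<Longrightarrow> P (r \<odot>\<^bsub>M\<^esub> x)"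
  shows "P x"
proof -
  have "submodule {x \<in> carrier M. P x} R M"
    by (rule submoduleI') (use assms in auto)
  moreover have "S \<subseteq> {x \<in> carrier M. P x}"
    using assms by auto
  ultimately show ?thesis
    using submodule_generated_minimal assms(2) by blast
qed

locale module_quotient = module R M + submodule H R M for R (structure) and M and H
begin

lemma H_abelian_subgroup: "abelian_subgroup H M"
  by (rule abelian_subgroupI3)
    (use is_subgroup M.abelian_group_axioms in \<open>auto intro: additive_subgroup.intro\<close>)

sublocale H: abelian_subgroup H M by (rule H_abelian_subgroup)

lemma quotient_simps:
  "\<zero>\<^bsub>quotient_module M H\<^esub> = H"
  "carrier (quotient_module M H) = a_rcosets\<^bsub>M\<^esub> H"
  "C \<oplus>\<^bsub>quotient_module M H\<^esub> D = C <+>\<^bsub>M\<^esub> D"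
  by (simp_all add: quotient_module_def)

lemma quotient_carrierE:
  assumes "C \<in> carrier (quotient_module M H)"
  obtains x where "x \<in> carrier M" "C = H +>\<^bsub>M\<^esub> x"
  using assms by (auto simp: quotient_simps A_RCOSETS_def')

lemma coset_closed: "x \<in> carrier M \<Longrightarrow> H +>\<^bsub>M\<^esub> x \<in> carrier (quotient_module M H)"
  by (auto simp: quotient_simps A_RCOSETS_def')

lemma coset_eq_iff:
  assumes "x \<in> carrier M" "y \<in> carrier M"
  shows "H +>\<^bsub>M\<^esub> x = H +>\<^bsub>M\<^esub> y \<longleftrightarrow> x \<ominus>\<^bsub>M\<^esub> y \<in> H"
proof
  assume "H +>\<^bsub>M\<^esub> x = H +>\<^bsub>M\<^esub> y"
  then have "x \<in> H +>\<^bsub>M\<^esub> y"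
    using H.a_rcos_self[OF assms(1)] by simp
  then show "x \<ominus>\<^bsub>M\<^esub> y \<in> H"
    using H.a_rcos_module[OF assms(2,1)] by (simp add: M.minus_eq)
next
  assume "x \<ominus>\<^bsub>M\<^esub> y \<in> H"
  then have "x \<in> H +>\<^bsub>M\<^esub> y"
    using H.a_rcos_module[OF assms(2,1)] by (simp add: M.minus_eq)
  from H.a_repr_independence'[OF this assms(2)] show "H +>\<^bsub>M\<^esub> x = H +>\<^bsub>M\<^esub> y"
    by (rule sym)
qed

lemma coset_add:
  "x \<in> carrier M \<Longrightarrow> y \<in> carrier M \<Longrightarrow>
     (H +>\<^bsub>M\<^esub> x) \<oplus>\<^bsub>quotient_module M H\<^esub> (H +>\<^bsub>M\<^esub> y) = H +>\<^bsub>M\<^esub> (x \<oplus>\<^bsub>M\<^esub> y)"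
  by (simp add: quotient_simps H.a_rcos_sum)

lemma coset_smult:
  assumes "r \<in> carrier R" "x \<in> carrier M"
  shows "r \<odot>\<^bsub>quotient_module M H\<^esub> (H +>\<^bsub>M\<^esub> x) = H +>\<^bsub>M\<^esub> (r \<odot>\<^bsub>M\<^esub> x)"
proof -
  have "H +>\<^bsub>M\<^esub> (r \<odot>\<^bsub>M\<^esub> y) = H +>\<^bsub>M\<^esub> (r \<odot>\<^bsub>M\<^esub> x)" if y: "y \<in> H +>\<^bsub>M\<^esub> x" for y
  proof -
    have yM: "y \<in> carrier M"
      using y assms(2) H.a_elemrcos_carrier by blast
    have "y \<ominus>\<^bsub>M\<^esub> x \<in> H"
      using H.a_rcos_module[OF assms(2) yM] y by (simp add: M.minus_eq)
    then have "r \<odot>\<^bsub>M\<^esub> (y \<ominus>\<^bsub>M\<^esub> x) \<in> H"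
      using assms(1) by auto
    then show ?thesis
      using assms yM by (simp add: coset_eq_iff M.minus_eq smult_r_distr smult_r_minus)
  qed
  then have "(\<Union>y\<in>H +>\<^bsub>M\<^esub> x. H +>\<^bsub>M\<^esub> (r \<odot>\<^bsub>M\<^esub> y)) = (\<Union>y\<in>H +>\<^bsub>M\<^esub> x. H +>\<^bsub>M\<^esub> (r \<odot>\<^bsub>M\<^esub> x))"
    by (rule SUP_cong[OF refl])
  also have "\<dots> = H +>\<^bsub>M\<^esub> (r \<odot>\<^bsub>M\<^esub> x)"
    using H.a_rcos_self[OF assms(2)] by blast
  finally show ?thesis
    by (simp add: quotient_module_def)
qed

lemma module_quotient_module: "module R (quotient_module M H)"
proof (rule moduleI)
  let ?Q = "quotient_module M H"
  show "abelian_group ?Q"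
  proof (rule abelian_groupI)
    show "\<zero>\<^bsub>?Q\<^esub> \<in> carrier ?Q"
      using coset_closed[OF M.zero_closed] H.a_subset by (simp add: quotient_simps)
  next
    fix C assume "C \<in> carrier ?Q"
    then obtain x where x: "x \<in> carrier M" "C = H +>\<^bsub>M\<^esub> x"
      by (rule quotient_carrierE)
    have H: "\<zero>\<^bsub>?Q\<^esub> = H +>\<^bsub>M\<^esub> \<zero>\<^bsub>M\<^esub>"
      using H.a_subset by (simp add: quotient_simps)
    show "\<zero>\<^bsub>?Q\<^esub> \<oplus>\<^bsub>?Q\<^esub> C = C"
      unfolding H x(2) using x(1) by (simp add: coset_add)
    show "\<exists>D\<in>carrier ?Q. D \<oplus>\<^bsub>?Q\<^esub> C = \<zero>\<^bsub>?Q\<^esub>"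
      unfolding H x(2) using x(1)
      by (intro bexI[of _ "H +>\<^bsub>M\<^esub> (\<ominus>\<^bsub>M\<^esub> x)"]) (auto simp: coset_add M.l_neg intro: coset_closed)
  next
    fix C D assume "C \<in> carrier ?Q" "D \<in> carrier ?Q"
    then obtain x y where x: "x \<in> carrier M" "C = H +>\<^bsub>M\<^esub> x" and y: "y \<in> carrier M" "D = H +>\<^bsub>M\<^esub> y"
      by (meson quotient_carrierE)
    show "C \<oplus>\<^bsub>?Q\<^esub> D \<in> carrier ?Q"
      unfolding x(2) y(2) using x(1) y(1) by (simp add: coset_add coset_closed)
    show "C \<oplus>\<^bsub>?Q\<^esub> D = D \<oplus>\<^bsub>?Q\<^esub> C"
      unfolding x(2) y(2) using x(1) y(1) by (simp add: coset_add M.a_comm)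
    fix E assume "E \<in> carrier ?Q"
    then obtain z where z: "z \<in> carrier M" "E = H +>\<^bsub>M\<^esub> z"
      by (meson quotient_carrierE)
    show "C \<oplus>\<^bsub>?Q\<^esub> D \<oplus>\<^bsub>?Q\<^esub> E = C \<oplus>\<^bsub>?Q\<^esub> (D \<oplus>\<^bsub>?Q\<^esub> E)"
      unfolding x(2) y(2) z(2) using x(1) y(1) z(1) by (simp add: coset_add M.a_assoc)
  qed
next
  let ?Q = "quotient_module M H"
  fix r C assume r: "r \<in> carrier R" and "C \<in> carrier ?Q"
  then obtain x where x: "x \<in> carrier M" "C = H +>\<^bsub>M\<^esub> x"
    by (meson quotient_carrierE)
  show "r \<odot>\<^bsub>?Q\<^esub> C \<in> carrier ?Q"
    unfolding x(2) using x(1) r by (simp add: coset_smult coset_closed)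
  {
    fix s assume s: "s \<in> carrier R"
    show "(r \<oplus> s) \<odot>\<^bsub>?Q\<^esub> C = r \<odot>\<^bsub>?Q\<^esub> C \<oplus>\<^bsub>?Q\<^esub> s \<odot>\<^bsub>?Q\<^esub> C"
      unfolding x(2) using x(1) r s by (simp add: coset_smult coset_add smult_l_distr)
    show "(r \<otimes> s) \<odot>\<^bsub>?Q\<^esub> C = r \<odot>\<^bsub>?Q\<^esub> (s \<odot>\<^bsub>?Q\<^esub> C)"
      unfolding x(2) using x(1) r s by (simp add: coset_smult smult_assoc1)
  }
  fix D assume "D \<in> carrier ?Q"
  then obtain y where y: "y \<in> carrier M" "D = H +>\<^bsub>M\<^esub> y"
    by (meson quotient_carrierE)
  show "r \<odot>\<^bsub>?Q\<^esub> (C \<oplus>\<^bsub>?Q\<^esub> D) = r \<odot>\<^bsub>?Q\<^esub> C \<oplus>\<^bsub>?Q\<^esub> r \<odot>\<^bsub>?Q\<^esub> D"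
    unfolding x(2) y(2) using x(1) y(1) r by (simp add: coset_smult coset_add smult_r_distr)
next
  fix C assume "C \<in> carrier (quotient_module M H)"
  then obtain x where x: "x \<in> carrier M" "C = H +>\<^bsub>M\<^esub> x"
    by (meson quotient_carrierE)
  show "\<one> \<odot>\<^bsub>quotient_module M H\<^esub> C = C"
    unfolding x(2) using x(1) by (simp add: coset_smult)
qed (rule R.cring_axioms)

end

declare free_module_simps [simp del]

section \<open>Modules given by a presentation\<close>

definition pres_proj ::
  "('r, 's) ring_scheme \<Rightarrow> 'x set \<Rightarrow> ('x \<Rightarrow> 'r) set \<Rightarrow> ('x \<Rightarrow> 'r) \<Rightarrow> ('x \<Rightarrow> 'r) set" where
  "pres_proj R X Rel Z =
     submodule_generated R (free_module R X) Rel +>\<^bsub>free_module R X\<^esub> Z"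

locale presentation = cring R for R (structure) +
  fixes X :: "'x set" and Rel :: "('x \<Rightarrow> 'a) set"
  assumes rels_closed: "Rel \<subseteq> carrier (free_module R X)"
begin

abbreviation "FM \<equiv> free_module R X"
abbreviation "PM \<equiv> pres_module R X Rel"

sublocale F: module R FM by (rule module_free_module[OF is_cring])

sublocale Q: module_quotient R FM "submodule_generated R FM Rel"
  by (intro module_quotient.intro F.module_axioms F.submodule_generated_submodule rels_closed)

lemma module_pres_module: "module R PM"
  unfolding pres_module_def by (rule Q.module_quotient_module)

sublocale P: module R PM by (rule module_pres_module)

lemma pres_proj_linear: "pres_proj R X Rel \<in> linear_maps R FM PM"
  unfolding pres_proj_def pres_module_def
  by (rule linear_mapsI) (simp_all add: Q.coset_closed Q.coset_add Q.coset_smult)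

lemma pres_proj_gen: "pres_proj R X Rel (free_gen R x) = pres_class R X Rel x"
  by (simp add: pres_proj_def pres_class_def)

lemma pres_carrierE:
  assumes "C \<in> carrier PM"
  obtains Z where "Z \<in> carrier FM" "C = pres_proj R X Rel Z"
  using assms unfolding pres_proj_def pres_module_def by (rule Q.quotient_carrierE)

lemma pres_proj_eq_zero_iff:
  assumes "Z \<in> carrier FM"
  shows "pres_proj R X Rel Z = \<zero>\<^bsub>PM\<^esub> \<longleftrightarrow> Z \<in> submodule_generated R FM Rel"
proof -
  have "\<zero>\<^bsub>PM\<^esub> = pres_proj R X Rel \<zero>\<^bsub>FM\<^esub>"
    using lin_zero[OF F.module_axioms module_pres_module pres_proj_linear] by simp
  then show ?thesis
    using Q.coset_eq_iff[OF assms F.zero_closed] assms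
    by (simp add: pres_proj_def F.minus_eq F.uminus_eq_smult)
qed

lemma pres_class_closed: "x \<in> X \<Longrightarrow> pres_class R X Rel x \<in> carrier PM"
  unfolding pres_proj_gen[symmetric]
  by (rule lin_closed[OF pres_proj_linear]) (rule free_gen_closed[OF is_cring])

lemma pres_induct [consumes 1, case_names zero add smult gen]:
  assumes "C \<in> carrier PM"
    and zero: "P \<zero>\<^bsub>PM\<^esub>"
    and add: "\<And>C D. C \<in> carrier PM \<Longrightarrow> D \<in> carrier PM \<Longrightarrow> P C \<Longrightarrow> P D \<Longrightarrow> P (C \<oplus>\<^bsub>PM\<^esub> D)"
    and smult: "\<And>r C. r \<in> carrier R \<Longrightarrow> C \<in> carrier PM \<Longrightarrow> P C \<Longrightarrow> P (r \<odot>\<^bsub>PM\<^esub> C)"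
    and gen: "\<And>x. x \<in> X \<Longrightarrow> P (pres_class R X Rel x)"
  shows "P C"
proof -
  obtain Z where Z: "Z \<in> carrier FM" "C = pres_proj R X Rel Z"
    using assms(1) by (rule pres_carrierE)
  note pp = linear_mapsD[OF pres_proj_linear]
  have "P (pres_proj R X Rel Z)"
    using is_cring Z(1)
  proof (induction rule: free_module_induct)
    case zero
    then show ?case
      using lin_zero[OF F.module_axioms module_pres_module pres_proj_linear] assms(2) by (simp add: free_module_simps)
  next
    case (add f g)
    then show ?case
      using pp(2)[of f g] assms(3)[OF pp(1) pp(1), of f g] by (simp add: free_module_simps)
  next
    case (smult r f)
    then show ?case
      using pp(3)[of r f] assms(4)[OF _ pp(1), of r f] by (simp add: free_module_simps)
  next
    case (gen x)
    then show ?case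
      using assms(5) by (simp add: pres_proj_gen)
  qed
  then show ?thesis using Z by simp
qed

lemma pres_linear_eqI:
  assumes "module R W" "f \<in> linear_maps R PM W" "g \<in> linear_maps R PM W"
    and "\<And>x. x \<in> X \<Longrightarrow> f (pres_class R X Rel x) = g (pres_class R X Rel x)" "C \<in> carrier PM"
  shows "f C = g C"
  using assms(5)
proof (induction rule: pres_induct)
  case zero
  then show ?case
    using lin_zero[OF module_pres_module assms(1,2)] lin_zero[OF module_pres_module assms(1,3)] by simp
qed (simp_all add: linear_mapsD[OF assms(2)] linear_mapsD[OF assms(3)] assms(4))

lemma free_lift_kills:
  assumes "module R W" "\<phi> \<in> X \<rightarrow> carrier W" "\<And>\<rho>. \<rho> \<in> Rel \<Longrightarrow> free_lift R W \<phi> \<rho> = \<zero>\<^bsub>W\<^esub>"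
    and "Z \<in> submodule_generated R FM Rel"
  shows "free_lift R W \<phi> Z = \<zero>\<^bsub>W\<^esub>"
proof -
  interpret W: module R W by fact
  note fl = free_lift_linear[OF assms(1,2)]
  show ?thesis
    using rels_closed assms(4)
  proof (induction rule: F.submodule_generated_induct)
    case zero
    show ?case by (rule lin_zero[OF F.module_axioms assms(1) fl])
  qed (use assms(3) in \<open>simp_all add: linear_mapsD[OF fl]\<close>)
qed

lemma pres_lift_proj:
  assumes "module R W" "\<phi> \<in> X \<rightarrow> carrier W" "\<And>\<rho>. \<rho> \<in> Rel \<Longrightarrow> free_lift R W \<phi> \<rho> = \<zero>\<^bsub>W\<^esub>"
    and "Z \<in> carrier FM"
  shows "pres_lift R W \<phi> (pres_proj R X Rel Z) = free_lift R W \<phi> Z"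
proof -
  interpret W: module R W by fact
  note fl = free_lift_linear[OF assms(1,2)]
  have "free_lift R W \<phi> Y = free_lift R W \<phi> Z" if Y: "Y \<in> pres_proj R X Rel Z" for Y
  proof -
    have YF: "Y \<in> carrier FM"
      using Y assms(4) Q.H.a_elemrcos_carrier unfolding pres_proj_def by blast
    have "Y \<ominus>\<^bsub>FM\<^esub> Z \<in> submodule_generated R FM Rel"
      using Q.H.a_rcos_module[OF assms(4) YF] Y unfolding pres_proj_def
      by (simp add: F.minus_eq)
    then have "free_lift R W \<phi> (Y \<ominus>\<^bsub>FM\<^esub> Z) = \<zero>\<^bsub>W\<^esub>"
      by - (rule free_lift_kills[OF assms(1-3)])
    then show ?thesis
      using lin_minus[OF F.module_axioms assms(1) fl YF assms(4)]
        lin_closed[OF fl YF] lin_closed[OF fl assms(4)] W.minus_eq_zero_iff by simp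
  qed
  moreover have "Z \<in> pres_proj R X Rel Z"
    using Q.H.a_rcos_self[OF assms(4)] unfolding pres_proj_def by simp
  ultimately have "free_lift R W \<phi> ` pres_proj R X Rel Z = {free_lift R W \<phi> Z}"
    by blast
  then show ?thesis
    by (simp add: pres_lift_def)
qed

lemma pres_lift_linear:
  assumes "module R W" "\<phi> \<in> X \<rightarrow> carrier W" "\<And>\<rho>. \<rho> \<in> Rel \<Longrightarrow> free_lift R W \<phi> \<rho> = \<zero>\<^bsub>W\<^esub>"
  shows "pres_lift R W \<phi> \<in> linear_maps R PM W"
proof (rule linear_mapsI)
  note fl = linear_mapsD[OF free_lift_linear[OF assms(1,2)]]
  note pp = linear_mapsD[OF pres_proj_linear]
  fix C assume "C \<in> carrier PM"
  then obtain Z where Z: "Z \<in> carrier FM" "C = pres_proj R X Rel Z"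
    by (rule pres_carrierE)
  show "pres_lift R W \<phi> C \<in> carrier W"
    using Z fl(1) pres_lift_proj[OF assms Z(1)] by simp
  {
    fix D assume "D \<in> carrier PM"
    then obtain Y where Y: "Y \<in> carrier FM" "D = pres_proj R X Rel Y"
      by (rule pres_carrierE)
    have "C \<oplus>\<^bsub>PM\<^esub> D = pres_proj R X Rel (Z \<oplus>\<^bsub>FM\<^esub> Y)"
      using Z Y pp(2) by simp
    then show "pres_lift R W \<phi> (C \<oplus>\<^bsub>PM\<^esub> D) = pres_lift R W \<phi> C \<oplus>\<^bsub>W\<^esub> pres_lift R W \<phi> D"
      using pres_lift_proj[OF assms] fl(2)[OF Z(1) Y(1)] Z Y F.a_closed[OF Z(1) Y(1)] by simp
  }
  fix r assume r: "r \<in> carrier R"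
  then have "r \<odot>\<^bsub>PM\<^esub> C = pres_proj R X Rel (r \<odot>\<^bsub>FM\<^esub> Z)"
    using Z pp(3) by simp
  then show "pres_lift R W \<phi> (r \<odot>\<^bsub>PM\<^esub> C) = r \<odot>\<^bsub>W\<^esub> pres_lift R W \<phi> C"
    using pres_lift_proj[OF assms] fl(3)[OF r Z(1)] Z F.smult_closed[OF r Z(1)] by simp
qed

lemma pres_lift_class:
  assumes "module R W" "\<phi> \<in> X \<rightarrow> carrier W" "\<And>\<rho>. \<rho> \<in> Rel \<Longrightarrow> free_lift R W \<phi> \<rho> = \<zero>\<^bsub>W\<^esub>" "x \<in> X"
  shows "pres_lift R W \<phi> (pres_class R X Rel x) = \<phi> x"
  using pres_lift_proj[OF assms(1-3) free_gen_closed[OF is_cring assms(4)]]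
    free_lift_gen[OF assms(1,2,4)] by (simp add: pres_proj_gen)

text \<open>
  If a linear map with the prescribed values on generators is already known, then \<open>\<phi>\<close> respects the
  relations and \<open>pres_lift\<close> is that map.
\<close>

lemma pres_lift_eq:
  assumes "module R W" "g \<in> linear_maps R PM W"
    and "\<And>x. x \<in> X \<Longrightarrow> g (pres_class R X Rel x) = \<phi> x" "C \<in> carrier PM"
  shows "pres_lift R W \<phi> C = g C"
proof -
  have \<phi>: "\<phi> \<in> X \<rightarrow> carrier W"
    using lin_closed[OF assms(2) pres_class_closed] assms(3) by auto
  note fl = free_lift_linear[OF assms(1) \<phi>]
  have eq: "free_lift R W \<phi> Z = g (pres_proj R X Rel Z)" if "Z \<in> carrier FM" for Z
    using assms(1) fl linear_maps_comp[OF pres_proj_linear assms(2)] _ that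
    by (rule free_module_linear_eqI)
      (use free_lift_gen[OF assms(1) \<phi>] assms(3) in \<open>simp add: pres_proj_gen\<close>)
  have kill: "free_lift R W \<phi> \<rho> = \<zero>\<^bsub>W\<^esub>" if "\<rho> \<in> Rel" for \<rho>
  proof -
    have \<rho>: "\<rho> \<in> carrier FM" "\<rho> \<in> submodule_generated R FM Rel"
      using that rels_closed subsetD[OF submodule_generated_incl that] by auto
    then have "pres_proj R X Rel \<rho> = \<zero>\<^bsub>PM\<^esub>"
      using pres_proj_eq_zero_iff by simp
    then show ?thesis
      using eq[OF \<rho>(1)] lin_zero[OF module_pres_module assms(1,2)] by simp
  qed
  show ?thesis
    using assms(1) pres_lift_linear[OF assms(1) \<phi> kill] assms(2) _ assms(4)
    by (rule pres_linear_eqI) (simp_all add: pres_lift_class[OF assms(1) \<phi> kill] assms(3))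
qed

end

lemma (in presentation) free_lift_rels:
  assumes "module R W" "\<phi> \<in> X \<rightarrow> carrier W"
  shows free_lift_add_rel: "u \<in> X \<Longrightarrow> v \<in> X \<Longrightarrow> w \<in> X \<Longrightarrow> \<phi> u = \<phi> v \<oplus>\<^bsub>W\<^esub> \<phi> w \<Longrightarrow>
      free_lift R W \<phi> (free_gen R u \<ominus>\<^bsub>FM\<^esub> (free_gen R v \<oplus>\<^bsub>FM\<^esub> free_gen R w)) = \<zero>\<^bsub>W\<^esub>"
    and free_lift_smult_rel: "u \<in> X \<Longrightarrow> v \<in> X \<Longrightarrow> r \<in> carrier R \<Longrightarrow> \<phi> u = r \<odot>\<^bsub>W\<^esub> \<phi> v \<Longrightarrow>
      free_lift R W \<phi> (free_gen R u \<ominus>\<^bsub>FM\<^esub> r \<odot>\<^bsub>FM\<^esub> free_gen R v) = \<zero>\<^bsub>W\<^esub>"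
    and free_lift_eq_rel: "u \<in> X \<Longrightarrow> v \<in> X \<Longrightarrow> \<phi> u = \<phi> v \<Longrightarrow>
      free_lift R W \<phi> (free_gen R u \<ominus>\<^bsub>FM\<^esub> free_gen R v) = \<zero>\<^bsub>W\<^esub>"
proof -
  interpret W: module R W by fact
  note fl = free_lift_linear[OF assms]
  note flm = lin_minus[OF F.module_axioms assms(1) fl] linear_mapsD[OF fl]
  note g = free_gen_closed[OF is_cring, of _ X]
  have c: "\<phi> x \<in> carrier W" if "x \<in> X" for x using that assms by auto
  show "u \<in> X \<Longrightarrow> v \<in> X \<Longrightarrow> w \<in> X \<Longrightarrow> \<phi> u = \<phi> v \<oplus>\<^bsub>W\<^esub> \<phi> w \<Longrightarrow>
      free_lift R W \<phi> (free_gen R u \<ominus>\<^bsub>FM\<^esub> (free_gen R v \<oplus>\<^bsub>FM\<^esub> free_gen R w)) = \<zero>\<^bsub>W\<^esub>"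
    by (simp add: flm g free_lift_gen[OF assms] c W.minus_eq_zero_iff)
  show "u \<in> X \<Longrightarrow> v \<in> X \<Longrightarrow> r \<in> carrier R \<Longrightarrow> \<phi> u = r \<odot>\<^bsub>W\<^esub> \<phi> v \<Longrightarrow>
      free_lift R W \<phi> (free_gen R u \<ominus>\<^bsub>FM\<^esub> r \<odot>\<^bsub>FM\<^esub> free_gen R v) = \<zero>\<^bsub>W\<^esub>"
    by (simp add: flm g free_lift_gen[OF assms] c W.minus_eq_zero_iff)
  show "u \<in> X \<Longrightarrow> v \<in> X \<Longrightarrow> \<phi> u = \<phi> v \<Longrightarrow>
      free_lift R W \<phi> (free_gen R u \<ominus>\<^bsub>FM\<^esub> free_gen R v) = \<zero>\<^bsub>W\<^esub>"
    by (simp add: flm g free_lift_gen[OF assms] c W.minus_eq_zero_iff)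
qed

lemma (in presentation)
  shows class_add_rel: "u \<in> X \<Longrightarrow> v \<in> X \<Longrightarrow> w \<in> X \<Longrightarrow>
      free_gen R u \<ominus>\<^bsub>FM\<^esub> (free_gen R v \<oplus>\<^bsub>FM\<^esub> free_gen R w) \<in> Rel \<Longrightarrow>
      pres_class R X Rel u = pres_class R X Rel v \<oplus>\<^bsub>PM\<^esub> pres_class R X Rel w"
    and class_smult_rel: "u \<in> X \<Longrightarrow> v \<in> X \<Longrightarrow> r \<in> carrier R \<Longrightarrow>
      free_gen R u \<ominus>\<^bsub>FM\<^esub> r \<odot>\<^bsub>FM\<^esub> free_gen R v \<in> Rel \<Longrightarrow>
      pres_class R X Rel u = r \<odot>\<^bsub>PM\<^esub> pres_class R X Rel v"
    and class_eq_rel: "u \<in> X \<Longrightarrow> v \<in> X \<Longrightarrow>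
      free_gen R u \<ominus>\<^bsub>FM\<^esub> free_gen R v \<in> Rel \<Longrightarrow>
      pres_class R X Rel u = pres_class R X Rel v"
    and class_zero_rel: "u \<in> X \<Longrightarrow> free_gen R u \<in> Rel \<Longrightarrow> pres_class R X Rel u = \<zero>\<^bsub>PM\<^esub>"
proof -
  note pp = lin_minus[OF F.module_axioms module_pres_module pres_proj_linear]
    linear_mapsD[OF pres_proj_linear] pres_proj_gen
  note g = free_gen_closed[OF is_cring, of _ X]
  note c = pres_class_closed
  have z: "pres_proj R X Rel \<rho> = \<zero>\<^bsub>PM\<^esub>" if "\<rho> \<in> Rel" for \<rho>
    using that rels_closed subsetD[OF submodule_generated_incl that]
    by (subst pres_proj_eq_zero_iff) auto
  show "u \<in> X \<Longrightarrow> v \<in> X \<Longrightarrow> w \<in> X \<Longrightarrow>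
      free_gen R u \<ominus>\<^bsub>FM\<^esub> (free_gen R v \<oplus>\<^bsub>FM\<^esub> free_gen R w) \<in> Rel \<Longrightarrow>
      pres_class R X Rel u = pres_class R X Rel v \<oplus>\<^bsub>PM\<^esub> pres_class R X Rel w"
    using z[of "free_gen R u \<ominus>\<^bsub>FM\<^esub> (free_gen R v \<oplus>\<^bsub>FM\<^esub> free_gen R w)"]
    by (simp add: pp g c P.minus_eq_zero_iff)
  show "u \<in> X \<Longrightarrow> v \<in> X \<Longrightarrow> r \<in> carrier R \<Longrightarrow>
      free_gen R u \<ominus>\<^bsub>FM\<^esub> r \<odot>\<^bsub>FM\<^esub> free_gen R v \<in> Rel \<Longrightarrow>
      pres_class R X Rel u = r \<odot>\<^bsub>PM\<^esub> pres_class R X Rel v"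
    using z[of "free_gen R u \<ominus>\<^bsub>FM\<^esub> r \<odot>\<^bsub>FM\<^esub> free_gen R v"]
    by (simp add: pp g c P.minus_eq_zero_iff)
  show "u \<in> X \<Longrightarrow> v \<in> X \<Longrightarrow>
      free_gen R u \<ominus>\<^bsub>FM\<^esub> free_gen R v \<in> Rel \<Longrightarrow>
      pres_class R X Rel u = pres_class R X Rel v"
    using z[of "free_gen R u \<ominus>\<^bsub>FM\<^esub> free_gen R v"]
    by (simp add: pp g c P.minus_eq_zero_iff)
  show "u \<in> X \<Longrightarrow> free_gen R u \<in> Rel \<Longrightarrow> pres_class R X Rel u = \<zero>\<^bsub>PM\<^esub>"
    using z[of "free_gen R u"] by (simp add: pp)
qed

section \<open>Tensor products\<close>

definition bilinear where
  "bilinear R M N W b \<longleftrightarrow>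
     (\<forall>y \<in> carrier N. (\<lambda>x. b x y) \<in> linear_maps R M W) \<and> (\<forall>x \<in> carrier M. b x \<in> linear_maps R N W)"

lemma presentation_tensor:
  assumes "module R M" "module R N"
  shows "presentation R (carrier M \<times> carrier N) (bilinear_rels R M N)"
proof -
  interpret M: module R M by fact
  interpret N: module R N by fact
  interpret F: module R "free_module R (carrier M \<times> carrier N)"
    by (rule module_free_module[OF M.R.cring_axioms])
  note g = free_gen_closed[OF M.R.cring_axioms, of _ "carrier M \<times> carrier N"]
  show ?thesis
    by unfold_locales (auto simp: bilinear_rels_def Let_def g)
qed

lemma module_tensor_module:
  "module R M \<Longrightarrow> module R N \<Longrightarrow> module R (tensor_module R M N)"
  unfolding tensor_module_def
  by (rule presentation.module_pres_module[OF presentation_tensor])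

lemma pure_tensor_bilinear:
  assumes "module R M" "module R N"
  shows "bilinear R M N (tensor_module R M N) (pure_tensor R M N)"
proof -
  interpret M: module R M by fact
  interpret N: module R N by fact
  interpret presentation R "carrier M \<times> carrier N" "bilinear_rels R M N"
    by (rule presentation_tensor[OF assms])
  show ?thesis
    unfolding bilinear_def pure_tensor_def[abs_def] tensor_module_def
  proof (intro conjI ballI linear_mapsI, goal_cases)
    case (2 z x y)
    then have "free_gen R (x \<oplus>\<^bsub>M\<^esub> y, z) \<ominus>\<^bsub>FM\<^esub> (free_gen R (x, z) \<oplus>\<^bsub>FM\<^esub> free_gen R (y, z)) \<in> bilinear_rels R M N"
      unfolding bilinear_rels_def Let_def by blast
    from class_add_rel[OF _ _ _ this] 2 show ?case by simp
  next
    case (3 z r x)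
    then have "free_gen R (r \<odot>\<^bsub>M\<^esub> x, z) \<ominus>\<^bsub>FM\<^esub> r \<odot>\<^bsub>FM\<^esub> free_gen R (x, z) \<in> bilinear_rels R M N"
      unfolding bilinear_rels_def Let_def by blast
    from class_smult_rel[OF _ _ _ this] 3 show ?case by simp
  next
    case (5 z x y)
    then have "free_gen R (z, x \<oplus>\<^bsub>N\<^esub> y) \<ominus>\<^bsub>FM\<^esub> (free_gen R (z, x) \<oplus>\<^bsub>FM\<^esub> free_gen R (z, y)) \<in> bilinear_rels R M N"
      unfolding bilinear_rels_def Let_def by blast
    from class_add_rel[OF _ _ _ this] 5 show ?case by simp
  next
    case (6 z r x)
    then have "free_gen R (z, r \<odot>\<^bsub>N\<^esub> x) \<ominus>\<^bsub>FM\<^esub> r \<odot>\<^bsub>FM\<^esub> free_gen R (z, x) \<in> bilinear_rels R M N"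
      unfolding bilinear_rels_def Let_def by blast
    from class_smult_rel[OF _ _ _ this] 6 show ?case by simp
  qed (auto intro: pres_class_closed)
qed

lemma
  assumes "module R M" "module R N"
  shows pure_tensor_closed:
      "x \<in> carrier M \<Longrightarrow> y \<in> carrier N \<Longrightarrow> pure_tensor R M N x y \<in> carrier (tensor_module R M N)"
    and pure_tensor_linear_left:
      "y \<in> carrier N \<Longrightarrow> (\<lambda>x. pure_tensor R M N x y) \<in> linear_maps R M (tensor_module R M N)"
    and pure_tensor_linear_right:
      "x \<in> carrier M \<Longrightarrow> pure_tensor R M N x \<in> linear_maps R N (tensor_module R M N)"
proof -
  show l: "y \<in> carrier N \<Longrightarrow> (\<lambda>x. pure_tensor R M N x y) \<in> linear_maps R M (tensor_module R M N)" for y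
    using pure_tensor_bilinear[OF assms] unfolding bilinear_def by simp
  show "x \<in> carrier M \<Longrightarrow> pure_tensor R M N x \<in> linear_maps R N (tensor_module R M N)"
    using pure_tensor_bilinear[OF assms] unfolding bilinear_def by simp
  show "x \<in> carrier M \<Longrightarrow> y \<in> carrier N \<Longrightarrow> pure_tensor R M N x y \<in> carrier (tensor_module R M N)"
    using lin_closed[OF l] .
qed

lemma tensor_linear_eqI:
  assumes "module R M" "module R N" "module R W"
    and "f \<in> linear_maps R (tensor_module R M N) W" "g \<in> linear_maps R (tensor_module R M N) W"
    and "\<And>x y. x \<in> carrier M \<Longrightarrow> y \<in> carrier N \<Longrightarrow>
      f (pure_tensor R M N x y) = g (pure_tensor R M N x y)"
    and "z \<in> carrier (tensor_module R M N)"
  shows "f z = g z"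
proof -
  interpret presentation R "carrier M \<times> carrier N" "bilinear_rels R M N"
    by (rule presentation_tensor[OF assms(1,2)])
  show ?thesis
    using assms(3-) unfolding tensor_module_def pure_tensor_def
    by - (rule pres_linear_eqI, auto)
qed

lemma tensor_lift:
  assumes "module R M" "module R N" "module R W" "bilinear R M N W b"
  obtains g where "g \<in> linear_maps R (tensor_module R M N) W"
    and "\<And>x y. x \<in> carrier M \<Longrightarrow> y \<in> carrier N \<Longrightarrow> g (pure_tensor R M N x y) = b x y"
proof -
  interpret M: module R M by fact
  interpret N: module R N by fact
  interpret W: module R W by fact
  interpret presentation R "carrier M \<times> carrier N" "bilinear_rels R M N"
    by (rule presentation_tensor[OF assms(1,2)])
  have l: "y \<in> carrier N \<Longrightarrow> (\<lambda>x. b x y) \<in> linear_maps R M W"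
    and r: "x \<in> carrier M \<Longrightarrow> b x \<in> linear_maps R N W" for x y
    using assms(4) unfolding bilinear_def by auto
  have c: "(\<lambda>(x, y). b x y) \<in> carrier M \<times> carrier N \<rightarrow> carrier W"
    using lin_closed[OF r] by auto
  have k: "free_lift R W (\<lambda>(x, y). b x y) \<rho> = \<zero>\<^bsub>W\<^esub>" if "\<rho> \<in> bilinear_rels R M N" for \<rho>
    using that unfolding bilinear_rels_def Let_def
    by (auto intro!: free_lift_add_rel[OF assms(3) c] free_lift_smult_rel[OF assms(3) c]
        simp: linear_mapsD[OF l] linear_mapsD[OF r])
  show ?thesis
    by (rule that[of "pres_lift R W (\<lambda>(x, y). b x y)"], unfold tensor_module_def pure_tensor_def)
      (use pres_lift_linear[OF assms(3) c k] pres_lift_class[OF assms(3) c k] in auto)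
qed

lemma tensor_map_linear:
  assumes "module R M" "module R N" "module R M'" "module R N'"
    and "f \<in> linear_maps R M M'" "g \<in> linear_maps R N N'"
  shows "tensor_map R M' N' f g \<in> linear_maps R (tensor_module R M N) (tensor_module R M' N')"
    and "x \<in> carrier M \<Longrightarrow> y \<in> carrier N \<Longrightarrow>
      tensor_map R M' N' f g (pure_tensor R M N x y) = pure_tensor R M' N' (f x) (g y)"
proof -
  interpret presentation R "carrier M \<times> carrier N" "bilinear_rels R M N"
    by (rule presentation_tensor[OF assms(1,2)])
  note T = module_tensor_module[OF assms(3,4)]
  have "bilinear R M N (tensor_module R M' N') (\<lambda>x y. pure_tensor R M' N' (f x) (g y))"
    using linear_maps_comp[OF assms(5) pure_tensor_linear_left[OF assms(3,4)]]
      linear_maps_comp[OF assms(6) pure_tensor_linear_right[OF assms(3,4)]]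
      lin_closed[OF assms(5)] lin_closed[OF assms(6)]
    unfolding bilinear_def by auto
  then obtain h where h: "h \<in> linear_maps R (tensor_module R M N) (tensor_module R M' N')"
    and eq: "\<And>x y. x \<in> carrier M \<Longrightarrow> y \<in> carrier N \<Longrightarrow>
      h (pure_tensor R M N x y) = pure_tensor R M' N' (f x) (g y)"
    using tensor_lift[OF assms(1,2) T] by metis
  have *: "tensor_map R M' N' f g C = h C" if "C \<in> carrier (tensor_module R M N)" for C
    unfolding tensor_map_def
    by (rule pres_lift_eq[OF T]) (use h eq that in \<open>auto simp: tensor_module_def pure_tensor_def\<close>)
  show "tensor_map R M' N' f g \<in> linear_maps R (tensor_module R M N) (tensor_module R M' N')"
    by (rule linear_maps_cong[OF h module_tensor_module[OF assms(1,2)] *])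
  show "x \<in> carrier M \<Longrightarrow> y \<in> carrier N \<Longrightarrow>
      tensor_map R M' N' f g (pure_tensor R M N x y) = pure_tensor R M' N' (f x) (g y)"
    using * eq pure_tensor_closed[OF assms(1,2)] by simp
qed

lemma tensor_pres_lift_eq:
  assumes "module R M" "module R N" "module R W" "g \<in> linear_maps R (tensor_module R M N) W"
    and "\<And>x y. x \<in> carrier M \<Longrightarrow> y \<in> carrier N \<Longrightarrow> g (pure_tensor R M N x y) = \<phi> (x, y)"
    and "z \<in> carrier (tensor_module R M N)"
  shows "pres_lift R W \<phi> z = g z"
proof -
  interpret presentation R "carrier M \<times> carrier N" "bilinear_rels R M N"
    by (rule presentation_tensor[OF assms(1,2)])
  show ?thesis
    using assms(4-6) by (intro pres_lift_eq[OF assms(3)]) (auto simp: tensor_module_def pure_tensor_def)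
qed

section \<open>Symmetric and exterior powers\<close>

lemma tuples_replace: "xs @ a # ys \<in> tuples M j \<Longrightarrow> c \<in> carrier M \<Longrightarrow> xs @ c # ys \<in> tuples M j"
  and tuples_entry: "xs @ a # ys \<in> tuples M j \<Longrightarrow> a \<in> carrier M"
  by (auto simp: tuples_def)

definition multilinear where
  "multilinear R M j W f \<longleftrightarrow> f \<in> tuples M j \<rightarrow> carrier W \<and>
     (\<forall>xs a b ys. xs @ a # ys \<in> tuples M j \<longrightarrow> b \<in> carrier M \<longrightarrow>
        f (xs @ (a \<oplus>\<^bsub>M\<^esub> b) # ys) = f (xs @ a # ys) \<oplus>\<^bsub>W\<^esub> f (xs @ b # ys)) \<and>
     (\<forall>xs r a ys. xs @ a # ys \<in> tuples M j \<longrightarrow> r \<in> carrier R \<longrightarrow>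
        f (xs @ (r \<odot>\<^bsub>M\<^esub> a) # ys) = r \<odot>\<^bsub>W\<^esub> f (xs @ a # ys))"

lemma multilinearD:
  assumes "multilinear R M j W f"
  shows "xs \<in> tuples M j \<Longrightarrow> f xs \<in> carrier W"
    and "xs @ a # ys \<in> tuples M j \<Longrightarrow> b \<in> carrier M \<Longrightarrow>
        f (xs @ (a \<oplus>\<^bsub>M\<^esub> b) # ys) = f (xs @ a # ys) \<oplus>\<^bsub>W\<^esub> f (xs @ b # ys)"
    and "xs @ a # ys \<in> tuples M j \<Longrightarrow> r \<in> carrier R \<Longrightarrow>
        f (xs @ (r \<odot>\<^bsub>M\<^esub> a) # ys) = r \<odot>\<^bsub>W\<^esub> f (xs @ a # ys)"
  using assms unfolding multilinear_def by auto

definition symmetric where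
  "symmetric R M j W f \<longleftrightarrow> multilinear R M j W f \<and>
     (\<forall>xs \<in> tuples M j. \<forall>ys \<in> tuples M j. mset xs = mset ys \<longrightarrow> f xs = f ys)"

definition alternating where
  "alternating R M j W f \<longleftrightarrow> multilinear R M j W f \<and>
     (\<forall>xs \<in> tuples M j. \<not> distinct xs \<longrightarrow> f xs = \<zero>\<^bsub>W\<^esub>)"

lemma presentation_powers:
  assumes "module R M"
  shows presentation_multilinear: "presentation R (tuples M j) (multilinear_rels R M j)"
    and presentation_sym: "presentation R (tuples M j) (sym_rels R M j)"
    and presentation_ext: "presentation R (tuples M j) (ext_rels R M j)"
proof -
  interpret M: module R M by fact
  interpret F: module R "free_module R (tuples M j)"
    by (rule module_free_module[OF M.R.cring_axioms])
  note g = free_gen_closed[OF M.R.cring_axioms, of _ "tuples M j"]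
  have "multilinear_rels R M j \<subseteq> carrier (free_module R (tuples M j))"
    unfolding multilinear_rels_def Let_def
    by (auto intro!: F.minus_closed F.a_closed F.smult_closed g intro: tuples_replace M.a_closed
        M.smult_closed dest: tuples_entry)
  then show "presentation R (tuples M j) (multilinear_rels R M j)"
      "presentation R (tuples M j) (sym_rels R M j)" "presentation R (tuples M j) (ext_rels R M j)"
    unfolding sym_rels_def ext_rels_def by unfold_locales (auto simp: g)
qed

lemma module_powers:
  assumes "module R M"
  shows module_sym_power: "module R (sym_power R M j)"
    and module_ext_power: "module R (ext_power R M j)"
  unfolding sym_power_def ext_power_def
  by (rule presentation.module_pres_module[OF presentation_sym[OF assms]]
      presentation.module_pres_module[OF presentation_ext[OF assms]])+

lemma sym_product_symmetric:
  assumes "module R M"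
  shows "symmetric R M j (sym_power R M j) (sym_product R M)"
proof -
  interpret M: module R M by fact
  interpret presentation R "tuples M j" "sym_rels R M j"
    by (rule presentation_sym[OF assms])
  have eq: "sym_product R M xs = pres_class R (tuples M j) (sym_rels R M j) xs" if "xs \<in> tuples M j" for xs
    using that by (auto simp: sym_product_def tuples_def)
  show ?thesis
    unfolding symmetric_def multilinear_def
  proof (intro conjI allI impI ballI)
    fix xs a b ys assume *: "xs @ a # ys \<in> tuples M j" "b \<in> carrier M"
    then have "xs @ (a \<oplus>\<^bsub>M\<^esub> b) # ys \<in> tuples M j" "xs @ b # ys \<in> tuples M j"
      by (auto simp: tuples_def)
    with * show "sym_product R M (xs @ (a \<oplus>\<^bsub>M\<^esub> b) # ys) =
        sym_product R M (xs @ a # ys) \<oplus>\<^bsub>sym_power R M j\<^esub> sym_product R M (xs @ b # ys)"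
      by (simp add: eq sym_power_def,
          intro class_add_rel) (auto simp: sym_rels_def multilinear_rels_def Let_def)
  next
    fix xs r a ys assume *: "xs @ a # ys \<in> tuples M j" "r \<in> carrier R"
    then have "xs @ (r \<odot>\<^bsub>M\<^esub> a) # ys \<in> tuples M j"
      by (auto simp: tuples_def)
    with * show "sym_product R M (xs @ (r \<odot>\<^bsub>M\<^esub> a) # ys) =
        r \<odot>\<^bsub>sym_power R M j\<^esub> sym_product R M (xs @ a # ys)"
      by (simp add: eq sym_power_def,
          intro class_smult_rel) (auto simp: sym_rels_def multilinear_rels_def Let_def)
  next
    fix xs ys assume *: "xs \<in> tuples M j" "ys \<in> tuples M j" "mset xs = mset ys"
    then show "sym_product R M xs = sym_product R M ys"
      by (simp add: eq, intro class_eq_rel) (auto simp: sym_rels_def)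
  qed (auto simp: eq sym_power_def intro: pres_class_closed)
qed

lemma wedge_alternating:
  assumes "module R M"
  shows "alternating R M j (ext_power R M j) (wedge R M)"
proof -
  interpret M: module R M by fact
  interpret presentation R "tuples M j" "ext_rels R M j"
    by (rule presentation_ext[OF assms])
  have eq: "wedge R M xs = pres_class R (tuples M j) (ext_rels R M j) xs" if "xs \<in> tuples M j" for xs
    using that by (auto simp: wedge_def tuples_def)
  show ?thesis
    unfolding alternating_def multilinear_def
  proof (intro conjI allI impI ballI)
    fix xs a b ys assume *: "xs @ a # ys \<in> tuples M j" "b \<in> carrier M"
    then have "xs @ (a \<oplus>\<^bsub>M\<^esub> b) # ys \<in> tuples M j" "xs @ b # ys \<in> tuples M j"
      by (auto simp: tuples_def)
    with * show "wedge R M (xs @ (a \<oplus>\<^bsub>M\<^esub> b) # ys) =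
        wedge R M (xs @ a # ys) \<oplus>\<^bsub>ext_power R M j\<^esub> wedge R M (xs @ b # ys)"
      by (simp add: eq ext_power_def,
          intro class_add_rel) (auto simp: ext_rels_def multilinear_rels_def Let_def)
  next
    fix xs r a ys assume *: "xs @ a # ys \<in> tuples M j" "r \<in> carrier R"
    then have "xs @ (r \<odot>\<^bsub>M\<^esub> a) # ys \<in> tuples M j"
      by (auto simp: tuples_def)
    with * show "wedge R M (xs @ (r \<odot>\<^bsub>M\<^esub> a) # ys) =
        r \<odot>\<^bsub>ext_power R M j\<^esub> wedge R M (xs @ a # ys)"
      by (simp add: eq ext_power_def,
          intro class_smult_rel) (auto simp: ext_rels_def multilinear_rels_def Let_def)
  next
    fix xs assume *: "xs \<in> tuples M j" "\<not> distinct xs"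
    then show "wedge R M xs = \<zero>\<^bsub>ext_power R M j\<^esub>"
      by (simp add: eq ext_power_def, intro class_zero_rel) (auto simp: ext_rels_def)
  qed (auto simp: eq ext_power_def intro: pres_class_closed)
qed

lemma sym_product_closed:
  "module R M \<Longrightarrow> xs \<in> tuples M j \<Longrightarrow> sym_product R M xs \<in> carrier (sym_power R M j)"
  using sym_product_symmetric unfolding symmetric_def multilinear_def by blast

lemma wedge_closed:
  "module R M \<Longrightarrow> xs \<in> tuples M j \<Longrightarrow> wedge R M xs \<in> carrier (ext_power R M j)"
  using wedge_alternating unfolding alternating_def multilinear_def by blast

lemma sym_linear_eqI:
  assumes "module R M" "module R W"
    and "f \<in> linear_maps R (sym_power R M j) W" "g \<in> linear_maps R (sym_power R M j) W"
    and "\<And>xs. xs \<in> tuples M j \<Longrightarrow> f (sym_product R M xs) = g (sym_product R M xs)"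
    and "z \<in> carrier (sym_power R M j)"
  shows "f z = g z"
proof -
  interpret presentation R "tuples M j" "sym_rels R M j"
    by (rule presentation_sym[OF assms(1)])
  have eq: "sym_product R M xs = pres_class R (tuples M j) (sym_rels R M j) xs" if "xs \<in> tuples M j" for xs
    using that by (auto simp: sym_product_def tuples_def)
  show ?thesis
    using assms(2-) eq unfolding sym_power_def by - (rule pres_linear_eqI, auto)
qed

lemma ext_linear_eqI:
  assumes "module R M" "module R W"
    and "f \<in> linear_maps R (ext_power R M j) W" "g \<in> linear_maps R (ext_power R M j) W"
    and "\<And>xs. xs \<in> tuples M j \<Longrightarrow> f (wedge R M xs) = g (wedge R M xs)"
    and "z \<in> carrier (ext_power R M j)"
  shows "f z = g z"
proof -
  interpret presentation R "tuples M j" "ext_rels R M j"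
    by (rule presentation_ext[OF assms(1)])
  have eq: "wedge R M xs = pres_class R (tuples M j) (ext_rels R M j) xs" if "xs \<in> tuples M j" for xs
    using that by (auto simp: wedge_def tuples_def)
  show ?thesis
    using assms(2-) eq unfolding ext_power_def by - (rule pres_linear_eqI, auto)
qed

lemma free_lift_multilinear_rels:
  assumes "module R M" "module R W" "multilinear R M j W f" "\<rho> \<in> multilinear_rels R M j"
  shows "free_lift R W f \<rho> = \<zero>\<^bsub>W\<^esub>"
proof -
  interpret M: module R M by fact
  interpret presentation R "tuples M j" "multilinear_rels R M j"
    by (rule presentation_multilinear[OF assms(1)])
  have c: "f \<in> tuples M j \<rightarrow> carrier W"
    and m: "\<And>xs a b ys. xs @ a # ys \<in> tuples M j \<Longrightarrow> b \<in> carrier M \<Longrightarrow>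
        f (xs @ (a \<oplus>\<^bsub>M\<^esub> b) # ys) = f (xs @ a # ys) \<oplus>\<^bsub>W\<^esub> f (xs @ b # ys)"
       "\<And>xs r a ys. xs @ a # ys \<in> tuples M j \<Longrightarrow> r \<in> carrier R \<Longrightarrow>
        f (xs @ (r \<odot>\<^bsub>M\<^esub> a) # ys) = r \<odot>\<^bsub>W\<^esub> f (xs @ a # ys)"
    using assms(3) unfolding multilinear_def by auto
  have cl: "xs @ (a \<oplus>\<^bsub>M\<^esub> b) # ys \<in> tuples M j" "xs @ b # ys \<in> tuples M j"
    "r \<in> carrier R \<Longrightarrow> xs @ (r \<odot>\<^bsub>M\<^esub> a) # ys \<in> tuples M j"
    if "xs @ a # ys \<in> tuples M j" "b \<in> carrier M" for xs a b ys r
    using that by (auto simp: tuples_def)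
  from assms(4) consider
    (add) xs a b ys where "xs @ a # ys \<in> tuples M j" "b \<in> carrier M"
      "\<rho> = free_gen R (xs @ (a \<oplus>\<^bsub>M\<^esub> b) # ys) \<ominus>\<^bsub>FM\<^esub>
        (free_gen R (xs @ a # ys) \<oplus>\<^bsub>FM\<^esub> free_gen R (xs @ b # ys))" |
    (smult) xs r a ys where "xs @ a # ys \<in> tuples M j" "r \<in> carrier R"
      "\<rho> = free_gen R (xs @ (r \<odot>\<^bsub>M\<^esub> a) # ys) \<ominus>\<^bsub>FM\<^esub> (r \<odot>\<^bsub>FM\<^esub> free_gen R (xs @ a # ys))"
    unfolding multilinear_rels_def Let_def by blast
  then show ?thesis
  proof cases
    case add
    show ?thesis
      unfolding add(3) by (rule free_lift_add_rel[OF assms(2) c])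
        (use add(1,2) cl(1,2)[OF add(1,2)] m(1) in auto)
  next
    case smult
    then have "a \<in> carrier M" by (auto simp: tuples_def)
    show ?thesis
      unfolding smult(3) by (rule free_lift_smult_rel[OF assms(2) c])
        (use smult(1,2) cl(3)[OF smult(1) \<open>a \<in> carrier M\<close>] m(2) in auto)
  qed
qed

lemma ext_pres_lift_eq:
  assumes "module R M" "module R W" "g \<in> linear_maps R (ext_power R M j) W"
    and "\<And>xs. xs \<in> tuples M j \<Longrightarrow> g (wedge R M xs) = \<phi> xs" "\<omega> \<in> carrier (ext_power R M j)"
  shows "pres_lift R W \<phi> \<omega> = g \<omega>"
proof -
  interpret presentation R "tuples M j" "ext_rels R M j"
    by (rule presentation_ext[OF assms(1)])
  have "wedge R M xs = pres_class R (tuples M j) (ext_rels R M j) xs" if "xs \<in> tuples M j" for xs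
    using that by (auto simp: wedge_def tuples_def)
  then show ?thesis
    using assms(3-5) by (intro pres_lift_eq[OF assms(2)]) (simp_all add: ext_power_def)
qed

lemma sym_lift:
  assumes "module R M" "module R W" "symmetric R M j W f"
  obtains g where "g \<in> linear_maps R (sym_power R M j) W"
    and "\<And>xs. xs \<in> tuples M j \<Longrightarrow> g (sym_product R M xs) = f xs"
proof -
  interpret presentation R "tuples M j" "sym_rels R M j"
    by (rule presentation_sym[OF assms(1)])
  have ml: "multilinear R M j W f"
    and s: "xs \<in> tuples M j \<Longrightarrow> ys \<in> tuples M j \<Longrightarrow> mset xs = mset ys \<Longrightarrow> f xs = f ys" for xs ys
    using assms(3) unfolding symmetric_def by blast+
  then have c: "f \<in> tuples M j \<rightarrow> carrier W"
    unfolding multilinear_def by blast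
  have k: "free_lift R W f \<rho> = \<zero>\<^bsub>W\<^esub>" if "\<rho> \<in> sym_rels R M j" for \<rho>
    using that unfolding sym_rels_def
  proof (elim UnE CollectE exE conjE)
    fix xs ys assume "xs \<in> tuples M j" "ys \<in> tuples M j" "mset xs = mset ys"
      and \<rho>: "\<rho> = free_gen R xs \<ominus>\<^bsub>FM\<^esub> free_gen R ys"
    then show "free_lift R W f \<rho> = \<zero>\<^bsub>W\<^esub>"
      unfolding \<rho> by (intro free_lift_eq_rel[OF assms(2) c] s)
  qed (rule free_lift_multilinear_rels[OF assms(1,2) ml])
  have eq: "sym_product R M xs = pres_class R (tuples M j) (sym_rels R M j) xs" if "xs \<in> tuples M j" for xs
    using that by (auto simp: sym_product_def tuples_def)
  show ?thesis
  proof (rule that)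
    show "pres_lift R W f \<in> linear_maps R (sym_power R M j) W"
      unfolding sym_power_def by (rule pres_lift_linear[OF assms(2) c k])
    show "pres_lift R W f (sym_product R M xs) = f xs" if "xs \<in> tuples M j" for xs
      unfolding eq[OF that] by (rule pres_lift_class[OF assms(2) c k that])
  qed
qed

lemma ext_lift:
  assumes "module R M" "module R W" "alternating R M j W f"
  obtains g where "g \<in> linear_maps R (ext_power R M j) W"
    and "\<And>xs. xs \<in> tuples M j \<Longrightarrow> g (wedge R M xs) = f xs"
proof -
  interpret presentation R "tuples M j" "ext_rels R M j"
    by (rule presentation_ext[OF assms(1)])
  have ml: "multilinear R M j W f"
    and s: "xs \<in> tuples M j \<Longrightarrow> \<not> distinct xs \<Longrightarrow> f xs = \<zero>\<^bsub>W\<^esub>" for xs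
    using assms(3) unfolding alternating_def by auto
  then have c: "f \<in> tuples M j \<rightarrow> carrier W"
    unfolding multilinear_def by blast
  have k: "free_lift R W f \<rho> = \<zero>\<^bsub>W\<^esub>" if "\<rho> \<in> ext_rels R M j" for \<rho>
    using that unfolding ext_rels_def
  proof (elim UnE CollectE exE conjE)
    fix xs assume xs: "xs \<in> tuples M j" "\<not> distinct xs" and \<rho>: "\<rho> = free_gen R xs"
    show "free_lift R W f \<rho> = \<zero>\<^bsub>W\<^esub>"
      unfolding \<rho> free_lift_gen[OF assms(2) c xs(1)] by (rule s[OF xs])
  qed (rule free_lift_multilinear_rels[OF assms(1,2) ml])
  have eq: "wedge R M xs = pres_class R (tuples M j) (ext_rels R M j) xs" if "xs \<in> tuples M j" for xs
    using that by (auto simp: wedge_def tuples_def)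
  show ?thesis
  proof (rule that)
    show "pres_lift R W f \<in> linear_maps R (ext_power R M j) W"
      unfolding ext_power_def by (rule pres_lift_linear[OF assms(2) c k])
    show "pres_lift R W f (wedge R M xs) = f xs" if "xs \<in> tuples M j" for xs
      unfolding eq[OF that] by (rule pres_lift_class[OF assms(2) c k that])
  qed
qed

section \<open>The total Koszul module\<close>

text \<open>
  \<open>kml\<close> describes the maps on triples \<open>(xs, as, y)\<close> that factor through the sum of all
  \<open>S\<^sup>iM \<otimes> \<Lambda>\<^sup>jM \<otimes> N\<close>, except that additivity in \<open>M\<close> is only required at the pairs in \<open>A\<close> and
  homogeneity only at the pairs in \<open>B\<close>.
\<close>

locale kml =
  fixes R :: "('r, 's) ring_scheme" and M :: "('r, 'm, 't) module_scheme"
    and N :: "('r, 'n, 'u) module_scheme"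
    and A :: "('m \<times> 'm) set" and B :: "('r \<times> 'm) set"
    and W :: "('r, 'w, 'v) module_scheme" and D :: "'m list \<Rightarrow> 'm list \<Rightarrow> 'n \<Rightarrow> 'w"
  assumes lin: "set xs \<subseteq> carrier M \<Longrightarrow> set as \<subseteq> carrier M \<Longrightarrow> D xs as \<in> linear_maps R N W"
    and add_x: "(a, b) \<in> A \<Longrightarrow> a \<in> carrier M \<Longrightarrow> b \<in> carrier M \<Longrightarrow> set xs \<subseteq> carrier M \<Longrightarrow>
      set as \<subseteq> carrier M \<Longrightarrow> y \<in> carrier N \<Longrightarrow>
      D ((a \<oplus>\<^bsub>M\<^esub> b) # xs) as y = D (a # xs) as y \<oplus>\<^bsub>W\<^esub> D (b # xs) as y"
    and smult_x: "(r, a) \<in> B \<Longrightarrow> r \<in> carrier R \<Longrightarrow> a \<in> carrier M \<Longrightarrow> set xs \<subseteq> carrier M \<Longrightarrow>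
      set as \<subseteq> carrier M \<Longrightarrow> y \<in> carrier N \<Longrightarrow>
      D ((r \<odot>\<^bsub>M\<^esub> a) # xs) as y = r \<odot>\<^bsub>W\<^esub> D (a # xs) as y"
    and sym: "mset xs = mset xs' \<Longrightarrow> set xs \<subseteq> carrier M \<Longrightarrow> set as \<subseteq> carrier M \<Longrightarrow> y \<in> carrier N \<Longrightarrow>
      D xs as y = D xs' as y"
    and add_as: "(a, b) \<in> A \<Longrightarrow> a \<in> carrier M \<Longrightarrow> b \<in> carrier M \<Longrightarrow> set xs \<subseteq> carrier M \<Longrightarrow>
      set ps \<subseteq> carrier M \<Longrightarrow> set qs \<subseteq> carrier M \<Longrightarrow> y \<in> carrier N \<Longrightarrow>
      D xs (ps @ (a \<oplus>\<^bsub>M\<^esub> b) # qs) y = D xs (ps @ a # qs) y \<oplus>\<^bsub>W\<^esub> D xs (ps @ b # qs) y"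
    and smult_as: "(r, a) \<in> B \<Longrightarrow> r \<in> carrier R \<Longrightarrow> a \<in> carrier M \<Longrightarrow> set xs \<subseteq> carrier M \<Longrightarrow>
      set ps \<subseteq> carrier M \<Longrightarrow> set qs \<subseteq> carrier M \<Longrightarrow> y \<in> carrier N \<Longrightarrow>
      D xs (ps @ (r \<odot>\<^bsub>M\<^esub> a) # qs) y = r \<odot>\<^bsub>W\<^esub> D xs (ps @ a # qs) y"
    and alt: "\<not> distinct as \<Longrightarrow> set xs \<subseteq> carrier M \<Longrightarrow> set as \<subseteq> carrier M \<Longrightarrow> y \<in> carrier N \<Longrightarrow>
      D xs as y = \<zero>\<^bsub>W\<^esub>"

definition triples where
  "triples M N = {(xs, as, y). set xs \<subseteq> carrier M \<and> set as \<subseteq> carrier M \<and> y \<in> carrier N}"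

inductive_set kos_rels ::
  "('r, 's) ring_scheme \<Rightarrow> ('r, 'm, 't) module_scheme \<Rightarrow> ('r, 'n, 'u) module_scheme \<Rightarrow>
     ('m \<times> 'm) set \<Rightarrow> ('r \<times> 'm) set \<Rightarrow> ('m list \<times> 'm list \<times> 'n \<Rightarrow> 'r) set"
  for R :: "('r, 's) ring_scheme" and M :: "('r, 'm, 't) module_scheme" and N :: "('r, 'n, 'u) module_scheme"
    and A B where
  rel_add_y: "(xs, as, y) \<in> triples M N \<Longrightarrow> z \<in> carrier N \<Longrightarrow>
    free_gen R (xs, as, y \<oplus>\<^bsub>N\<^esub> z) \<ominus>\<^bsub>free_module R (triples M N)\<^esub>
      (free_gen R (xs, as, y) \<oplus>\<^bsub>free_module R (triples M N)\<^esub> free_gen R (xs, as, z)) \<in> kos_rels R M N A B"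
| rel_smult_y: "(xs, as, y) \<in> triples M N \<Longrightarrow> r \<in> carrier R \<Longrightarrow>
    free_gen R (xs, as, r \<odot>\<^bsub>N\<^esub> y) \<ominus>\<^bsub>free_module R (triples M N)\<^esub>
      r \<odot>\<^bsub>free_module R (triples M N)\<^esub> free_gen R (xs, as, y) \<in> kos_rels R M N A B"
| rel_add_x: "(xs, as, y) \<in> triples M N \<Longrightarrow> (a, b) \<in> A \<Longrightarrow> a \<in> carrier M \<Longrightarrow> b \<in> carrier M \<Longrightarrow>
    free_gen R ((a \<oplus>\<^bsub>M\<^esub> b) # xs, as, y) \<ominus>\<^bsub>free_module R (triples M N)\<^esub>
      (free_gen R (a # xs, as, y) \<oplus>\<^bsub>free_module R (triples M N)\<^esub> free_gen R (b # xs, as, y)) \<in> kos_rels R M N A B"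
| rel_smult_x: "(xs, as, y) \<in> triples M N \<Longrightarrow> (r, a) \<in> B \<Longrightarrow> r \<in> carrier R \<Longrightarrow> a \<in> carrier M \<Longrightarrow>
    free_gen R ((r \<odot>\<^bsub>M\<^esub> a) # xs, as, y) \<ominus>\<^bsub>free_module R (triples M N)\<^esub>
      r \<odot>\<^bsub>free_module R (triples M N)\<^esub> free_gen R (a # xs, as, y) \<in> kos_rels R M N A B"
| rel_sym: "(xs, as, y) \<in> triples M N \<Longrightarrow> mset xs = mset xs' \<Longrightarrow>
    free_gen R (xs, as, y) \<ominus>\<^bsub>free_module R (triples M N)\<^esub> free_gen R (xs', as, y) \<in> kos_rels R M N A B"
| rel_add_as: "(xs, ps @ qs, y) \<in> triples M N \<Longrightarrow> (a, b) \<in> A \<Longrightarrow> a \<in> carrier M \<Longrightarrow> b \<in> carrier M \<Longrightarrow>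
    free_gen R (xs, ps @ (a \<oplus>\<^bsub>M\<^esub> b) # qs, y) \<ominus>\<^bsub>free_module R (triples M N)\<^esub>
      (free_gen R (xs, ps @ a # qs, y) \<oplus>\<^bsub>free_module R (triples M N)\<^esub> free_gen R (xs, ps @ b # qs, y)) \<in> kos_rels R M N A B"
| rel_smult_as: "(xs, ps @ qs, y) \<in> triples M N \<Longrightarrow> (r, a) \<in> B \<Longrightarrow> r \<in> carrier R \<Longrightarrow> a \<in> carrier M \<Longrightarrow>
    free_gen R (xs, ps @ (r \<odot>\<^bsub>M\<^esub> a) # qs, y) \<ominus>\<^bsub>free_module R (triples M N)\<^esub>
      r \<odot>\<^bsub>free_module R (triples M N)\<^esub> free_gen R (xs, ps @ a # qs, y) \<in> kos_rels R M N A B"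
| rel_alt: "(xs, as, y) \<in> triples M N \<Longrightarrow> \<not> distinct as \<Longrightarrow> free_gen R (xs, as, y) \<in> kos_rels R M N A B"

lemma kos_rels_finite:
  assumes "\<rho> \<in> kos_rels R M N A B"
  obtains A' B' where "finite A'" "finite B'" "A' \<subseteq> A" "B' \<subseteq> B" "\<rho> \<in> kos_rels R M N A' B'"
  using assms
proof cases
  case (rel_add_x xs as y a b)
  then show ?thesis
    using kos_rels.rel_add_x[of xs as y M N a b "{(a, b)}"] by (intro that[of "{(a, b)}" "{}"]) auto
next
  case (rel_smult_x xs as y r a)
  then show ?thesis
    using kos_rels.rel_smult_x[of xs as y M N r a "{(r, a)}"] by (intro that[of "{}" "{(r, a)}"]) auto
next
  case (rel_add_as xs ps qs y a b)
  then show ?thesis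
    using kos_rels.rel_add_as[of xs ps qs y M N a b "{(a, b)}"] by (intro that[of "{(a, b)}" "{}"]) auto
next
  case (rel_smult_as xs ps qs y r a)
  then show ?thesis
    using kos_rels.rel_smult_as[of xs ps qs y M N r a "{(r, a)}"] by (intro that[of "{}" "{(r, a)}"]) auto
qed (use kos_rels.intros(1,2,5,8)[of _ _ _ M N] in \<open>auto intro!: that[of "{}" "{}"]\<close>)

locale two_modules = M: module R M + N: module R N
  for R :: "('r, 's) ring_scheme" (structure) and M :: "('r, 'm, 't) module_scheme"
    and N :: "('r, 'n, 'u) module_scheme"
begin

abbreviation "AM \<equiv> carrier M \<times> carrier M"
abbreviation "BM \<equiv> carrier R \<times> carrier M"
abbreviation "E \<equiv> pres_module R (triples M N) (kos_rels R M N AM BM)"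
abbreviation "FT \<equiv> free_module R (triples M N)"
abbreviation "ok xs \<equiv> set xs \<subseteq> carrier M"

lemma in_triples: "(xs, as, y) \<in> triples M N \<longleftrightarrow> ok xs \<and> ok as \<and> y \<in> carrier N"
  by (simp add: triples_def)

sublocale P: presentation R "triples M N" "kos_rels R M N AM BM"
proof
  interpret F: module R "free_module R (triples M N)"
    by (rule module_free_module[OF M.R.cring_axioms])
  note g = free_gen_closed[OF M.R.cring_axioms, of _ "triples M N"]
  show "kos_rels R M N AM BM \<subseteq> carrier FT"
  proof
    fix \<rho> assume "\<rho> \<in> kos_rels R M N AM BM"
    then show "\<rho> \<in> carrier FT"
    proof cases
      case (rel_sym xs as y xs')
      then have "ok xs'"
        by (metis in_triples set_mset_mset)
      with rel_sym show ?thesis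
        by (auto intro!: F.minus_closed g simp: in_triples)
    qed (auto intro!: F.minus_closed F.a_closed F.smult_closed g simp: in_triples)
  qed
qed

lemma free_lift_kos_rel:
  assumes "module R W" "kml R M N A B W D" "\<rho> \<in> kos_rels R M N A B"
  shows "free_lift R W (\<lambda>(xs, as, y). D xs as y) \<rho> = \<zero>\<^bsub>W\<^esub>"
proof -
  interpret K: kml R M N A B W D by fact
  let ?D = "\<lambda>(xs, as, y). D xs as y"
  have c: "?D \<in> triples M N \<rightarrow> carrier W"
    using lin_closed[OF K.lin] by (auto simp: in_triples)
  have ms: "ok xs'" if "ok xs" "mset xs = mset xs'" for xs xs'
    using that by (metis set_mset_mset)
  note add = P.free_lift_add_rel[OF assms(1) c]
  note smult = P.free_lift_smult_rel[OF assms(1) c]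
  show ?thesis
    using assms(3)
  proof cases
    case (rel_add_y xs as y z)
    then show ?thesis
      unfolding rel_add_y(1) by (intro add) (auto simp: in_triples lin_add[OF K.lin])
  next
    case (rel_smult_y xs as y r)
    then show ?thesis
      unfolding rel_smult_y(1) by (intro smult) (auto simp: in_triples lin_smult[OF K.lin])
  next
    case (rel_add_x xs as y a b)
    then show ?thesis
      unfolding rel_add_x(1) by (intro add) (auto simp: in_triples K.add_x)
  next
    case (rel_smult_x xs as y r a)
    then show ?thesis
      unfolding rel_smult_x(1) by (intro smult) (auto simp: in_triples K.smult_x)
  next
    case (rel_sym xs as y xs')
    then have *: "D xs as y = D xs' as y" "ok xs" "ok xs'" "ok as" "y \<in> carrier N"
      using K.sym[of xs xs' as y] ms[of xs xs'] by (simp_all add: in_triples)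
    show ?thesis
      unfolding rel_sym(1) by (rule P.free_lift_eq_rel[OF assms(1) c]) (use * in \<open>simp_all add: in_triples\<close>)
  next
    case (rel_add_as xs ps qs y a b)
    then show ?thesis
      unfolding rel_add_as(1) by (intro add) (auto simp: in_triples K.add_as)
  next
    case (rel_smult_as xs ps qs y r a)
    then show ?thesis
      unfolding rel_smult_as(1) by (intro smult) (auto simp: in_triples K.smult_as)
  next
    case (rel_alt xs as y)
    then show ?thesis
      using free_lift_gen[OF assms(1) c, of "(xs, as, y)"] K.alt[of as xs y] by (simp add: in_triples)
  qed
qed

definition cl :: "'m list \<Rightarrow> 'm list \<Rightarrow> 'n \<Rightarrow> ('m list \<times> 'm list \<times> 'n \<Rightarrow> 'r) set" where
  "cl xs as y = pres_class R (triples M N) (kos_rels R M N AM BM) (xs, as, y)"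

lemma kml_cl: "kml R M N AM BM E cl"
proof -
  have ms: "ok xs'" if "ok xs" "mset xs = mset xs'" for xs xs'
    using that by (metis set_mset_mset)
  show ?thesis
  proof (unfold_locales, unfold cl_def, goal_cases)
    case (1 xs as)
    show ?case
    proof (rule linear_mapsI)
      fix y assume y: "y \<in> carrier N"
      then show "pres_class R (triples M N) (kos_rels R M N AM BM) (xs, as, y) \<in> carrier E"
        using 1 by (intro P.pres_class_closed) (simp add: in_triples)
      show "pres_class R (triples M N) (kos_rels R M N AM BM) (xs, as, r \<odot>\<^bsub>N\<^esub> y) =
          r \<odot>\<^bsub>E\<^esub> pres_class R (triples M N) (kos_rels R M N AM BM) (xs, as, y)" if "r \<in> carrier R" for r
        by (rule P.class_smult_rel) (use 1 y that in \<open>auto simp: in_triples intro: kos_rels.intros\<close>)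
      show "pres_class R (triples M N) (kos_rels R M N AM BM) (xs, as, y \<oplus>\<^bsub>N\<^esub> z) =
          pres_class R (triples M N) (kos_rels R M N AM BM) (xs, as, y) \<oplus>\<^bsub>E\<^esub>
          pres_class R (triples M N) (kos_rels R M N AM BM) (xs, as, z)" if "z \<in> carrier N" for z
        by (rule P.class_add_rel) (use 1 y that in \<open>auto simp: in_triples intro: kos_rels.intros\<close>)
    qed
  next
    case (2 a b xs as y)
    then have "free_gen R ((a \<oplus>\<^bsub>M\<^esub> b) # xs, as, y) \<ominus>\<^bsub>FT\<^esub> (free_gen R (a # xs, as, y) \<oplus>\<^bsub>FT\<^esub> free_gen R (b # xs, as, y))
       \<in> kos_rels R M N AM BM"
      by (intro kos_rels.intros) (auto simp: in_triples)
    from P.class_add_rel[OF _ _ _ this] show ?case using 2 by (simp add: in_triples)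
  next
    case (3 r a xs as y)
    then have "free_gen R ((r \<odot>\<^bsub>M\<^esub> a) # xs, as, y) \<ominus>\<^bsub>FT\<^esub> r \<odot>\<^bsub>FT\<^esub> free_gen R (a # xs, as, y)
       \<in> kos_rels R M N AM BM"
      by (intro kos_rels.intros) (auto simp: in_triples)
    from P.class_smult_rel[OF _ _ _ this] show ?case using 3 by (simp add: in_triples)
  next
    case (4 xs xs' as y)
    then have "free_gen R (xs, as, y) \<ominus>\<^bsub>FT\<^esub> free_gen R (xs', as, y) \<in> kos_rels R M N AM BM"
      by (intro kos_rels.intros) (auto simp: in_triples)
    from P.class_eq_rel[OF _ _ this] show ?case using 4 ms[of xs xs'] by (simp add: in_triples)
  next
    case (5 a b xs ps qs y)
    then have "free_gen R (xs, ps @ (a \<oplus>\<^bsub>M\<^esub> b) # qs, y) \<ominus>\<^bsub>FT\<^esub>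
       (free_gen R (xs, ps @ a # qs, y) \<oplus>\<^bsub>FT\<^esub> free_gen R (xs, ps @ b # qs, y)) \<in> kos_rels R M N AM BM"
      by (intro kos_rels.intros) (auto simp: in_triples)
    from P.class_add_rel[OF _ _ _ this] show ?case using 5 by (simp add: in_triples)
  next
    case (6 r a xs ps qs y)
    then have "free_gen R (xs, ps @ (r \<odot>\<^bsub>M\<^esub> a) # qs, y) \<ominus>\<^bsub>FT\<^esub> r \<odot>\<^bsub>FT\<^esub> free_gen R (xs, ps @ a # qs, y)
       \<in> kos_rels R M N AM BM"
      by (intro kos_rels.intros) (auto simp: in_triples)
    from P.class_smult_rel[OF _ _ _ this] show ?case using 6 by (simp add: in_triples)
  next
    case (7 as xs y)
    then have "free_gen R (xs, as, y) \<in> kos_rels R M N AM BM"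
      by (intro kos_rels.intros) (auto simp: in_triples)
    from P.class_zero_rel[OF _ this] show ?case using 7 by (simp add: in_triples)
  qed
qed

sublocale K: kml R M N AM BM E cl by (rule kml_cl)

lemma cl_closed [simp]: "ok xs \<Longrightarrow> ok as \<Longrightarrow> y \<in> carrier N \<Longrightarrow> cl xs as y \<in> carrier E"
  by (rule lin_closed[OF K.lin])

definition lft where
  "lft W D = pres_lift R W (\<lambda>(xs, as, y). D xs as y)"

lemma
  assumes "module R W" "kml R M N AM BM W D"
  shows lft_linear: "lft W D \<in> linear_maps R E W"
    and lft_cl: "ok xs \<Longrightarrow> ok as \<Longrightarrow> y \<in> carrier N \<Longrightarrow> lft W D (cl xs as y) = D xs as y"
proof -
  interpret D: kml R M N AM BM W D by fact
  have c: "(\<lambda>(xs, as, y). D xs as y) \<in> triples M N \<rightarrow> carrier W"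
    using lin_closed[OF D.lin] by (auto simp: in_triples)
  note k = free_lift_kos_rel[OF assms]
  show "lft W D \<in> linear_maps R E W"
    unfolding lft_def by (rule P.pres_lift_linear[OF assms(1) c k])
  show "ok xs \<Longrightarrow> ok as \<Longrightarrow> y \<in> carrier N \<Longrightarrow> lft W D (cl xs as y) = D xs as y"
    unfolding lft_def cl_def using P.pres_lift_class[OF assms(1) c k, of "(xs, as, y)"]
    by (simp add: in_triples)
qed

lemma E_eqI:
  assumes "module R W" "f \<in> linear_maps R E W" "g \<in> linear_maps R E W"
    and "\<And>xs as y. ok xs \<Longrightarrow> ok as \<Longrightarrow> y \<in> carrier N \<Longrightarrow> f (cl xs as y) = g (cl xs as y)"
    and "z \<in> carrier E"
  shows "f z = g z"
  using assms(1-3) _ assms(5)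
  by (rule P.pres_linear_eqI) (use assms(4) in \<open>auto simp: in_triples cl_def\<close>)

definition lam where "lam a = lft E (\<lambda>xs as y. cl xs (a # as) y)"
definition sig where "sig a = lft E (\<lambda>xs as y. cl (a # xs) as y)"

lemma kml_lam: "a \<in> carrier M \<Longrightarrow> kml R M N AM BM E (\<lambda>xs as y. cl xs (a # as) y)"
proof (unfold_locales, goal_cases)
  case (1 xs as)
  then show ?case using K.lin[of xs "a # as"] by simp
next
  case (4 xs xs' as y)
  then show ?case using K.sym[of xs xs' "a # as" y] by simp
next
  case (5 b c xs ps qs y)
  then show ?case using K.add_as[of b c xs "a # ps" qs y] by simp
next
  case (6 r b xs ps qs y)
  then show ?case using K.smult_as[of r b xs "a # ps" qs y] by simp
qed (simp_all add: K.add_x K.smult_x K.alt)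

lemma kml_sig: "a \<in> carrier M \<Longrightarrow> kml R M N AM BM E (\<lambda>xs as y. cl (a # xs) as y)"
proof (unfold_locales, goal_cases)
  case (1 xs as)
  then show ?case using K.lin[of "a # xs" as] by simp
next
  case (2 b c xs as y)
  then show ?case
    using K.sym[of "a # (b \<oplus>\<^bsub>M\<^esub> c) # xs" "(b \<oplus>\<^bsub>M\<^esub> c) # a # xs" as y] K.sym[of "a # b # xs" "b # a # xs" as y]
      K.sym[of "a # c # xs" "c # a # xs" as y] by (simp add: K.add_x add_mset_commute)
next
  case (3 r b xs as y)
  then show ?case
    using K.sym[of "a # (r \<odot>\<^bsub>M\<^esub> b) # xs" "(r \<odot>\<^bsub>M\<^esub> b) # a # xs" as y] K.sym[of "a # b # xs" "b # a # xs" as y]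
    by (simp add: K.smult_x add_mset_commute)
next
  case (4 xs xs' as y)
  then show ?case using K.sym[of "a # xs" "a # xs'" as y] by simp
qed (simp_all add: K.add_as K.smult_as K.alt)

lemma lam_linear: "a \<in> carrier M \<Longrightarrow> lam a \<in> linear_maps R E E"
  and lam_cl [simp]: "a \<in> carrier M \<Longrightarrow> ok xs \<Longrightarrow> ok as \<Longrightarrow> y \<in> carrier N \<Longrightarrow> lam a (cl xs as y) = cl xs (a # as) y"
  and sig_linear: "a \<in> carrier M \<Longrightarrow> sig a \<in> linear_maps R E E"
  and sig_cl [simp]: "a \<in> carrier M \<Longrightarrow> ok xs \<Longrightarrow> ok as \<Longrightarrow> y \<in> carrier N \<Longrightarrow> sig a (cl xs as y) = cl (a # xs) as y"
  unfolding lam_def sig_def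
  by (simp_all add: lft_linear[OF P.module_pres_module kml_lam] lft_cl[OF P.module_pres_module kml_lam]
      lft_linear[OF P.module_pres_module kml_sig] lft_cl[OF P.module_pres_module kml_sig])

lemmas lam_closed [simp] = lin_closed[OF lam_linear]
lemmas sig_closed [simp] = lin_closed[OF sig_linear]
lemmas lin_E_zero = lin_zero[OF P.module_pres_module P.module_pres_module]
lemmas lin_E_neg = lin_neg[OF P.module_pres_module P.module_pres_module]
lemmas lin_E_minus = lin_minus[OF P.module_pres_module P.module_pres_module]
lemmas lam_simps = lin_add[OF lam_linear] lin_smult[OF lam_linear] lin_E_zero[OF lam_linear]
  lin_E_neg[OF lam_linear] lin_E_minus[OF lam_linear]
lemmas sig_simps = lin_add[OF sig_linear] lin_smult[OF sig_linear] lin_E_zero[OF sig_linear]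
  lin_E_neg[OF sig_linear] lin_E_minus[OF sig_linear]

lemmas E_lin_intros = linear_maps_add[OF P.module_pres_module] linear_maps_smult[OF P.module_pres_module]
  linear_maps_minus[OF P.module_pres_module] linear_maps_neg[OF P.module_pres_module]
  linear_maps_zero[OF P.module_pres_module] linear_maps_id lam_linear sig_linear

lemma lam_add: "a \<in> carrier M \<Longrightarrow> b \<in> carrier M \<Longrightarrow> z \<in> carrier E \<Longrightarrow>
    lam (a \<oplus>\<^bsub>M\<^esub> b) z = lam a z \<oplus>\<^bsub>E\<^esub> lam b z"
  by (rule E_eqI[OF P.module_pres_module]) (auto intro!: E_lin_intros simp: K.add_as[of a b _ "[]", simplified])

lemma lam_smult: "r \<in> carrier R \<Longrightarrow> a \<in> carrier M \<Longrightarrow> z \<in> carrier E \<Longrightarrow>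
    lam (r \<odot>\<^bsub>M\<^esub> a) z = r \<odot>\<^bsub>E\<^esub> lam a z"
  by (rule E_eqI[OF P.module_pres_module]) (auto intro!: E_lin_intros simp: K.smult_as[of r a _ "[]", simplified])

lemma sig_add: "a \<in> carrier M \<Longrightarrow> b \<in> carrier M \<Longrightarrow> z \<in> carrier E \<Longrightarrow>
    sig (a \<oplus>\<^bsub>M\<^esub> b) z = sig a z \<oplus>\<^bsub>E\<^esub> sig b z"
  by (rule E_eqI[OF P.module_pres_module]) (auto intro!: E_lin_intros simp: K.add_x)

lemma sig_smult: "r \<in> carrier R \<Longrightarrow> a \<in> carrier M \<Longrightarrow> z \<in> carrier E \<Longrightarrow>
    sig (r \<odot>\<^bsub>M\<^esub> a) z = r \<odot>\<^bsub>E\<^esub> sig a z"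
  by (rule E_eqI[OF P.module_pres_module]) (auto intro!: E_lin_intros simp: K.smult_x)

lemma sig_sig: "a \<in> carrier M \<Longrightarrow> b \<in> carrier M \<Longrightarrow> z \<in> carrier E \<Longrightarrow> sig a (sig b z) = sig b (sig a z)"
  by (rule E_eqI[OF P.module_pres_module linear_maps_comp[OF sig_linear sig_linear]
        linear_maps_comp[OF sig_linear sig_linear]])
    (simp_all, rule K.sym, simp_all add: add_mset_commute)

lemma lam_sig: "a \<in> carrier M \<Longrightarrow> b \<in> carrier M \<Longrightarrow> z \<in> carrier E \<Longrightarrow> lam a (sig b z) = sig b (lam a z)"
  by (rule E_eqI[OF P.module_pres_module linear_maps_comp[OF sig_linear lam_linear]
        linear_maps_comp[OF lam_linear sig_linear]]) simp_all

lemma lam_self: "a \<in> carrier M \<Longrightarrow> z \<in> carrier E \<Longrightarrow> lam a (lam a z) = \<zero>\<^bsub>E\<^esub>"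
  by (rule E_eqI[OF P.module_pres_module linear_maps_comp[OF lam_linear lam_linear]
        linear_maps_zero[OF P.module_pres_module]]) (simp_all add: K.alt)

lemma lam_lam:
  assumes "a \<in> carrier M" "b \<in> carrier M" "z \<in> carrier E"
  shows "lam a (lam b z) = \<ominus>\<^bsub>E\<^esub> lam b (lam a z)"
proof -
  have "\<zero>\<^bsub>E\<^esub> = lam (a \<oplus>\<^bsub>M\<^esub> b) (lam (a \<oplus>\<^bsub>M\<^esub> b) z)"
    using assms by (simp add: lam_self)
  also have "\<dots> = lam a (lam b z) \<oplus>\<^bsub>E\<^esub> lam b (lam a z)"
    using assms by (simp add: lam_add lam_simps lam_self P.P.a_comm)
  finally show ?thesis
    using assms P.P.minus_equality[of "lam a (lam b z)" "lam b (lam a z)"] by simp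
qed

section \<open>The Koszul differential\<close>

primrec dterm where
  "dterm xs [] y = \<zero>\<^bsub>E\<^esub>"
| "dterm xs (a # as) y = cl (a # xs) as y \<ominus>\<^bsub>E\<^esub> lam a (dterm xs as y)"

lemma dterm_linear: "ok xs \<Longrightarrow> ok as \<Longrightarrow> dterm xs as \<in> linear_maps R N E"
proof (induction as)
  case Nil
  show ?case
    using linear_maps_zero[OF P.module_pres_module] by simp
next
  case (Cons a as)
  then have "(\<lambda>y. cl (a # xs) as y \<ominus>\<^bsub>E\<^esub> lam a (dterm xs as y)) \<in> linear_maps R N E"
    by (intro linear_maps_minus[OF P.module_pres_module] K.lin
        linear_maps_comp[OF _ lam_linear, of "dterm xs as"]) auto
  then show ?case by simp
qed

lemmas dterm_closed [simp] = lin_closed[OF dterm_linear]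

lemma lam_dterm:
  "a \<in> set as \<Longrightarrow> ok xs \<Longrightarrow> ok as \<Longrightarrow> y \<in> carrier N \<Longrightarrow> lam a (dterm xs as y) = cl (a # xs) as y"
proof (induction as)
  case (Cons b bs)
  have *: "lam a (dterm xs (b # bs) y) = cl (b # xs) (a # bs) y \<ominus>\<^bsub>E\<^esub> lam a (lam b (dterm xs bs y))"
    using Cons.prems subsetD[OF Cons.prems(3,1)] by (simp add: lam_simps)
  show ?case
  proof (cases "a = b")
    case True
    then show ?thesis
      unfolding * using Cons.prems by (simp add: lam_self P.P.minus_eq P.P.uminus_eq_smult)
  next
    case False
    then have a: "a \<in> set bs" "a \<in> carrier M" using Cons.prems by auto
    have "lam a (lam b (dterm xs bs y)) = \<ominus>\<^bsub>E\<^esub> lam b (lam a (dterm xs bs y))"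
      using Cons.prems a by (intro lam_lam) auto
    also have "lam b (lam a (dterm xs bs y)) = cl (a # xs) (b # bs) y"
      using Cons.prems a by (simp add: Cons.IH)
    finally show ?thesis
      unfolding * using Cons.prems a K.alt[of "a # bs" "b # xs" y] by (simp add: P.P.minus_eq)
  qed
qed simp

lemmas group_simps = P.P.minus_eq P.P.minus_add P.P.a_ac P.P.minus_minus

lemma kml_dterm: "kml R M N AM BM E dterm"
proof (unfold_locales, goal_cases)
  case (1 xs as)
  then show ?case by (rule dterm_linear)
next
  case (2 a b xs as y)
  from 2(5) show ?case
  proof (induction as)
    case (Cons c as)
    then show ?case
      using 2 kml.add_x[OF kml_sig[of c], of a b xs as y] by (simp add: lam_simps group_simps)
  qed simp
next
  case (3 r a xs as y)
  from 3(5) show ?case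
  proof (induction as)
    case (Cons c as)
    then show ?case
      using 3 kml.smult_x[OF kml_sig[of c], of r a xs as y]
      by (simp add: lam_simps P.P.minus_eq P.P.smult_r_distr P.P.smult_r_minus)
  qed (use 3 in simp)
next
  case (4 xs xs' as y)
  from 4(3) show ?case
  proof (induction as)
    case (Cons c as)
    then show ?case
      using kml.sym[OF kml_sig[of c] 4(1,2) _ 4(4), of as] by simp
  qed simp
next
  case (5 a b xs ps qs y)
  from 5(5) show ?case
  proof (induction ps)
    case Nil
    then show ?case
      using 5 by (simp add: K.add_x lam_add group_simps)
  next
    case (Cons c ps)
    then show ?case
      using 5 by (simp add: K.add_as lam_simps group_simps)
  qed
next
  case (6 r a xs ps qs y)
  from 6(5) show ?case
  proof (induction ps)
    case Nil
    then show ?case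
      using 6 by (simp add: K.smult_x lam_smult P.P.minus_eq P.P.smult_r_distr P.P.smult_r_minus)
  next
    case (Cons c ps)
    then show ?case
      using 6 by (simp add: K.smult_as lam_simps P.P.minus_eq P.P.smult_r_distr P.P.smult_r_minus)
  qed
next
  case (7 as xs y)
  from 7(1,3) show ?case
  proof (induction as)
    case (Cons b bs)
    show ?case
    proof (cases "b \<in> set bs")
      case True
      then show ?thesis
        using Cons.prems 7 by (simp add: lam_dterm P.P.minus_eq P.P.r_neg)
    next
      case False
      then show ?thesis
        using Cons 7 by (simp add: K.alt lam_simps P.P.minus_eq_zero_iff)
    qed
  qed simp
qed

definition del where "del = lft E dterm"

lemma del_linear: "del \<in> linear_maps R E E"
  and del_cl [simp]: "ok xs \<Longrightarrow> ok as \<Longrightarrow> y \<in> carrier N \<Longrightarrow> del (cl xs as y) = dterm xs as y"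
  unfolding del_def
  by (simp_all add: lft_linear[OF P.module_pres_module kml_dterm] lft_cl[OF P.module_pres_module kml_dterm])

lemmas del_closed [simp] = lin_closed[OF del_linear]
lemmas del_simps = lin_add[OF del_linear] lin_smult[OF del_linear] lin_E_zero[OF del_linear]
  lin_E_neg[OF del_linear] lin_E_minus[OF del_linear]

lemma del_lam: "a \<in> carrier M \<Longrightarrow> z \<in> carrier E \<Longrightarrow> del (lam a z) = sig a z \<ominus>\<^bsub>E\<^esub> lam a (del z)"
  by (rule E_eqI[OF P.module_pres_module linear_maps_comp[OF lam_linear del_linear]
        linear_maps_minus[OF P.module_pres_module sig_linear linear_maps_comp[OF del_linear lam_linear]]])
    simp_all

lemma dterm_Cons:
  "b \<in> carrier M \<Longrightarrow> ok xs \<Longrightarrow> ok as \<Longrightarrow> y \<in> carrier N \<Longrightarrow> dterm (b # xs) as y = sig b (dterm xs as y)"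
proof (induction as)
  case (Cons a as)
  then show ?case
    by (simp add: lam_sig sig_simps K.sym[of "a # b # xs" "b # a # xs"] add_mset_commute)
qed (simp add: sig_simps)

lemma del_sig: "a \<in> carrier M \<Longrightarrow> z \<in> carrier E \<Longrightarrow> del (sig a z) = sig a (del z)"
  by (rule E_eqI[OF P.module_pres_module linear_maps_comp[OF sig_linear del_linear]
        linear_maps_comp[OF del_linear sig_linear]]) (simp_all add: dterm_Cons)

lemma del_dterm: "ok xs \<Longrightarrow> ok as \<Longrightarrow> y \<in> carrier N \<Longrightarrow> del (dterm xs as y) = \<zero>\<^bsub>E\<^esub>"
proof (induction as)
  case (Cons a as)
  then show ?case
    by (simp add: del_simps del_lam dterm_Cons lam_simps P.P.minus_eq P.P.r_neg P.P.minus_add P.P.r_zero)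
qed (simp add: del_simps)

lemma del_del: "z \<in> carrier E \<Longrightarrow> del (del z) = \<zero>\<^bsub>E\<^esub>"
  by (rule E_eqI[OF P.module_pres_module linear_maps_comp[OF del_linear del_linear]
        linear_maps_zero[OF P.module_pres_module]]) (simp_all add: del_dterm)

section \<open>The homotopy of multiplication by the degree\<close>

primrec sterm where
  "sterm [] as y = \<zero>\<^bsub>E\<^esub>"
| "sterm (x # xs) as y = cl xs (x # as) y \<oplus>\<^bsub>E\<^esub> sig x (sterm xs as y)"

lemma sterm_linear: "ok xs \<Longrightarrow> ok as \<Longrightarrow> sterm xs as \<in> linear_maps R N E"
proof (induction xs)
  case Nil
  have "sterm [] as = (\<lambda>y. \<zero>\<^bsub>E\<^esub>)" by (rule ext) simp
  then show ?case
    using linear_maps_zero[OF P.module_pres_module] by simp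
next
  case (Cons x xs)
  then have "(\<lambda>y. cl xs (x # as) y \<oplus>\<^bsub>E\<^esub> sig x (sterm xs as y)) \<in> linear_maps R N E"
    by (intro linear_maps_add[OF P.module_pres_module] K.lin
        linear_maps_comp[OF _ sig_linear, of "sterm xs as"]) auto
  moreover have "sterm (x # xs) as = (\<lambda>y. cl xs (x # as) y \<oplus>\<^bsub>E\<^esub> sig x (sterm xs as y))"
    by (rule ext) simp
  ultimately show ?case by simp
qed

lemmas sterm_closed [simp] = lin_closed[OF sterm_linear]

lemma sterm_move:
  "ok ps \<Longrightarrow> x \<in> carrier M \<Longrightarrow> ok qs \<Longrightarrow> ok as \<Longrightarrow> y \<in> carrier N \<Longrightarrow>
     sterm (ps @ x # qs) as y = sterm (x # ps @ qs) as y"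
proof (induction ps)
  case (Cons p ps)
  then show ?case
    using K.sym[of "ps @ x # qs" "x # ps @ qs" "p # as" y]
    by (simp add: sig_simps sig_sig[of p x] P.P.a_ac)
qed simp

lemma kml_sterm: "kml R M N AM BM E sterm"
proof (unfold_locales, goal_cases)
  case (1 xs as)
  then show ?case by (rule sterm_linear)
next
  case (2 a b xs as y)
  then show ?case
    using K.add_as[of a b xs "[]" as y] by (simp add: sig_add P.P.a_ac)
next
  case (3 r a xs as y)
  then show ?case
    using K.smult_as[of r a xs "[]" as y] by (simp add: sig_smult P.P.smult_r_distr)
next
  case (4 xs xs' as y)
  from 4(1,2) show ?case
  proof (induction xs arbitrary: xs')
    case (Cons x xs)
    then have "x \<in> set xs'"
      by (metis list.set_intros(1) set_mset_mset)
    then obtain ps qs where xs': "xs' = ps @ x # qs"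
      by (auto dest: split_list)
    have m: "mset xs = mset (ps @ qs)"
      using Cons.prems xs' by simp
    then have okpq: "ok (ps @ qs)"
      using Cons.prems by (metis set_mset_mset set_subset_Cons subset_trans)
    have "sterm xs as y = sterm (ps @ qs) as y"
      using Cons.IH[OF m] Cons.prems by simp
    then show ?case
      using sterm_move[of ps x qs as y] K.sym[OF m, of "x # as" y] okpq Cons.prems 4 xs' by simp
  qed simp
next
  case (5 a b xs ps qs y)
  from 5(4) show ?case
  proof (induction xs)
    case (Cons x xs)
    then show ?case
      using 5 K.add_as[of a b xs "x # ps" qs y] by (simp add: sig_simps P.P.a_ac)
  qed simp
next
  case (6 r a xs ps qs y)
  from 6(4) show ?case
  proof (induction xs)
    case (Cons x xs)
    then show ?case
      using 6 K.smult_as[of r a xs "x # ps" qs y] by (simp add: sig_simps P.P.smult_r_distr)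
  qed (use 6 in simp)
next
  case (7 as xs y)
  from 7(2) show ?case
  proof (induction xs)
    case (Cons x xs)
    then show ?case
      using 7 K.alt[of "x # as" xs y] by (simp add: sig_simps)
  qed simp
qed

definition hom where "hom = lft E sterm"

lemma hom_linear: "hom \<in> linear_maps R E E"
  and hom_cl [simp]: "ok xs \<Longrightarrow> ok as \<Longrightarrow> y \<in> carrier N \<Longrightarrow> hom (cl xs as y) = sterm xs as y"
  unfolding hom_def
  by (simp_all add: lft_linear[OF P.module_pres_module kml_sterm] lft_cl[OF P.module_pres_module kml_sterm])

lemmas hom_closed [simp] = lin_closed[OF hom_linear]
lemmas hom_simps = lin_add[OF hom_linear] lin_smult[OF hom_linear] lin_E_zero[OF hom_linear]
  lin_E_neg[OF hom_linear] lin_E_minus[OF hom_linear]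

lemma hom_sig: "a \<in> carrier M \<Longrightarrow> z \<in> carrier E \<Longrightarrow> hom (sig a z) = lam a z \<oplus>\<^bsub>E\<^esub> sig a (hom z)"
  by (rule E_eqI[OF P.module_pres_module linear_maps_comp[OF sig_linear hom_linear]
        linear_maps_add[OF P.module_pres_module lam_linear linear_maps_comp[OF hom_linear sig_linear]]])
    simp_all

lemma cl_swap:
  "a \<in> carrier M \<Longrightarrow> b \<in> carrier M \<Longrightarrow> ok xs \<Longrightarrow> ok as \<Longrightarrow> y \<in> carrier N \<Longrightarrow>
     cl xs (a # b # as) y = \<ominus>\<^bsub>E\<^esub> cl xs (b # a # as) y"
  using lam_lam[of a b "cl xs as y"] by simp

lemma sterm_lam:
  "a \<in> carrier M \<Longrightarrow> ok xs \<Longrightarrow> ok as \<Longrightarrow> y \<in> carrier N \<Longrightarrow>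
     sterm xs (a # as) y = \<ominus>\<^bsub>E\<^esub> lam a (sterm xs as y)"
proof (induction xs)
  case Nil
  then show ?case by (simp add: lam_simps P.P.uminus_eq_smult)
next
  case (Cons x xs)
  then show ?case
    using cl_swap[of x a xs as y] by (simp add: lam_simps sig_simps lam_sig P.P.minus_add)
qed

lemma hom_lam: "a \<in> carrier M \<Longrightarrow> z \<in> carrier E \<Longrightarrow> hom (lam a z) = \<ominus>\<^bsub>E\<^esub> lam a (hom z)"
  by (rule E_eqI[OF P.module_pres_module linear_maps_comp[OF lam_linear hom_linear]
        linear_maps_neg[OF P.module_pres_module linear_maps_comp[OF hom_linear lam_linear]]])
    (simp_all add: sterm_lam)

lemma homotopy_sig:
  assumes "x \<in> carrier M" "z \<in> carrier E"
  shows "del (hom (sig x z)) \<oplus>\<^bsub>E\<^esub> hom (del (sig x z)) =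
    sig x z \<oplus>\<^bsub>E\<^esub> sig x (del (hom z) \<oplus>\<^bsub>E\<^esub> hom (del z))"
  using assms by (simp add: hom_sig del_sig del_simps del_lam sig_simps P.P.minus_eq P.P.a_ac)
    (simp add: P.P.cancel_simps)

lemma homotopy_lam:
  assumes "x \<in> carrier M" "z \<in> carrier E"
  shows "del (hom (lam x z)) \<oplus>\<^bsub>E\<^esub> hom (del (lam x z)) =
    lam x z \<oplus>\<^bsub>E\<^esub> lam x (del (hom z) \<oplus>\<^bsub>E\<^esub> hom (del z))"
  using assms
  by (simp add: hom_lam hom_simps hom_sig del_simps del_lam lam_simps P.P.minus_eq P.P.minus_add P.P.a_ac)
    (simp add: P.P.cancel_simps)

lemma homotopy_cl:
  assumes "ok xs" "ok as" "y \<in> carrier N"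
  shows "del (hom (cl xs as y)) \<oplus>\<^bsub>E\<^esub> hom (del (cl xs as y)) =
    ([(length xs + length as)] \<cdot>\<^bsub>R\<^esub> \<one>) \<odot>\<^bsub>E\<^esub> cl xs as y"
  using assms(1)
proof (induction xs)
  case Nil
  show ?case
    using assms(2)
  proof (induction as)
    case Nil
    then show ?case
      using assms by (simp add: del_simps hom_simps)
  next
    case (Cons a as)
    let ?z = "cl [] as y"
    have "del (hom (lam a ?z)) \<oplus>\<^bsub>E\<^esub> hom (del (lam a ?z)) = lam a ?z \<oplus>\<^bsub>E\<^esub> lam a (([(length as)] \<cdot>\<^bsub>R\<^esub> \<one>) \<odot>\<^bsub>E\<^esub> ?z)"
      using Cons assms by (subst homotopy_lam) simp_all
    then show ?case
      using Cons.prems assms(3)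
      by (simp add: lam_simps P.P.smult_l_distr P.P.a_comm del: hom_cl del_cl)
  qed
next
  case (Cons x xs)
  let ?z = "cl xs as y"
  have "del (hom (sig x ?z)) \<oplus>\<^bsub>E\<^esub> hom (del (sig x ?z)) =
      sig x ?z \<oplus>\<^bsub>E\<^esub> sig x (([(length xs + length as)] \<cdot>\<^bsub>R\<^esub> \<one>) \<odot>\<^bsub>E\<^esub> ?z)"
    using Cons assms by (subst homotopy_sig) simp_all
  then show ?case
    using Cons.prems assms(2,3)
    by (simp add: sig_simps P.P.smult_l_distr P.P.a_comm del: hom_cl del_cl)
qed

end

section \<open>Partially linear maps and rank one steps\<close>

definition partially_linear where
  "partially_linear R M A B f \<longleftrightarrow> f \<in> carrier M \<rightarrow> carrier M \<and>
     (\<forall>(a, b) \<in> A. a \<in> carrier M \<longrightarrow> b \<in> carrier M \<longrightarrow> f (a \<oplus>\<^bsub>M\<^esub> b) = f a \<oplus>\<^bsub>M\<^esub> f b) \<and>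
     (\<forall>(r, a) \<in> B. r \<in> carrier R \<longrightarrow> a \<in> carrier M \<longrightarrow> f (r \<odot>\<^bsub>M\<^esub> a) = r \<odot>\<^bsub>M\<^esub> f a)"

lemma partially_linearD:
  assumes "partially_linear R M A B f"
  shows "x \<in> carrier M \<Longrightarrow> f x \<in> carrier M"
    and "(a, b) \<in> A \<Longrightarrow> a \<in> carrier M \<Longrightarrow> b \<in> carrier M \<Longrightarrow> f (a \<oplus>\<^bsub>M\<^esub> b) = f a \<oplus>\<^bsub>M\<^esub> f b"
    and "(r, a) \<in> B \<Longrightarrow> r \<in> carrier R \<Longrightarrow> a \<in> carrier M \<Longrightarrow> f (r \<odot>\<^bsub>M\<^esub> a) = r \<odot>\<^bsub>M\<^esub> f a"
  using assms unfolding partially_linear_def by auto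

inductive reachable for R M A B where
  zero: "reachable R M A B (\<lambda>_. \<zero>\<^bsub>M\<^esub>)"
| step: "reachable R M A B g \<Longrightarrow> partially_linear R M A B f \<Longrightarrow> e \<in> carrier M \<Longrightarrow>
    (\<And>x. x \<in> carrier M \<Longrightarrow> \<exists>c \<in> carrier R. f x = g x \<oplus>\<^bsub>M\<^esub> c \<odot>\<^bsub>M\<^esub> e) \<Longrightarrow> reachable R M A B f"

lemma reachable_partially_linear:
  assumes "module R M" "reachable R M A B f"
  shows "partially_linear R M A B f"
proof -
  interpret M: module R M by fact
  from assms(2) show ?thesis
  proof cases
    case zero
    then show ?thesis by (auto simp: partially_linear_def)
  qed
qed

text \<open>
  The identity of \<open>M\<close> is, up to finitely many conditions, a sum of maps with values in cyclic
  submodules.  This holds for direct limits of finite direct sums of cyclic modules.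
\<close>

definition locally_split where
  "locally_split R M \<longleftrightarrow> (\<forall>T A B. finite T \<longrightarrow> finite A \<longrightarrow> finite B \<longrightarrow> T \<subseteq> carrier M \<longrightarrow>
     A \<subseteq> carrier M \<times> carrier M \<longrightarrow> B \<subseteq> carrier R \<times> carrier M \<longrightarrow>
     (\<exists>f. reachable R M A B f \<and> (\<forall>x \<in> T. f x = x)))"

lemma kml_antimono:
  assumes "kml R M N A B W D" "A' \<subseteq> A" "B' \<subseteq> B"
  shows "kml R M N A' B' W D"
proof -
  interpret kml R M N A B W D by fact
  show ?thesis
    using subsetD[OF assms(2)] subsetD[OF assms(3)]
    by (intro kml.intro lin add_x smult_x sym add_as smult_as alt)
qed

context two_modules
begin

definition flft where
  "flft W D = free_lift R W (\<lambda>(xs, as, y). D xs as y)"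

abbreviation "gen xs as y \<equiv> free_gen R (xs, as, y)"

lemma gen_closed [simp]: "ok xs \<Longrightarrow> ok as \<Longrightarrow> y \<in> carrier N \<Longrightarrow> gen xs as y \<in> carrier FT"
  by (rule free_gen_closed[OF M.R.cring_axioms]) (simp add: in_triples)

lemma
  assumes "module R W" "\<And>xs as y. ok xs \<Longrightarrow> ok as \<Longrightarrow> y \<in> carrier N \<Longrightarrow> D xs as y \<in> carrier W"
  shows flft_linear: "flft W D \<in> linear_maps R FT W"
    and flft_gen: "ok xs \<Longrightarrow> ok as \<Longrightarrow> y \<in> carrier N \<Longrightarrow> flft W D (gen xs as y) = D xs as y"
proof -
  have c: "(\<lambda>(xs, as, y). D xs as y) \<in> triples M N \<rightarrow> carrier W"
    using assms(2) by (auto simp: in_triples)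
  show "flft W D \<in> linear_maps R FT W"
    unfolding flft_def by (rule free_lift_linear[OF assms(1) c])
  show "ok xs \<Longrightarrow> ok as \<Longrightarrow> y \<in> carrier N \<Longrightarrow> flft W D (gen xs as y) = D xs as y"
    unfolding flft_def using free_lift_gen[OF assms(1) c, of "(xs, as, y)"] by (simp add: in_triples)
qed

lemma FT_eqI:
  assumes "module R W" "f \<in> linear_maps R FT W" "g \<in> linear_maps R FT W"
    and "\<And>xs as y. ok xs \<Longrightarrow> ok as \<Longrightarrow> y \<in> carrier N \<Longrightarrow> f (gen xs as y) = g (gen xs as y)"
    and "Z \<in> carrier FT"
  shows "f Z = g Z"
  using assms(1-3) _ assms(5)
  by (rule free_module_linear_eqI) (use assms(4) in \<open>auto simp: in_triples\<close>)

abbreviation "proj \<equiv> pres_proj R (triples M N) (kos_rels R M N AM BM)"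

lemma proj_gen: "proj (gen xs as y) = cl xs as y"
  by (simp add: P.pres_proj_gen cl_def)

definition lamF where "lamF a = flft FT (\<lambda>xs as y. gen xs (a # as) y)"

lemma lamF_linear: "a \<in> carrier M \<Longrightarrow> lamF a \<in> linear_maps R FT FT"
  and lamF_gen: "a \<in> carrier M \<Longrightarrow> ok xs \<Longrightarrow> ok as \<Longrightarrow> y \<in> carrier N \<Longrightarrow> lamF a (gen xs as y) = gen xs (a # as) y"
  unfolding lamF_def by (intro flft_linear flft_gen P.F.module_axioms; simp)+

primrec dtermF where
  "dtermF xs [] y = \<zero>\<^bsub>FT\<^esub>"
| "dtermF xs (a # as) y = gen (a # xs) as y \<ominus>\<^bsub>FT\<^esub> lamF a (dtermF xs as y)"

lemma dtermF_closed [simp]: "ok xs \<Longrightarrow> ok as \<Longrightarrow> y \<in> carrier N \<Longrightarrow> dtermF xs as y \<in> carrier FT"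
  by (induction as) (auto intro: lin_closed[OF lamF_linear])

definition delF where "delF = flft FT dtermF"

lemma delF_linear: "delF \<in> linear_maps R FT FT"
  and delF_gen: "ok xs \<Longrightarrow> ok as \<Longrightarrow> y \<in> carrier N \<Longrightarrow> delF (gen xs as y) = dtermF xs as y"
  unfolding delF_def by (intro flft_linear flft_gen P.F.module_axioms; simp)+

lemma proj_lamF: "a \<in> carrier M \<Longrightarrow> Z \<in> carrier FT \<Longrightarrow> proj (lamF a Z) = lam a (proj Z)"
  by (rule FT_eqI[OF P.module_pres_module linear_maps_comp[OF lamF_linear P.pres_proj_linear]
        linear_maps_comp[OF P.pres_proj_linear lam_linear]]) (simp_all add: lamF_gen proj_gen)

lemma proj_dtermF: "ok xs \<Longrightarrow> ok as \<Longrightarrow> y \<in> carrier N \<Longrightarrow> proj (dtermF xs as y) = dterm xs as y"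
proof (induction as)
  case Nil
  then show ?case
    using lin_zero[OF P.F.module_axioms P.module_pres_module P.pres_proj_linear] by simp
next
  case (Cons a as)
  then show ?case
    using lin_minus[OF P.F.module_axioms P.module_pres_module P.pres_proj_linear]
    by (simp add: proj_gen proj_lamF lin_closed[OF lamF_linear])
qed

lemma proj_delF: "Z \<in> carrier FT \<Longrightarrow> proj (delF Z) = del (proj Z)"
  by (rule FT_eqI[OF P.module_pres_module linear_maps_comp[OF delF_linear P.pres_proj_linear]
        linear_maps_comp[OF P.pres_proj_linear del_linear]]) (simp_all add: delF_gen proj_gen proj_dtermF)

lemma kernel_finite_support:
  assumes "Z \<in> submodule_generated R FT (kos_rels R M N AM BM)"
  shows "\<exists>A B. finite A \<and> finite B \<and> A \<subseteq> AM \<and> B \<subseteq> BM \<and> (\<forall>D. kml R M N A B E D \<longrightarrow> flft E D Z = \<zero>\<^bsub>E\<^esub>)"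
proof -
  have l: "flft E D \<in> linear_maps R FT E" if "kml R M N A B E D" for D A B
    by (rule flft_linear[OF P.module_pres_module]) (rule lin_closed[OF kml.lin[OF that]])
  show ?thesis
    using P.rels_closed assms
  proof (induction rule: P.F.submodule_generated_induct)
    case (incl \<rho>)
    then obtain A B where "finite A" "finite B" "A \<subseteq> AM" "B \<subseteq> BM" "\<rho> \<in> kos_rels R M N A B"
      by (rule kos_rels_finite)
    then show ?case
      using free_lift_kos_rel[OF P.module_pres_module] unfolding flft_def
      by (intro exI[of _ A] exI[of _ B]) auto
  next
    case zero
    have "flft E D \<zero>\<^bsub>FT\<^esub> = \<zero>\<^bsub>E\<^esub>" if "kml R M N {} {} E D" for D
      by (rule lin_zero[OF P.F.module_axioms P.module_pres_module l[OF that]])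
    then show ?case
      by (intro exI[of _ "{}"]) simp
  next
    case (add x y)
    then obtain A B A' B' where *: "finite A" "finite B" "A \<subseteq> AM" "B \<subseteq> BM"
      "\<And>D. kml R M N A B E D \<Longrightarrow> flft E D x = \<zero>\<^bsub>E\<^esub>"
      "finite A'" "finite B'" "A' \<subseteq> AM" "B' \<subseteq> BM"
      "\<And>D. kml R M N A' B' E D \<Longrightarrow> flft E D y = \<zero>\<^bsub>E\<^esub>"
      by auto
    have "flft E D (x \<oplus>\<^bsub>FT\<^esub> y) = \<zero>\<^bsub>E\<^esub>" if D: "kml R M N (A \<union> A') (B \<union> B') E D" for D
      using *(5)[OF kml_antimono[OF D]] *(10)[OF kml_antimono[OF D]] lin_add[OF l[OF D] add(1,2)] by simp
    then show ?case
      using * by (intro exI[of _ "A \<union> A'"] exI[of _ "B \<union> B'"]) auto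
  next
    case (smult r x)
    then obtain A B where *: "finite A" "finite B" "A \<subseteq> AM" "B \<subseteq> BM"
      "\<And>D. kml R M N A B E D \<Longrightarrow> flft E D x = \<zero>\<^bsub>E\<^esub>"
      by auto
    then show ?case
      using lin_smult[OF l smult(1,2)] smult(1) by (intro exI[of _ A] exI[of _ B]) auto
  qed
qed

definition kmap where "kmap f xs as y = cl (map f xs) (map f as) y"

lemma ok_map [simp]: "f \<in> carrier M \<rightarrow> carrier M \<Longrightarrow> ok xs \<Longrightarrow> ok (map f xs)"
  by auto

lemma kmap_closed [simp]:
  "f \<in> carrier M \<rightarrow> carrier M \<Longrightarrow> ok xs \<Longrightarrow> ok as \<Longrightarrow> y \<in> carrier N \<Longrightarrow> kmap f xs as y \<in> carrier E"
  unfolding kmap_def by (intro cl_closed ok_map)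

lemma kmap_Cons_x: "f \<in> carrier M \<rightarrow> carrier M \<Longrightarrow> x \<in> carrier M \<Longrightarrow> ok xs \<Longrightarrow> ok as \<Longrightarrow> y \<in> carrier N \<Longrightarrow>
    kmap f (x # xs) as y = sig (f x) (kmap f xs as y)"
  and kmap_Cons_as: "f \<in> carrier M \<rightarrow> carrier M \<Longrightarrow> x \<in> carrier M \<Longrightarrow> ok xs \<Longrightarrow> ok as \<Longrightarrow> y \<in> carrier N \<Longrightarrow>
    kmap f xs (x # as) y = lam (f x) (kmap f xs as y)"
  unfolding kmap_def using ok_map[of f xs] ok_map[of f as] by (simp_all add: funcset_mem)

lemma kmap_linear: "f \<in> carrier M \<rightarrow> carrier M \<Longrightarrow> ok xs \<Longrightarrow> ok as \<Longrightarrow> kmap f xs as \<in> linear_maps R N E"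
  unfolding kmap_def[abs_def] by (intro K.lin ok_map)

lemma flft_kmap_linear: "f \<in> carrier M \<rightarrow> carrier M \<Longrightarrow> flft E (kmap f) \<in> linear_maps R FT E"
  and flft_kmap_gen: "f \<in> carrier M \<rightarrow> carrier M \<Longrightarrow> ok xs \<Longrightarrow> ok as \<Longrightarrow> y \<in> carrier N \<Longrightarrow>
    flft E (kmap f) (gen xs as y) = kmap f xs as y"
  by (intro flft_linear flft_gen P.module_pres_module kmap_closed; assumption)+

lemma kmap_finite_support:
  assumes "Z \<in> carrier FT"
  shows "\<exists>T. finite T \<and> T \<subseteq> carrier M \<and>
    (\<forall>f \<in> carrier M \<rightarrow> carrier M. (\<forall>x \<in> T. f x = x) \<longrightarrow> flft E (kmap f) Z = proj Z)"
proof -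
  note l = flft_kmap_linear
  note lm = linear_mapsD[OF l, unfolded free_module_simps]
  note pm = linear_mapsD[OF P.pres_proj_linear, unfolded free_module_simps]
  show ?thesis
    using M.R.cring_axioms assms
  proof (induction rule: free_module_induct)
    case zero
    show ?case
      using lin_zero[OF P.F.module_axioms P.module_pres_module l]
        lin_zero[OF P.F.module_axioms P.module_pres_module P.pres_proj_linear]
      by (intro exI[of _ "{}"]) (auto simp: free_module_simps)
  next
    case (add F G)
    then obtain T T' where "finite T" "T \<subseteq> carrier M" "finite T'" "T' \<subseteq> carrier M"
      and 1: "\<And>f. f \<in> carrier M \<rightarrow> carrier M \<Longrightarrow> (\<forall>x \<in> T. f x = x) \<Longrightarrow> flft E (kmap f) F = proj F"
      and 2: "\<And>f. f \<in> carrier M \<rightarrow> carrier M \<Longrightarrow> (\<forall>x \<in> T'. f x = x) \<Longrightarrow> flft E (kmap f) G = proj G"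
      by auto
    then show ?case
      using add(1,2) by (intro exI[of _ "T \<union> T'"]) (auto simp: lm(2) pm(2))
  next
    case (smult r F)
    then obtain T where "finite T" "T \<subseteq> carrier M"
      and 1: "\<And>f. f \<in> carrier M \<rightarrow> carrier M \<Longrightarrow> (\<forall>x \<in> T. f x = x) \<Longrightarrow> flft E (kmap f) F = proj F"
      by auto
    then show ?case
      using smult(1,2) by (intro exI[of _ T]) (auto simp: lm(3) pm(3))
  next
    case (gen t)
    obtain xs as y where t: "t = (xs, as, y)" by (cases t)
    with gen have *: "ok xs" "ok as" "y \<in> carrier N" by (auto simp: in_triples)
    have "flft E (kmap f) (free_gen R t) = proj (free_gen R t)"
      if f: "f \<in> carrier M \<rightarrow> carrier M" "\<forall>x \<in> set xs \<union> set as. f x = x" for f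
    proof -
      have "map f xs = xs" "map f as = as"
        using f(2) by (auto intro!: map_idI)
      then show ?thesis
        using * f(1) flft_kmap_gen by (simp add: t proj_gen kmap_def)
    qed
    then show ?case
      using * by (intro exI[of _ "set xs \<union> set as"]) auto
  qed
qed

end

locale rank_one_step = two_modules R M N
  for R :: "('r, 's) ring_scheme" (structure) and M :: "('r, 'm, 't) module_scheme"
    and N :: "('r, 'n, 'u) module_scheme" +
  fixes A B f g e
  assumes pl_f: "partially_linear R M A B f" and pl_g: "partially_linear R M A B g"
    and e: "e \<in> carrier M"
    and step: "x \<in> carrier M \<Longrightarrow> \<exists>c \<in> carrier R. f x = g x \<oplus>\<^bsub>M\<^esub> c \<odot>\<^bsub>M\<^esub> e"
begin

lemma f_fun [simp]: "f \<in> carrier M \<rightarrow> carrier M" and g_fun [simp]: "g \<in> carrier M \<rightarrow> carrier M"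
  using partially_linearD(1)[OF pl_f] partially_linearD(1)[OF pl_g] by auto

lemmas f_closed [simp] = partially_linearD(1)[OF pl_f]
lemmas g_closed [simp] = partially_linearD(1)[OF pl_g]

definition d where "d x = f x \<ominus>\<^bsub>M\<^esub> g x"

lemma d_closed [simp]: "x \<in> carrier M \<Longrightarrow> d x \<in> carrier M"
  by (simp add: d_def)

lemma f_eq: "x \<in> carrier M \<Longrightarrow> f x = g x \<oplus>\<^bsub>M\<^esub> d x"
  by (simp add: d_def M.minus_eq M.cancel_simps)

lemma d_multiple:
  assumes "x \<in> carrier M"
  obtains c where "c \<in> carrier R" "d x = c \<odot>\<^bsub>M\<^esub> e"
proof -
  obtain c where "c \<in> carrier R" "f x = g x \<oplus>\<^bsub>M\<^esub> c \<odot>\<^bsub>M\<^esub> e"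
    using step[OF assms] by auto
  then show ?thesis
    using assms e by (intro that[of c]) (auto simp: d_def M.minus_eq M.a_ac M.cancel_simps)
qed

lemma lam_sig_d:
  assumes "x \<in> carrier M" "y \<in> carrier M" "z \<in> carrier E"
  shows "lam (d x) (sig (d y) z) = lam (d y) (sig (d x) z)"
proof -
  obtain b c where "b \<in> carrier R" "d x = b \<odot>\<^bsub>M\<^esub> e" "c \<in> carrier R" "d y = c \<odot>\<^bsub>M\<^esub> e"
    using d_multiple assms by metis
  then show ?thesis
    using assms e by (simp add: lam_smult sig_smult lam_simps P.P.smult_assoc1[symmetric] M.R.m_comm)
qed

lemma lam_lam_d:
  assumes "x \<in> carrier M" "y \<in> carrier M" "z \<in> carrier E"
  shows "lam (d x) (lam (d y) z) = \<zero>\<^bsub>E\<^esub>"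
proof -
  obtain b c where "b \<in> carrier R" "d x = b \<odot>\<^bsub>M\<^esub> e" "c \<in> carrier R" "d y = c \<odot>\<^bsub>M\<^esub> e"
    using d_multiple assms by metis
  then show ?thesis
    using assms e by (simp add: lam_smult lam_simps lam_self)
qed

text \<open>
  This is \<open>x\<^sub>1 \<cdots> x\<^sub>m \<otimes> \<omega> \<mapsto> \<Sum>\<^sub>i (\<Prod>\<^bsub>l<i\<^esub> g x\<^sub>l) (\<Prod>\<^bsub>l>i\<^esub> f x\<^sub>l) \<otimes> (f x\<^sub>i - g x\<^sub>i) \<and> f \<omega>\<close>.
  It is symmetric in the \<open>x\<^sub>i\<close> only because all \<open>f x - g x\<close> are multiples of one element.
\<close>

primrec pterm where
  "pterm [] as y = \<zero>\<^bsub>E\<^esub>"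
| "pterm (x # xs) as y = lam (d x) (kmap f xs as y) \<oplus>\<^bsub>E\<^esub> sig (g x) (pterm xs as y)"

lemma pterm_linear: "ok xs \<Longrightarrow> ok as \<Longrightarrow> pterm xs as \<in> linear_maps R N E"
proof (induction xs)
  case Nil
  have "pterm [] as = (\<lambda>y. \<zero>\<^bsub>E\<^esub>)" by (rule ext) simp
  then show ?case
    using linear_maps_zero[OF P.module_pres_module] by simp
next
  case (Cons x xs)
  then have "(\<lambda>y. lam (d x) (kmap f xs as y) \<oplus>\<^bsub>E\<^esub> sig (g x) (pterm xs as y)) \<in> linear_maps R N E"
    by (intro linear_maps_add[OF P.module_pres_module] linear_maps_comp[OF kmap_linear lam_linear]
        linear_maps_comp[OF _ sig_linear, of "pterm xs as"]) auto
  moreover have "pterm (x # xs) as = (\<lambda>y. lam (d x) (kmap f xs as y) \<oplus>\<^bsub>E\<^esub> sig (g x) (pterm xs as y))"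
    by (rule ext) simp
  ultimately show ?case by simp
qed

lemmas pterm_closed [simp] = lin_closed[OF pterm_linear]

lemma kmap_sym:
  "mset xs = mset xs' \<Longrightarrow> ok xs \<Longrightarrow> ok as \<Longrightarrow> y \<in> carrier N \<Longrightarrow> kmap f xs as y = kmap f xs' as y"
  unfolding kmap_def by (rule K.sym) (auto simp: image_subset_iff subset_iff)

lemma pterm_move:
  "ok ps \<Longrightarrow> x \<in> carrier M \<Longrightarrow> ok qs \<Longrightarrow> ok as \<Longrightarrow> y \<in> carrier N \<Longrightarrow>
     pterm (ps @ x # qs) as y = pterm (x # ps @ qs) as y"
proof (induction ps)
  case (Cons p ps)
  let ?K = "kmap f (ps @ qs) as y" and ?p = "pterm (ps @ qs) as y"
  have K: "?K \<in> carrier E" "?p \<in> carrier E" using Cons.prems by simp_all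
  have "pterm ((p # ps) @ x # qs) as y =
      lam (d p) (sig (f x) ?K) \<oplus>\<^bsub>E\<^esub> sig (g p) (lam (d x) ?K \<oplus>\<^bsub>E\<^esub> sig (g x) ?p)"
    using Cons kmap_sym[of "ps @ x # qs" "x # ps @ qs" as y] by (simp add: kmap_Cons_x)
  also have "\<dots> = lam (d x) (sig (f p) ?K) \<oplus>\<^bsub>E\<^esub> sig (g x) (lam (d p) ?K \<oplus>\<^bsub>E\<^esub> sig (g p) ?p)"
    using Cons.prems K lam_sig_d[of p x ?K]
    by (simp add: f_eq sig_add lam_simps sig_simps sig_sig[of "g x" "g p"] lam_sig P.P.a_ac)
  also have "\<dots> = pterm (x # (p # ps) @ qs) as y"
    using Cons.prems by (simp add: kmap_Cons_x)
  finally show ?case .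
qed simp

lemma d_add: "(a, b) \<in> A \<Longrightarrow> a \<in> carrier M \<Longrightarrow> b \<in> carrier M \<Longrightarrow> d (a \<oplus>\<^bsub>M\<^esub> b) = d a \<oplus>\<^bsub>M\<^esub> d b"
  unfolding d_def using partially_linearD(2)[OF pl_f] partially_linearD(2)[OF pl_g]
  by (simp add: M.minus_eq M.minus_add M.a_ac)

lemma d_smult: "(r, a) \<in> B \<Longrightarrow> r \<in> carrier R \<Longrightarrow> a \<in> carrier M \<Longrightarrow> d (r \<odot>\<^bsub>M\<^esub> a) = r \<odot>\<^bsub>M\<^esub> d a"
  unfolding d_def using partially_linearD(3)[OF pl_f] partially_linearD(3)[OF pl_g]
  by (simp add: M.minus_eq M.smult_r_distr M.smult_r_minus)

lemma kml_pterm: "kml R M N A B E pterm"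
proof (unfold_locales, goal_cases)
  case (1 xs as)
  then show ?case by (rule pterm_linear)
next
  case (2 a b xs as y)
  then show ?case
    using partially_linearD(2)[OF pl_g] by (simp add: d_add lam_add sig_add P.P.a_ac)
next
  case (3 r a xs as y)
  then show ?case
    using partially_linearD(3)[OF pl_g] by (simp add: d_smult lam_smult sig_smult P.P.smult_r_distr)
next
  case (4 xs xs' as y)
  from 4(1,2) show ?case
  proof (induction xs arbitrary: xs')
    case (Cons x xs)
    then have "x \<in> set xs'"
      by (metis list.set_intros(1) set_mset_mset)
    then obtain ps qs where xs': "xs' = ps @ x # qs"
      by (auto dest: split_list)
    have m: "mset xs = mset (ps @ qs)"
      using Cons.prems xs' by simp
    then have okpq: "ok (ps @ qs)"
      using Cons.prems by (metis set_mset_mset set_subset_Cons subset_trans)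
    have "pterm xs as y = pterm (ps @ qs) as y"
      using Cons.IH[OF m] Cons.prems by simp
    then show ?case
      using pterm_move[of ps x qs as y] kmap_sym[OF m, of as y] okpq Cons.prems 4 xs' by simp
  qed simp
next
  case (5 a b xs ps qs y)
  have *: "kmap f zs (ps @ (a \<oplus>\<^bsub>M\<^esub> b) # qs) y = kmap f zs (ps @ a # qs) y \<oplus>\<^bsub>E\<^esub> kmap f zs (ps @ b # qs) y"
    if "ok zs" for zs
    unfolding kmap_def map_append list.map partially_linearD(2)[OF pl_f 5(1-3)]
    by (rule K.add_as) (use 5 that in \<open>auto simp: image_subset_iff subset_iff\<close>)
  from 5(4) show ?case
  proof (induction xs)
    case (Cons x xs)
    then show ?case
      using 5 *[of xs] by (simp add: lam_simps sig_simps P.P.a_ac)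
  qed simp
next
  case (6 r a xs ps qs y)
  have *: "kmap f zs (ps @ (r \<odot>\<^bsub>M\<^esub> a) # qs) y = r \<odot>\<^bsub>E\<^esub> kmap f zs (ps @ a # qs) y"
    if "ok zs" for zs
    unfolding kmap_def map_append list.map partially_linearD(3)[OF pl_f 6(1-3)]
    by (rule K.smult_as) (use 6 that in \<open>auto simp: image_subset_iff subset_iff\<close>)
  from 6(4) show ?case
  proof (induction xs)
    case (Cons x xs)
    then show ?case
      using 6 *[of xs] by (simp add: lam_simps sig_simps P.P.smult_r_distr)
  qed (use 6 in simp)
next
  case (7 as xs y)
  have *: "kmap f zs as y = \<zero>\<^bsub>E\<^esub>" if "ok zs" for zs
    unfolding kmap_def using 7 that by (intro K.alt ok_map f_fun) (auto simp: distinct_map)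
  from 7(2) show ?case
  proof (induction xs)
    case (Cons x xs)
    then show ?case
      using 7 *[of xs] by (simp add: lam_simps sig_simps)
  qed simp
qed

lemma lam_kmap_diff_Nil:
  "x \<in> carrier M \<Longrightarrow> ok as \<Longrightarrow> y \<in> carrier N \<Longrightarrow> lam (d x) (kmap f [] as y) = lam (d x) (kmap g [] as y)"
proof (induction as)
  case Nil
  then show ?case by (simp add: kmap_def)
next
  case (Cons a as)
  have "lam (d x) (kmap f [] (a # as) y) = lam (d x) (lam (g a) (kmap f [] as y))"
    using Cons.prems by (simp add: kmap_Cons_as f_eq lam_add lam_simps lam_lam_d)
  also have "\<dots> = \<ominus>\<^bsub>E\<^esub> lam (g a) (lam (d x) (kmap g [] as y))"
    using Cons by (simp add: lam_lam[of "d x" "g a"])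
  also have "\<dots> = lam (d x) (kmap g [] (a # as) y)"
    using Cons.prems by (simp add: kmap_Cons_as lam_lam[of "d x" "g a"])
  finally show ?case .
qed

text \<open>Both sides telescope to the same sum because all the differences \<open>f x - g x\<close> are multiples of \<open>e\<close>.\<close>

lemma lam_kmap_diff:
  "a \<in> carrier M \<Longrightarrow> ok xs \<Longrightarrow> ok as \<Longrightarrow> y \<in> carrier N \<Longrightarrow>
     lam (d a) (kmap f xs as y) = lam (d a) (kmap g xs as y) \<oplus>\<^bsub>E\<^esub> sig (d a) (pterm xs as y)"
proof (induction xs)
  case Nil
  then show ?case
    by (simp add: lam_kmap_diff_Nil sig_simps)
next
  case (Cons x xs)
  let ?F = "kmap f xs as y" and ?G = "kmap g xs as y" and ?p = "pterm xs as y"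
  have c: "?F \<in> carrier E" "?G \<in> carrier E" "?p \<in> carrier E" using Cons.prems by simp_all
  have "lam (d a) (kmap f (x # xs) as y) = sig (g x) (lam (d a) ?F) \<oplus>\<^bsub>E\<^esub> sig (d a) (lam (d x) ?F)"
    using Cons.prems c lam_sig_d[of a x ?F] by (simp add: kmap_Cons_x f_eq sig_add lam_simps lam_sig)
  also have "\<dots> = sig (g x) (lam (d a) ?G) \<oplus>\<^bsub>E\<^esub> (sig (d a) (lam (d x) ?F) \<oplus>\<^bsub>E\<^esub> sig (d a) (sig (g x) ?p))"
    using Cons c by (simp add: sig_simps sig_sig[of "d a" "g x"] P.P.a_ac)
  finally show ?case
    using Cons.prems c by (simp add: kmap_Cons_x lam_sig sig_simps)
qed

definition hp where "hp = flft E pterm"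

lemma hp_linear: "hp \<in> linear_maps R FT E"
  and hp_gen: "ok xs \<Longrightarrow> ok as \<Longrightarrow> y \<in> carrier N \<Longrightarrow> hp (gen xs as y) = pterm xs as y"
  unfolding hp_def by (intro flft_linear flft_gen P.module_pres_module; simp)+

lemma pterm_lam:
  "a \<in> carrier M \<Longrightarrow> ok xs \<Longrightarrow> ok as \<Longrightarrow> y \<in> carrier N \<Longrightarrow>
     pterm xs (a # as) y = \<ominus>\<^bsub>E\<^esub> lam (f a) (pterm xs as y)"
proof (induction xs)
  case Nil
  then show ?case by (simp add: lam_simps P.P.uminus_eq_smult)
next
  case (Cons x xs)
  then show ?case
    by (simp add: lam_simps sig_simps lam_sig P.P.minus_add kmap_Cons_as lam_lam[of "d x" "f a"])
qed

lemma hp_lamF: "a \<in> carrier M \<Longrightarrow> Z \<in> carrier FT \<Longrightarrow> hp (lamF a Z) = \<ominus>\<^bsub>E\<^esub> lam (f a) (hp Z)"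
  by (rule FT_eqI[OF P.module_pres_module linear_maps_comp[OF lamF_linear hp_linear]
        linear_maps_neg[OF P.module_pres_module linear_maps_comp[OF hp_linear lam_linear]]])
    (simp_all add: lamF_gen hp_gen pterm_lam)

lemma step_homotopy_gen:
  assumes "ok xs" "ok as" "y \<in> carrier N"
  shows "kmap f xs as y = kmap g xs as y \<oplus>\<^bsub>E\<^esub> (del (pterm xs as y) \<oplus>\<^bsub>E\<^esub> hp (dtermF xs as y))"
  using assms(2)
proof (induction as)
  case Nil
  have hz: "hp \<zero>\<^bsub>FT\<^esub> = \<zero>\<^bsub>E\<^esub>"
    by (rule lin_zero[OF P.F.module_axioms P.module_pres_module hp_linear])
  have dk: "del (kmap f zs [] y) = \<zero>\<^bsub>E\<^esub>" if "ok zs" for zs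
    using ok_map[OF f_fun that] assms(3) by (simp add: kmap_def)
  from assms(1) show ?case
  proof (induction xs)
    case Nil
    then show ?case
      using assms hz by (simp add: kmap_def del_simps)
  next
    case (Cons x xs)
    let ?F = "kmap f xs [] y" and ?G = "kmap g xs [] y" and ?p = "pterm xs [] y"
    have c: "?F \<in> carrier E" "?G \<in> carrier E" "?p \<in> carrier E" using Cons.prems assms by simp_all
    have IH: "?F = ?G \<oplus>\<^bsub>E\<^esub> del ?p"
      using Cons c hz by simp
    have "kmap f (x # xs) [] y = sig (g x) ?F \<oplus>\<^bsub>E\<^esub> sig (d x) ?F"
      using Cons.prems assms c by (simp add: kmap_Cons_x f_eq sig_add)
    also have "sig (g x) ?F = sig (g x) ?G \<oplus>\<^bsub>E\<^esub> sig (g x) (del ?p)"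
      using Cons.prems c by (subst IH) (simp add: sig_simps)
    finally show ?case
      using Cons.prems assms c hz dk[of xs]
      by (simp add: kmap_Cons_x del_simps del_lam del_sig lam_simps P.P.minus_eq P.P.uminus_eq_smult P.P.a_ac)
  qed
next
  case (Cons a as)
  let ?F = "kmap f xs as y" and ?G = "kmap g xs as y" and ?p = "pterm xs as y"
    and ?h = "hp (dtermF xs as y)"
  have dF: "dtermF xs as y \<in> carrier FT" using Cons.prems assms by simp
  have c: "?F \<in> carrier E" "?G \<in> carrier E" "?p \<in> carrier E" "?h \<in> carrier E"
    using Cons.prems assms lin_closed[OF hp_linear dF] by simp_all
  have a: "a \<in> carrier M" "ok as" using Cons.prems by auto
  have IH: "?F = ?G \<oplus>\<^bsub>E\<^esub> (del ?p \<oplus>\<^bsub>E\<^esub> ?h)"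
    using Cons.IH a by simp
  have hd: "hp (dtermF xs (a # as) y) = lam (d a) ?F \<oplus>\<^bsub>E\<^esub> sig (g a) ?p \<oplus>\<^bsub>E\<^esub> lam (f a) ?h"
    using a assms c dF lin_closed[OF lamF_linear[OF a(1)] dF]
      lin_minus[OF P.F.module_axioms P.module_pres_module hp_linear, of "gen (a # xs) as y" "lamF a (dtermF xs as y)"]
    by (simp add: hp_gen hp_lamF P.P.minus_eq P.P.minus_minus)
  have dp: "del (pterm xs (a # as) y) = lam (f a) (del ?p) \<ominus>\<^bsub>E\<^esub> sig (f a) ?p"
    using a assms c by (simp add: pterm_lam del_simps del_lam group_simps)
  have "kmap f xs (a # as) y = lam (f a) ?G \<oplus>\<^bsub>E\<^esub> (lam (f a) (del ?p) \<oplus>\<^bsub>E\<^esub> lam (f a) ?h)"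
    using a assms c by (simp add: kmap_Cons_as lam_simps) (subst IH, simp add: lam_simps)
  also have "lam (f a) ?G = lam (g a) ?G \<oplus>\<^bsub>E\<^esub> lam (d a) ?G"
    using a c by (simp add: f_eq lam_add)
  also have "lam (d a) ?G = lam (d a) ?F \<ominus>\<^bsub>E\<^esub> sig (d a) ?p"
    using a assms c lam_kmap_diff[of a xs as y] by (simp add: group_simps P.P.cancel_simps P.P.r_neg)
  finally have "kmap f xs (a # as) y = lam (g a) ?G \<oplus>\<^bsub>E\<^esub> (lam (d a) ?F \<ominus>\<^bsub>E\<^esub> sig (d a) ?p) \<oplus>\<^bsub>E\<^esub>
      (lam (f a) (del ?p) \<oplus>\<^bsub>E\<^esub> lam (f a) ?h)" .
  also have "\<dots> = lam (g a) ?G \<oplus>\<^bsub>E\<^esub> (lam (f a) (del ?p) \<ominus>\<^bsub>E\<^esub> sig (f a) ?p \<oplus>\<^bsub>E\<^esub>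
      (lam (d a) ?F \<oplus>\<^bsub>E\<^esub> sig (g a) ?p \<oplus>\<^bsub>E\<^esub> lam (f a) ?h))"
    using a c by (simp add: f_eq[of a] sig_add group_simps P.P.cancel_simps) (simp add: P.P.cancel_far)
  finally show ?case
    unfolding hd dp using a assms c by (simp add: kmap_Cons_as)
qed

lemma step_homotopy:
  assumes "Z \<in> carrier FT"
  shows "flft E (kmap f) Z = flft E (kmap g) Z \<oplus>\<^bsub>E\<^esub> (del (hp Z) \<oplus>\<^bsub>E\<^esub> hp (delF Z))"
  by (rule FT_eqI[OF P.module_pres_module flft_kmap_linear[OF f_fun]
          linear_maps_add[OF P.module_pres_module flft_kmap_linear[OF g_fun]
            linear_maps_add[OF P.module_pres_module linear_maps_comp[OF hp_linear del_linear]
              linear_maps_comp[OF delF_linear hp_linear]]] _ assms])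
      (simp add: flft_kmap_gen hp_gen delF_gen step_homotopy_gen)

end

context two_modules
begin

lemma locally_split_exact:
  assumes "locally_split R M" "Z \<in> carrier FT" "del (proj Z) = \<zero>\<^bsub>E\<^esub>"
    and "flft E (kmap (\<lambda>_. \<zero>\<^bsub>M\<^esub>)) Z = \<zero>\<^bsub>E\<^esub>"
  shows "\<exists>w \<in> carrier E. proj Z = del w"
proof -
  have dZ: "delF Z \<in> carrier FT"
    using assms(2) by (rule lin_closed[OF delF_linear])
  have "delF Z \<in> submodule_generated R FT (kos_rels R M N AM BM)"
    using P.pres_proj_eq_zero_iff[OF dZ] proj_delF[OF assms(2)] assms(3) by simp
  from kernel_finite_support[OF this] obtain A B where AB: "finite A" "finite B" "A \<subseteq> AM" "B \<subseteq> BM"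
    and kill: "\<And>D. kml R M N A B E D \<Longrightarrow> flft E D (delF Z) = \<zero>\<^bsub>E\<^esub>"
    by (elim exE conjE) (rule that, auto)
  from kmap_finite_support[OF assms(2)] obtain T where T: "finite T" "T \<subseteq> carrier M"
    and id: "\<And>f. f \<in> carrier M \<rightarrow> carrier M \<Longrightarrow> (\<forall>x \<in> T. f x = x) \<Longrightarrow> flft E (kmap f) Z = proj Z"
    by (elim exE conjE) (rule that, auto)
  obtain f where f: "reachable R M A B f" "\<forall>x \<in> T. f x = x"
    using assms(1)[unfolded locally_split_def, rule_format, OF T(1) AB(1,2) T(2) AB(3,4)] by auto
  from f(1) have "\<exists>w \<in> carrier E. flft E (kmap f) Z = del w"
  proof (induction rule: reachable.induct)
    case zero
    then show ?case
      using assms(4) by (intro bexI[of _ "\<zero>\<^bsub>E\<^esub>"]) (simp_all add: del_simps)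
  next
    case (step g f e)
    interpret rank_one_step R M N A B f g e
      using step(2-4) reachable_partially_linear[OF M.module_axioms step(1)] by unfold_locales
    obtain w where w: "w \<in> carrier E" "flft E (kmap g) Z = del w"
      using step.IH by auto
    have hz: "hp Z \<in> carrier E"
      by (rule lin_closed[OF hp_linear assms(2)])
    have "hp (delF Z) = \<zero>\<^bsub>E\<^esub>"
      unfolding hp_def by (rule kill[OF kml_pterm])
    then have "flft E (kmap f) Z = del (w \<oplus>\<^bsub>E\<^esub> hp Z)"
      using step_homotopy[OF assms(2)] w hz by (simp add: del_simps)
    then show ?case
      using P.P.a_closed[OF w(1) hz] by (rule bexI)
  qed
  moreover have "flft E (kmap f) Z = proj Z"
    using partially_linearD(1)[OF reachable_partially_linear[OF M.module_axioms f(1)]] f(2)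
    by (intro id) auto
  ultimately show ?thesis by simp
qed

end

section \<open>The components of the Koszul complex\<close>

definition kgen where
  "kgen R M p q xs as =
     pure_tensor R (sym_power R M p) (ext_power R M q) (sym_product R M xs) (wedge R M as)"

lemma module_kos: "module R M \<Longrightarrow> module R (tensor_module R (sym_power R M p) (ext_power R M q))"
  by (intro module_tensor_module module_sym_power module_ext_power)

lemma kgen_closed:
  "module R M \<Longrightarrow> xs \<in> tuples M p \<Longrightarrow> as \<in> tuples M q \<Longrightarrow>
     kgen R M p q xs as \<in> carrier (tensor_module R (sym_power R M p) (ext_power R M q))"
  unfolding kgen_def
  by (intro pure_tensor_closed module_sym_power module_ext_power sym_product_closed wedge_closed)

lemma kos_eqI:
  assumes M: "module R M" and W: "module R W"
    and f: "f \<in> linear_maps R (tensor_module R (sym_power R M p) (ext_power R M q)) W"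
    and g: "g \<in> linear_maps R (tensor_module R (sym_power R M p) (ext_power R M q)) W"
    and eq: "\<And>xs as. xs \<in> tuples M p \<Longrightarrow> as \<in> tuples M q \<Longrightarrow> f (kgen R M p q xs as) = g (kgen R M p q xs as)"
    and z: "z \<in> carrier (tensor_module R (sym_power R M p) (ext_power R M q))"
  shows "f z = g z"
proof -
  note S = module_sym_power[OF M, of p] and L = module_ext_power[OF M, of q]
  note r = linear_maps_comp[OF pure_tensor_linear_right[OF S L]]
  note l = linear_maps_comp[OF pure_tensor_linear_left[OF S L]]
  have 1: "f (pure_tensor R (sym_power R M p) (ext_power R M q) (sym_product R M xs) \<omega>) =
      g (pure_tensor R (sym_power R M p) (ext_power R M q) (sym_product R M xs) \<omega>)"
    if xs: "xs \<in> tuples M p" and \<omega>: "\<omega> \<in> carrier (ext_power R M q)" for xs \<omega>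
  proof -
    note sp = sym_product_closed[OF M xs]
    show ?thesis
      by (rule ext_linear_eqI[OF M W r[OF sp f] r[OF sp g] _ \<omega>])
        (use eq xs in \<open>simp add: kgen_def\<close>)
  qed
  show ?thesis
  proof (rule tensor_linear_eqI[OF S L W f g _ z])
    fix \<alpha> \<omega> assume \<alpha>: "\<alpha> \<in> carrier (sym_power R M p)" and \<omega>: "\<omega> \<in> carrier (ext_power R M q)"
    show "f (pure_tensor R (sym_power R M p) (ext_power R M q) \<alpha> \<omega>) =
        g (pure_tensor R (sym_power R M p) (ext_power R M q) \<alpha> \<omega>)"
      by (rule sym_linear_eqI[OF M W l[OF \<omega> f] l[OF \<omega> g] _ \<alpha>]) (rule 1[OF _ \<omega>])
  qed
qed

lemma kos_lift:
  assumes M: "module R M" and W: "module R W"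
    and sy: "\<And>as. as \<in> tuples M q \<Longrightarrow> symmetric R M p W (\<lambda>xs. D xs as)"
    and al: "\<And>xs. xs \<in> tuples M p \<Longrightarrow> alternating R M q W (D xs)"
  shows "\<exists>g \<in> linear_maps R (tensor_module R (sym_power R M p) (ext_power R M q)) W.
    \<forall>xs \<in> tuples M p. \<forall>as \<in> tuples M q. g (kgen R M p q xs as) = D xs as"
proof -
  interpret M: module R M by fact
  interpret W: module R W by fact
  note S = module_sym_power[OF M, of p] and L = module_ext_power[OF M, of q]
  interpret L: module R "ext_power R M q" by (rule L)
  have "\<forall>xs \<in> tuples M p. \<exists>A \<in> linear_maps R (ext_power R M q) W. \<forall>as \<in> tuples M q. A (wedge R M as) = D xs as"
    using ext_lift[OF M W al] by metis
  then obtain A where A: "\<And>xs. xs \<in> tuples M p \<Longrightarrow> A xs \<in> linear_maps R (ext_power R M q) W"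
    and Aw: "\<And>xs as. xs \<in> tuples M p \<Longrightarrow> as \<in> tuples M q \<Longrightarrow> A xs (wedge R M as) = D xs as"
    by metis
  have ml: "multilinear R M p W (\<lambda>xs. D xs as)"
    and sm: "\<And>xs ys. xs \<in> tuples M p \<Longrightarrow> ys \<in> tuples M p \<Longrightarrow> mset xs = mset ys \<Longrightarrow> D xs as = D ys as"
    if "as \<in> tuples M q" for as
    using sy[OF that] unfolding symmetric_def by blast+
  have Asym: "symmetric R M p W (\<lambda>xs. A xs \<omega>)" if \<omega>: "\<omega> \<in> carrier (ext_power R M q)" for \<omega>
    unfolding symmetric_def multilinear_def
  proof (intro conjI allI impI ballI funcsetI)
    fix xs assume xs: "xs \<in> tuples M p"
    show "A xs \<omega> \<in> carrier W" by (rule lin_closed[OF A[OF xs] \<omega>])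
    fix ys assume ys: "ys \<in> tuples M p" and ms: "mset xs = mset ys"
    show "A xs \<omega> = A ys \<omega>"
      by (rule ext_linear_eqI[OF M W A[OF xs] A[OF ys] _ \<omega>]) (simp add: Aw xs ys sm[OF _ xs ys ms])
  next
    fix xs a b ys assume *: "xs @ a # ys \<in> tuples M p" "b \<in> carrier M"
    note t = tuples_replace[OF *(1) M.a_closed[OF tuples_entry[OF *(1)] *(2)]] tuples_replace[OF *(1,2)]
    show "A (xs @ (a \<oplus>\<^bsub>M\<^esub> b) # ys) \<omega> = A (xs @ a # ys) \<omega> \<oplus>\<^bsub>W\<^esub> A (xs @ b # ys) \<omega>"
      by (rule ext_linear_eqI[OF M W A[OF t(1)] linear_maps_add[OF W A[OF *(1)] A[OF t(2)]] _ \<omega>])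
        (simp add: Aw t * multilinearD(2)[OF ml])
  next
    fix xs r a ys assume *: "xs @ a # ys \<in> tuples M p" "r \<in> carrier R"
    note t = tuples_replace[OF *(1) M.smult_closed[OF *(2) tuples_entry[OF *(1)]]]
    show "A (xs @ (r \<odot>\<^bsub>M\<^esub> a) # ys) \<omega> = r \<odot>\<^bsub>W\<^esub> A (xs @ a # ys) \<omega>"
      by (rule ext_linear_eqI[OF M W A[OF t] linear_maps_smult[OF W A[OF *(1)] *(2)] _ \<omega>])
        (simp add: Aw t * multilinearD(3)[OF ml])
  qed
  have "\<forall>\<omega> \<in> carrier (ext_power R M q). \<exists>B \<in> linear_maps R (sym_power R M p) W.
      \<forall>xs \<in> tuples M p. B (sym_product R M xs) = A xs \<omega>"
    using sym_lift[OF M W Asym] by metis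
  then obtain B where B: "\<And>\<omega>. \<omega> \<in> carrier (ext_power R M q) \<Longrightarrow> B \<omega> \<in> linear_maps R (sym_power R M p) W"
    and Bs: "\<And>\<omega> xs. \<omega> \<in> carrier (ext_power R M q) \<Longrightarrow> xs \<in> tuples M p \<Longrightarrow> B \<omega> (sym_product R M xs) = A xs \<omega>"
    by metis
  have "bilinear R (sym_power R M p) (ext_power R M q) W (\<lambda>\<alpha> \<omega>. B \<omega> \<alpha>)"
    unfolding bilinear_def
  proof (intro conjI ballI linear_mapsI)
    fix \<omega> assume \<omega>: "\<omega> \<in> carrier (ext_power R M q)"
    note lB = linear_mapsD[OF B[OF \<omega>]]
    show "B \<omega> \<alpha> \<in> carrier W" if "\<alpha> \<in> carrier (sym_power R M p)" for \<alpha>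
      using that by (rule lB)
    then show "B \<omega> \<alpha> \<in> carrier W" if "\<alpha> \<in> carrier (sym_power R M p)" for \<alpha>
      using that by simp
    show "B \<omega> (\<alpha> \<oplus>\<^bsub>sym_power R M p\<^esub> \<beta>) = B \<omega> \<alpha> \<oplus>\<^bsub>W\<^esub> B \<omega> \<beta>"
      if "\<alpha> \<in> carrier (sym_power R M p)" "\<beta> \<in> carrier (sym_power R M p)" for \<alpha> \<beta>
      using that by (rule lB)
    show "B \<omega> (r \<odot>\<^bsub>sym_power R M p\<^esub> \<alpha>) = r \<odot>\<^bsub>W\<^esub> B \<omega> \<alpha>"
      if "r \<in> carrier R" "\<alpha> \<in> carrier (sym_power R M p)" for r \<alpha>
      using that by (rule lB)
    fix \<alpha> assume \<alpha>: "\<alpha> \<in> carrier (sym_power R M p)"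
    show "B (\<omega> \<oplus>\<^bsub>ext_power R M q\<^esub> \<eta>) \<alpha> = B \<omega> \<alpha> \<oplus>\<^bsub>W\<^esub> B \<eta> \<alpha>" if \<eta>: "\<eta> \<in> carrier (ext_power R M q)" for \<eta>
      by (rule sym_linear_eqI[OF M W B[OF L.a_closed[OF \<omega> \<eta>]] linear_maps_add[OF W B[OF \<omega>] B[OF \<eta>]] _ \<alpha>])
        (simp add: Bs \<omega> \<eta> lin_add[OF A])
    show "B (r \<odot>\<^bsub>ext_power R M q\<^esub> \<omega>) \<alpha> = r \<odot>\<^bsub>W\<^esub> B \<omega> \<alpha>" if r: "r \<in> carrier R" for r
      by (rule sym_linear_eqI[OF M W B[OF L.smult_closed[OF r \<omega>]] linear_maps_smult[OF W B[OF \<omega>] r] _ \<alpha>])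
        (simp add: Bs \<omega> r lin_smult[OF A])
  qed
  then obtain g where g: "g \<in> linear_maps R (tensor_module R (sym_power R M p) (ext_power R M q)) W"
    and gb: "\<And>\<alpha> \<omega>. \<alpha> \<in> carrier (sym_power R M p) \<Longrightarrow> \<omega> \<in> carrier (ext_power R M q) \<Longrightarrow>
      g (pure_tensor R (sym_power R M p) (ext_power R M q) \<alpha> \<omega>) = B \<omega> \<alpha>"
    using tensor_lift[OF S L W] by metis
  show ?thesis
    by (rule bexI[OF _ g])
      (simp add: kgen_def gb Bs Aw sym_product_closed[OF M] wedge_closed[OF M])
qed

lemma sym_mult_linear:
  assumes M: "module R M" and a: "a \<in> carrier M"
  shows "(\<lambda>\<alpha>. sym_mult R M j \<alpha> a) \<in> linear_maps R (sym_power R M j) (sym_power R M (j + 1))"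
    and "xs \<in> tuples M j \<Longrightarrow> sym_mult R M j (sym_product R M xs) a = sym_product R M (a # xs)"
proof -
  interpret M: module R M by fact
  interpret P: presentation R "tuples M j" "sym_rels R M j" by (rule presentation_sym[OF M])
  note S = module_sym_power[OF M, of "j + 1"]
  have t: "xs @ [a] \<in> tuples M (j + 1)" "a # xs \<in> tuples M (j + 1)" if "xs \<in> tuples M j" for xs
    using that a by (auto simp: tuples_def)
  have ml: "multilinear R M (j + 1) (sym_power R M (j + 1)) (sym_product R M)"
    and sm: "\<And>xs ys. xs \<in> tuples M (j + 1) \<Longrightarrow> ys \<in> tuples M (j + 1) \<Longrightarrow> mset xs = mset ys \<Longrightarrow>
      sym_product R M xs = sym_product R M ys"
    using sym_product_symmetric[OF M, of "j + 1"] unfolding symmetric_def by blast+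
  have "symmetric R M j (sym_power R M (j + 1)) (\<lambda>xs. sym_product R M (xs @ [a]))"
    unfolding symmetric_def multilinear_def
  proof (intro conjI allI impI ballI funcsetI)
    fix xs assume "xs \<in> tuples M j"
    then show "sym_product R M (xs @ [a]) \<in> carrier (sym_power R M (j + 1))"
      by (intro sym_product_closed[OF M] t)
  next
    fix xs b c ys assume *: "xs @ b # ys \<in> tuples M j" "c \<in> carrier M"
    show "sym_product R M ((xs @ (b \<oplus>\<^bsub>M\<^esub> c) # ys) @ [a]) =
        sym_product R M ((xs @ b # ys) @ [a]) \<oplus>\<^bsub>sym_power R M (j + 1)\<^esub> sym_product R M ((xs @ c # ys) @ [a])"
      using multilinearD(2)[OF ml, of xs b "ys @ [a]" c] t(1)[OF *(1)] * by simp
  next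
    fix xs r b ys assume *: "xs @ b # ys \<in> tuples M j" "r \<in> carrier R"
    show "sym_product R M ((xs @ (r \<odot>\<^bsub>M\<^esub> b) # ys) @ [a]) =
        r \<odot>\<^bsub>sym_power R M (j + 1)\<^esub> sym_product R M ((xs @ b # ys) @ [a])"
      using multilinearD(3)[OF ml, of xs b "ys @ [a]" r] t(1)[OF *(1)] * by simp
  next
    fix xs ys assume "xs \<in> tuples M j" "ys \<in> tuples M j" "mset xs = mset ys"
    then show "sym_product R M (xs @ [a]) = sym_product R M (ys @ [a])"
      by (intro sm t) auto
  qed
  then obtain g where g: "g \<in> linear_maps R (sym_power R M j) (sym_power R M (j + 1))"
    and gs: "\<And>xs. xs \<in> tuples M j \<Longrightarrow> g (sym_product R M xs) = sym_product R M (xs @ [a])"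
    using sym_lift[OF M S] by metis
  have pc: "pres_class R (tuples M j) (sym_rels R M j) xs = sym_product R M xs" if "xs \<in> tuples M j" for xs
    using that by (auto simp: sym_product_def tuples_def)
  have eq: "sym_mult R M j \<alpha> a = g \<alpha>" if "\<alpha> \<in> carrier (sym_power R M j)" for \<alpha>
    unfolding sym_mult_def
    by (rule P.pres_lift_eq[OF S]) (use g gs that pc in \<open>simp_all add: sym_power_def\<close>)
  show "(\<lambda>\<alpha>. sym_mult R M j \<alpha> a) \<in> linear_maps R (sym_power R M j) (sym_power R M (j + 1))"
    by (rule linear_maps_cong[OF g module_sym_power[OF M] eq])
  assume xs: "xs \<in> tuples M j"
  have "sym_product R M (xs @ [a]) = sym_product R M (a # xs)"
    by (intro sm t xs) simp
  then show "sym_mult R M j (sym_product R M xs) a = sym_product R M (a # xs)"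
    using eq gs xs sym_product_closed[OF M] by simp
qed

context two_modules
begin

lemma kml_symmetric:
  assumes "kml R M N AM BM W D" "ok as" "y \<in> carrier N"
  shows "symmetric R M j W (\<lambda>xs. D xs as y)"
proof -
  interpret D: kml R M N AM BM W D by fact
  show ?thesis
    unfolding symmetric_def multilinear_def
  proof (intro conjI allI impI ballI funcsetI)
    fix xs assume xs: "xs \<in> tuples M j"
    then show "D xs as y \<in> carrier W"
      using lin_closed[OF D.lin] assms by (auto simp: tuples_def)
    fix ys assume "mset xs = mset ys"
    then show "D xs as y = D ys as y"
      using xs assms by (intro D.sym) (auto simp: tuples_def)
  next
    fix xs a b ys assume *: "xs @ a # ys \<in> tuples M j" "b \<in> carrier M"
    have mv: "D (xs @ c # ys) as y = D (c # xs @ ys) as y" if "c \<in> carrier M" for c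
      using that * assms by (intro D.sym) (auto simp: tuples_def)
    show "D (xs @ (a \<oplus>\<^bsub>M\<^esub> b) # ys) as y = D (xs @ a # ys) as y \<oplus>\<^bsub>W\<^esub> D (xs @ b # ys) as y"
      using * assms by (simp add: mv tuples_def D.add_x)
  next
    fix xs r a ys assume *: "xs @ a # ys \<in> tuples M j" "r \<in> carrier R"
    have mv: "D (xs @ c # ys) as y = D (c # xs @ ys) as y" if "c \<in> carrier M" for c
      using that * assms by (intro D.sym) (auto simp: tuples_def)
    show "D (xs @ (r \<odot>\<^bsub>M\<^esub> a) # ys) as y = r \<odot>\<^bsub>W\<^esub> D (xs @ a # ys) as y"
      using * assms by (simp add: mv tuples_def D.smult_x)
  qed
qed

lemma kml_alternating:
  assumes "kml R M N AM BM W D" "ok xs" "y \<in> carrier N"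
  shows "alternating R M j W (\<lambda>as. D xs as y)"
proof -
  interpret D: kml R M N AM BM W D by fact
  show ?thesis
    unfolding alternating_def multilinear_def
    using assms(2,3) lin_closed[OF D.lin] by (auto simp: tuples_def D.add_as D.smult_as D.alt)
qed

definition emb where
  "emb p q y = (SOME g. g \<in> linear_maps R (tensor_module R (sym_power R M p) (ext_power R M q)) E \<and>
     (\<forall>xs \<in> tuples M p. \<forall>as \<in> tuples M q. g (kgen R M p q xs as) = cl xs as y))"

lemma
  assumes "y \<in> carrier N"
  shows emb_linear: "emb p q y \<in> linear_maps R (tensor_module R (sym_power R M p) (ext_power R M q)) E"
    and emb_kgen: "xs \<in> tuples M p \<Longrightarrow> as \<in> tuples M q \<Longrightarrow> emb p q y (kgen R M p q xs as) = cl xs as y"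
proof -
  have "\<exists>g \<in> linear_maps R (tensor_module R (sym_power R M p) (ext_power R M q)) E.
    \<forall>xs \<in> tuples M p. \<forall>as \<in> tuples M q. g (kgen R M p q xs as) = cl xs as y"
    by (rule kos_lift[OF M.module_axioms P.module_pres_module kml_symmetric[OF kml_cl _ assms]
          kml_alternating[OF kml_cl _ assms]]) (auto simp: tuples_def)
  then have "emb p q y \<in> linear_maps R (tensor_module R (sym_power R M p) (ext_power R M q)) E \<and>
     (\<forall>xs \<in> tuples M p. \<forall>as \<in> tuples M q. emb p q y (kgen R M p q xs as) = cl xs as y)"
    unfolding emb_def Bex_def by (rule someI_ex)
  then show "emb p q y \<in> linear_maps R (tensor_module R (sym_power R M p) (ext_power R M q)) E"
    "xs \<in> tuples M p \<Longrightarrow> as \<in> tuples M q \<Longrightarrow> emb p q y (kgen R M p q xs as) = cl xs as y"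
    by auto
qed

lemma emb_linear_right:
  assumes z: "z \<in> carrier (tensor_module R (sym_power R M p) (ext_power R M q))"
  shows "(\<lambda>y. emb p q y z) \<in> linear_maps R N E"
proof (rule linear_mapsI)
  fix y assume y: "y \<in> carrier N"
  show "emb p q y z \<in> carrier E"
    by (rule lin_closed[OF emb_linear[OF y] z])
  show "emb p q (y \<oplus>\<^bsub>N\<^esub> y') z = emb p q y z \<oplus>\<^bsub>E\<^esub> emb p q y' z" if y': "y' \<in> carrier N" for y'
    by (rule kos_eqI[OF M.module_axioms P.module_pres_module emb_linear
          linear_maps_add[OF P.module_pres_module emb_linear emb_linear] _ z])
      (use y y' in \<open>auto simp: emb_kgen lin_add[OF K.lin] tuples_def\<close>)
  show "emb p q (r \<odot>\<^bsub>N\<^esub> y) z = r \<odot>\<^bsub>E\<^esub> emb p q y z" if r: "r \<in> carrier R" for r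
    by (rule kos_eqI[OF M.module_axioms P.module_pres_module emb_linear
          linear_maps_smult[OF P.module_pres_module emb_linear] _ z])
      (use y r in \<open>auto simp: emb_kgen lin_smult[OF K.lin] tuples_def\<close>)
qed

text \<open>The part of degree \<open>(p, q)\<close> of the total module; a left inverse of \<open>emb p q\<close>.\<close>

definition retr where
  "retr p q W b = lft W (\<lambda>xs as y. if xs \<in> tuples M p \<and> as \<in> tuples M q then b (kgen R M p q xs as) y else \<zero>\<^bsub>W\<^esub>)"

lemma
  assumes W: "module R W"
    and b: "bilinear R (tensor_module R (sym_power R M p) (ext_power R M q)) N W b"
  shows retr_linear: "retr p q W b \<in> linear_maps R E W"
    and retr_cl: "ok xs \<Longrightarrow> ok as \<Longrightarrow> y \<in> carrier N \<Longrightarrow> retr p q W b (cl xs as y) =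
      (if xs \<in> tuples M p \<and> as \<in> tuples M q then b (kgen R M p q xs as) y else \<zero>\<^bsub>W\<^esub>)"
proof -
  interpret W: module R W by fact
  let ?K = "tensor_module R (sym_power R M p) (ext_power R M q)"
  note S = module_sym_power[OF M.module_axioms, of p] and L = module_ext_power[OF M.module_axioms, of q]
  have bl: "(\<lambda>z. b z y) \<in> linear_maps R ?K W" if "y \<in> carrier N" for y
    using b that unfolding bilinear_def by auto
  have br: "b z \<in> linear_maps R N W" if "z \<in> carrier ?K" for z
    using b that unfolding bilinear_def by auto
  note kc = kgen_closed[OF M.module_axioms, of _ p _ q]
  have mt: "ok xs \<Longrightarrow> ok xs' \<Longrightarrow> length xs = length xs' \<Longrightarrow> xs \<in> tuples M j \<longleftrightarrow> xs' \<in> tuples M j" for xs xs' j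
    by (auto simp: tuples_def)
  note sl = linear_maps_comp[OF pure_tensor_linear_left[OF S L] bl]
  note lr = linear_maps_comp[OF pure_tensor_linear_right[OF S L] bl]
  note spc = sym_product_closed[OF M.module_axioms] and wc = wedge_closed[OF M.module_axioms]
  have sml: "multilinear R M p (sym_power R M p) (sym_product R M)"
    and ssm: "\<And>xs ys. xs \<in> tuples M p \<Longrightarrow> ys \<in> tuples M p \<Longrightarrow> mset xs = mset ys \<Longrightarrow>
      sym_product R M xs = sym_product R M ys"
    using sym_product_symmetric[OF M.module_axioms, of p] unfolding symmetric_def by blast+
  have wml: "multilinear R M q (ext_power R M q) (wedge R M)"
    and walt: "\<And>as. as \<in> tuples M q \<Longrightarrow> \<not> distinct as \<Longrightarrow> wedge R M as = \<zero>\<^bsub>ext_power R M q\<^esub>"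
    using wedge_alternating[OF M.module_axioms, of q] unfolding alternating_def by blast+
  have k: "kml R M N AM BM W (\<lambda>xs as y. if xs \<in> tuples M p \<and> as \<in> tuples M q then b (kgen R M p q xs as) y else \<zero>\<^bsub>W\<^esub>)"
  proof (unfold_locales, goal_cases)
    case (1 xs as)
    show ?case
    proof (cases "xs \<in> tuples M p \<and> as \<in> tuples M q")
      case True
      then show ?thesis by (simp add: br kc)
    next
      case False
      show ?thesis unfolding if_not_P[OF False] by (rule linear_maps_zero[OF W])
    qed
  next
    case (2 a c xs as y)
    then have t: "(a \<oplus>\<^bsub>M\<^esub> c) # xs \<in> tuples M p \<longleftrightarrow> a # xs \<in> tuples M p" "c # xs \<in> tuples M p \<longleftrightarrow> a # xs \<in> tuples M p"
      by (auto simp: tuples_def)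
    show ?case
      using 2 multilinearD(2)[OF sml, of "[]" a xs c] lin_add[OF sl[OF wc]] spc t
      by (simp add: t kgen_def)
  next
    case (3 r a xs as y)
    then have t: "(r \<odot>\<^bsub>M\<^esub> a) # xs \<in> tuples M p \<longleftrightarrow> a # xs \<in> tuples M p"
      by (auto simp: tuples_def)
    show ?case
      using 3 multilinearD(3)[OF sml, of "[]" a xs r] lin_smult[OF sl[OF wc]] spc t
      by (simp add: t kgen_def)
  next
    case (4 xs xs' as y)
    then have "xs' \<in> tuples M p \<longleftrightarrow> xs \<in> tuples M p"
      by (intro mt) (metis set_mset_mset, assumption, metis size_mset)
    then show ?case
      using ssm[of xs xs'] 4(1) by (simp add: kgen_def)
  next
    case (5 a c xs ps qs y)
    then have t: "ps @ (a \<oplus>\<^bsub>M\<^esub> c) # qs \<in> tuples M q \<longleftrightarrow> ps @ a # qs \<in> tuples M q"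
        "ps @ c # qs \<in> tuples M q \<longleftrightarrow> ps @ a # qs \<in> tuples M q"
      by (auto simp: tuples_def)
    show ?case
      using 5 multilinearD(2)[OF wml, of ps a qs c] lin_add[OF lr[OF spc]] wc t
      by (simp add: t kgen_def)
  next
    case (6 r a xs ps qs y)
    then have t: "ps @ (r \<odot>\<^bsub>M\<^esub> a) # qs \<in> tuples M q \<longleftrightarrow> ps @ a # qs \<in> tuples M q"
      by (auto simp: tuples_def)
    show ?case
      using 6 multilinearD(3)[OF wml, of ps a qs r] lin_smult[OF lr[OF spc]] wc t
      by (simp add: t kgen_def)
  next
    case (7 as xs y)
    then show ?case
      using walt[of as] lin_zero[OF L W lr[OF spc]] by (simp add: kgen_def)
  qed
  show "retr p q W b \<in> linear_maps R E W"
    unfolding retr_def by (rule lft_linear[OF W k])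
  show "ok xs \<Longrightarrow> ok as \<Longrightarrow> y \<in> carrier N \<Longrightarrow> retr p q W b (cl xs as y) =
      (if xs \<in> tuples M p \<and> as \<in> tuples M q then b (kgen R M p q xs as) y else \<zero>\<^bsub>W\<^esub>)"
    unfolding retr_def by (rule lft_cl[OF W k])
qed

lemma retr_emb:
  assumes W: "module R W"
    and b: "bilinear R (tensor_module R (sym_power R M p) (ext_power R M q)) N W b"
    and y: "y \<in> carrier N" and z: "z \<in> carrier (tensor_module R (sym_power R M p) (ext_power R M q))"
  shows "retr p q W b (emb p q y z) = b z y"
proof -
  have bl: "(\<lambda>z. b z y) \<in> linear_maps R (tensor_module R (sym_power R M p) (ext_power R M q)) W"
    using b y unfolding bilinear_def by auto
  show ?thesis
    by (rule kos_eqI[OF M.module_axioms W linear_maps_comp[OF emb_linear[OF y] retr_linear[OF W b]] bl _ z])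
      (use y retr_cl[OF W b] in \<open>auto simp: emb_kgen tuples_def\<close>)
qed

lemma ok_omit: "ok as \<Longrightarrow> ok (take i as @ drop (Suc i) as)"
  by (auto dest: in_set_takeD in_set_dropD)

lemma dterm_finsum:
  "ok xs \<Longrightarrow> ok as \<Longrightarrow> y \<in> carrier N \<Longrightarrow> dterm xs as y =
     (\<Oplus>\<^bsub>E\<^esub>i\<in>{..<length as}. ((\<ominus> \<one>) [^] i) \<odot>\<^bsub>E\<^esub> cl (as ! i # xs) (take i as @ drop (Suc i) as) y)"
proof (induction as)
  case (Cons a as)
  define f where "f = (\<lambda>as i. ((\<ominus> \<one>) [^] i) \<odot>\<^bsub>E\<^esub> cl (as ! i # xs) (take i as @ drop (Suc i) as) y)"
  have fc: "f bs i \<in> carrier E" if "ok bs" "i < length bs" for bs i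
    using that Cons.prems ok_omit[OF that(1), of i] nth_mem[OF that(2)] unfolding f_def
    by (intro P.P.smult_closed cl_closed) (auto simp: subset_iff)
  have neg: "\<ominus>\<^bsub>E\<^esub> lam a (f as i) = f (a # as) (Suc i)" if "i < length as" for i
  proof -
    let ?c = "cl (as ! i # xs) (take i as @ drop (Suc i) as) y"
    have 1: "as ! i \<in> carrier M" "ok (take i as @ drop (Suc i) as)" "a \<in> carrier M"
      using that Cons.prems ok_omit[of as i] nth_mem[OF that] by (auto simp: subset_iff)
    then have c: "?c \<in> carrier E" "lam a ?c \<in> carrier E" using Cons.prems by auto
    have l: "lam a ?c = cl (as ! i # xs) (a # take i as @ drop (Suc i) as) y"
      using 1 Cons.prems by (subst lam_cl) auto
    have "\<ominus>\<^bsub>E\<^esub> lam a (f as i) = (\<ominus> \<one> \<otimes> (\<ominus> \<one>) [^] i) \<odot>\<^bsub>E\<^esub> lam a ?c"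
      using c 1 unfolding f_def by (simp add: lam_simps P.P.uminus_eq_smult P.P.smult_assoc1)
    also have "\<dots> = f (a # as) (Suc i)"
      unfolding l f_def by (simp add: M.R.m_comm)
    finally show ?thesis .
  qed
  have d: "dterm xs as y = (\<Oplus>\<^bsub>E\<^esub>i\<in>{..<length as}. f as i)"
    using Cons unfolding f_def by simp
  have a: "a \<in> carrier M" "ok as" using Cons.prems by auto
  have "\<ominus>\<^bsub>E\<^esub> lam a (dterm xs as y) = (\<Oplus>\<^bsub>E\<^esub>i\<in>{..<length as}. \<ominus>\<^bsub>E\<^esub> lam a (f as i))"
    unfolding d
    by (rule lin_finsum[OF P.module_pres_module P.module_pres_module
          linear_maps_neg[OF P.module_pres_module lam_linear[OF a(1)]]]) (use fc a in auto)
  also have "\<dots> = (\<Oplus>\<^bsub>E\<^esub>i\<in>{..<length as}. f (a # as) (Suc i))"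
    by (rule P.P.finsum_cong') (use fc[OF Cons.prems(2)] neg in auto)
  finally have e: "\<ominus>\<^bsub>E\<^esub> lam a (dterm xs as y) = (\<Oplus>\<^bsub>E\<^esub>i\<in>{..<length as}. f (a # as) (Suc i))" .
  have f0: "f (a # as) 0 = cl (a # xs) as y"
    using Cons.prems unfolding f_def by simp
  have "(\<Oplus>\<^bsub>E\<^esub>i\<in>{..<Suc (length as)}. f (a # as) i) = f (a # as) 0 \<oplus>\<^bsub>E\<^esub> (\<Oplus>\<^bsub>E\<^esub>i\<in>{..<length as}. f (a # as) (Suc i))"
    by (rule finsum_lessThan_Suc2[OF P.P.abelian_group_axioms]) (use fc[OF Cons.prems(2)] in simp)
  then show ?case
    unfolding dterm.simps P.P.minus_eq e f0 by (simp add: f_def)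
qed simp

end

section \<open>The Koszul complex as a retract of the total Koszul module\<close>

lemma koszul_term_linear:
  assumes M: "module R M" and as: "as \<in> tuples M n"
  shows "(\<lambda>\<alpha>. koszul_term R M k n \<alpha> as) \<in>
    linear_maps R (sym_power R M (int k - n)) (koszul_component R M k (n - 1))"
proof -
  interpret M: module R M by fact
  have deg: "int k - (n - 1) = int k - n + 1" by simp
  note S = module_sym_power[OF M, of "int k - n + 1"] and L = module_ext_power[OF M, of "n - 1"]
  note K = module_tensor_module[OF S L]
  show ?thesis
    unfolding koszul_term_def koszul_component_def deg
  proof (rule linear_maps_finsum[OF module_sym_power[OF M] K])
    fix i assume i: "i \<in> {..<length as}"
    then have ai: "as ! i \<in> carrier M"
      using as nth_mem[of i as] by (auto simp: tuples_def)
    have "take i as @ drop (Suc i) as \<in> tuples M (n - 1)"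
      using as i by (auto simp: tuples_def dest: in_set_takeD in_set_dropD)
    then have w: "wedge R M (take i as @ drop (Suc i) as) \<in> carrier (ext_power R M (n - 1))"
      by (rule wedge_closed[OF M])
    show "(\<lambda>\<alpha>. ((\<ominus>\<^bsub>R\<^esub> \<one>\<^bsub>R\<^esub>) [^]\<^bsub>R\<^esub> i) \<odot>\<^bsub>tensor_module R (sym_power R M (int k - n + 1)) (ext_power R M (n - 1))\<^esub>
        pure_tensor R (sym_power R M (int k - n + 1)) (ext_power R M (n - 1))
          (sym_mult R M (int k - n) \<alpha> (as ! i)) (wedge R M (take i as @ drop (Suc i) as)))
      \<in> linear_maps R (sym_power R M (int k - n))
        (tensor_module R (sym_power R M (int k - n + 1)) (ext_power R M (n - 1)))"
      by (intro linear_maps_smult[OF K] linear_maps_comp[OF sym_mult_linear(1)[OF M ai]]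
          pure_tensor_linear_left[OF S L w] M.R.nat_pow_closed) simp
  qed simp
qed

abbreviation koszul_diff where
  "koszul_diff R M k n \<equiv> differential (koszul_complex R M k) n"

lemma module_koszul_component: "module R M \<Longrightarrow> module R (koszul_component R M k n)"
  unfolding koszul_component_def by (rule module_kos)

lemma scalar_bilinear:
  assumes "module R K"
  shows "bilinear R K (ring_module R) K (\<lambda>z r. r \<odot>\<^bsub>K\<^esub> z)"
proof -
  interpret K: module R K by fact
  show ?thesis
    unfolding bilinear_def
    by (intro conjI ballI linear_mapsI)
      (auto simp: K.smult_r_distr K.smult_l_distr K.smult_assoc1[symmetric] K.R.m_comm)
qed

context two_modules
begin

lemma emb_koszul_term:
  assumes xs: "xs \<in> tuples M (int k - n)" and as: "as \<in> tuples M n" and y: "y \<in> carrier N"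
  shows "emb (int k - (n - 1)) (n - 1) y (koszul_term R M k n (sym_product R M xs) as) = dterm xs as y"
proof -
  have deg: "int k - (n - 1) = int k - n + 1" by simp
  let ?K = "tensor_module R (sym_power R M (int k - n + 1)) (ext_power R M (n - 1))"
  let ?e = "emb (int k - n + 1) (n - 1) y"
  interpret K: module R ?K by (rule module_kos[OF M.module_axioms])
  note el = emb_linear[OF y, of "int k - n + 1" "n - 1"]
  have ok: "ok xs" "ok as"
    using xs as by (auto simp: tuples_def)
  have t: "as ! i \<in> carrier M" "as ! i # xs \<in> tuples M (int k - n + 1)"
    "take i as @ drop (Suc i) as \<in> tuples M (n - 1)" if "i < length as" for i
    using that xs as nth_mem[OF that] by (auto simp: tuples_def dest: in_set_takeD in_set_dropD)
  have kg: "kgen R M (int k - n + 1) (n - 1) (as ! i # xs) (take i as @ drop (Suc i) as) \<in> carrier ?K"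
    if "i < length as" for i
    by (rule kgen_closed[OF M.module_axioms t(2,3)[OF that]])
  have kt: "koszul_term R M k n (sym_product R M xs) as =
      (\<Oplus>\<^bsub>?K\<^esub>i\<in>{..<length as}. ((\<ominus> \<one>) [^] i) \<odot>\<^bsub>?K\<^esub>
        kgen R M (int k - n + 1) (n - 1) (as ! i # xs) (take i as @ drop (Suc i) as))"
    unfolding koszul_term_def koszul_component_def deg
    by (rule K.finsum_cong')
      (use t kg xs in \<open>auto simp: kgen_def sym_mult_linear(2)[OF M.module_axioms]\<close>)
  have "?e (koszul_term R M k n (sym_product R M xs) as) = (\<Oplus>\<^bsub>E\<^esub>i\<in>{..<length as}. ?e (((\<ominus> \<one>) [^] i) \<odot>\<^bsub>?K\<^esub>
        kgen R M (int k - n + 1) (n - 1) (as ! i # xs) (take i as @ drop (Suc i) as)))"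
    unfolding kt by (rule lin_finsum[OF K.module_axioms P.module_pres_module el])
      (intro funcsetI K.smult_closed kg M.R.nat_pow_closed M.R.a_inv_closed M.R.one_closed, simp_all)
  also have "\<dots> = (\<Oplus>\<^bsub>E\<^esub>i\<in>{..<length as}. ((\<ominus> \<one>) [^] i) \<odot>\<^bsub>E\<^esub> cl (as ! i # xs) (take i as @ drop (Suc i) as) y)"
  proof (rule P.P.finsum_cong')
    fix i assume "i \<in> {..<length as}"
    then have i: "i < length as" by simp
    have "(\<ominus> \<one>) [^] i \<in> carrier R" by simp
    from lin_smult[OF el this kg[OF i]]
    show "?e (((\<ominus> \<one>) [^] i) \<odot>\<^bsub>?K\<^esub> kgen R M (int k - n + 1) (n - 1) (as ! i # xs) (take i as @ drop (Suc i) as)) =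
        ((\<ominus> \<one>) [^] i) \<odot>\<^bsub>E\<^esub> cl (as ! i # xs) (take i as @ drop (Suc i) as) y"
      unfolding emb_kgen[OF y t(2,3)[OF i]] .
  next
    have "cl (as ! i # xs) (take i as @ drop (Suc i) as) y \<in> carrier E" if "i < length as" for i
      using t(1)[OF that] ok ok_omit[OF ok(2), of i] y by (intro cl_closed) auto
    then show "(\<lambda>i. ((\<ominus> \<one>) [^] i) \<odot>\<^bsub>E\<^esub> cl (as ! i # xs) (take i as @ drop (Suc i) as) y) \<in> {..<length as} \<rightarrow> carrier E"
      by auto
  qed simp
  also have "\<dots> = dterm xs as y"
    by (rule dterm_finsum[OF ok y, symmetric])
  finally show ?thesis
    unfolding deg .
qed

end

lemma koszul_diff_exists:
  assumes M: "module R M"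
  shows "\<exists>\<delta> \<in> linear_maps R (koszul_component R M k n) (koszul_component R M k (n - 1)).
    \<forall>\<alpha> \<in> carrier (sym_power R M (int k - n)). \<forall>as \<in> tuples M n.
      \<delta> (pure_tensor R (sym_power R M (int k - n)) (ext_power R M n) \<alpha> (wedge R M as)) = koszul_term R M k n \<alpha> as"
proof -
  interpret M: module R M by fact
  interpret T: two_modules R M "ring_module R"
    by (intro two_modules.intro M module_ring_module M.R.cring_axioms)
  note K1 = module_koszul_component[OF M, of k "n - 1", unfolded koszul_component_def]
  interpret K1: module R "tensor_module R (sym_power R M (int k - (n - 1))) (ext_power R M (n - 1))" by (rule K1)
  note S = module_sym_power[OF M, of "int k - n"] and L = module_ext_power[OF M, of n]
  let ?b = "\<lambda>z r. r \<odot>\<^bsub>koszul_component R M k (n - 1)\<^esub> z"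
  define \<rho> where "\<rho> = T.retr (int k - (n - 1)) (n - 1) (koszul_component R M k (n - 1)) ?b"
  have one: "\<one>\<^bsub>R\<^esub> \<in> carrier (ring_module R)" by simp
  define \<delta> where "\<delta> = (\<lambda>z. \<rho> (T.del (T.emb (int k - n) n \<one>\<^bsub>R\<^esub> z)))"
  have \<delta>: "\<delta> \<in> linear_maps R (koszul_component R M k n) (koszul_component R M k (n - 1))"
    unfolding \<delta>_def \<rho>_def koszul_component_def
    by (rule linear_maps_comp[OF linear_maps_comp[OF T.emb_linear[OF one] T.del_linear]
          T.retr_linear[OF K1 scalar_bilinear[OF K1]]])
  have "\<delta> (pure_tensor R (sym_power R M (int k - n)) (ext_power R M n) \<alpha> (wedge R M as)) = koszul_term R M k n \<alpha> as"
    if \<alpha>: "\<alpha> \<in> carrier (sym_power R M (int k - n))" and as: "as \<in> tuples M n" for \<alpha> as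
  proof (rule sym_linear_eqI[OF M module_koszul_component[OF M] _ koszul_term_linear[OF M as] _ \<alpha>])
    show "(\<lambda>\<alpha>. \<delta> (pure_tensor R (sym_power R M (int k - n)) (ext_power R M n) \<alpha> (wedge R M as)))
        \<in> linear_maps R (sym_power R M (int k - n)) (koszul_component R M k (n - 1))"
      by (rule linear_maps_comp[OF pure_tensor_linear_left[OF S L wedge_closed[OF M as]]
            \<delta>[unfolded koszul_component_def[of R M k n]]])
    fix xs assume xs: "xs \<in> tuples M (int k - n)"
    have kt: "koszul_term R M k n (sym_product R M xs) as \<in> carrier (koszul_component R M k (n - 1))"
      by (rule lin_closed[OF koszul_term_linear[OF M as] sym_product_closed[OF M xs]])
    have ok: "set xs \<subseteq> carrier M" "set as \<subseteq> carrier M"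
      using xs as by (auto simp: tuples_def)
    have "\<delta> (kgen R M (int k - n) n xs as) = \<rho> (T.dterm xs as \<one>\<^bsub>R\<^esub>)"
      unfolding \<delta>_def by (simp add: T.emb_kgen[OF one xs as] ok)
    also have "\<dots> = \<rho> (T.emb (int k - (n - 1)) (n - 1) \<one>\<^bsub>R\<^esub> (koszul_term R M k n (sym_product R M xs) as))"
      by (simp only: T.emb_koszul_term[OF xs as one])
    also have "\<dots> = \<one>\<^bsub>R\<^esub> \<odot>\<^bsub>koszul_component R M k (n - 1)\<^esub> koszul_term R M k n (sym_product R M xs) as"
      unfolding \<rho>_def koszul_component_def
      by (rule T.retr_emb[OF K1 scalar_bilinear[OF K1] one kt[unfolded koszul_component_def]])
    also have "\<dots> = koszul_term R M k n (sym_product R M xs) as"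
      using kt unfolding koszul_component_def by (rule K1.smult_one)
    finally show "\<delta> (pure_tensor R (sym_power R M (int k - n)) (ext_power R M n) (sym_product R M xs) (wedge R M as)) =
        koszul_term R M k n (sym_product R M xs) as"
      unfolding kgen_def .
  qed
  then show ?thesis
    by (intro bexI[OF _ \<delta>] ballI)
qed

lemma
  assumes M: "module R M"
  shows koszul_diff_linear:
      "koszul_diff R M k n \<in> linear_maps R (koszul_component R M k n) (koszul_component R M k (n - 1))"
    and koszul_diff_kgen: "xs \<in> tuples M (int k - n) \<Longrightarrow> as \<in> tuples M n \<Longrightarrow>
      koszul_diff R M k n (kgen R M (int k - n) n xs as) = koszul_term R M k n (sym_product R M xs) as"
proof -
  interpret M: module R M by fact
  note S = module_sym_power[OF M, of "int k - n"] and L = module_ext_power[OF M, of n]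
  note K1 = module_koszul_component[OF M, of k "n - 1"]
  obtain \<delta> where \<delta>: "\<delta> \<in> linear_maps R (koszul_component R M k n) (koszul_component R M k (n - 1))"
    and eq: "\<And>\<alpha> as. \<alpha> \<in> carrier (sym_power R M (int k - n)) \<Longrightarrow> as \<in> tuples M n \<Longrightarrow>
      \<delta> (pure_tensor R (sym_power R M (int k - n)) (ext_power R M n) \<alpha> (wedge R M as)) = koszul_term R M k n \<alpha> as"
    using koszul_diff_exists[OF M, of k n] by (elim bexE) (rule that, assumption, simp)
  note \<delta>' = \<delta>[unfolded koszul_component_def[of R M k n]]
  have inner: "pres_lift R (koszul_component R M k (n - 1)) (koszul_term R M k n \<alpha>) \<omega> =
      \<delta> (pure_tensor R (sym_power R M (int k - n)) (ext_power R M n) \<alpha> \<omega>)"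
    if \<alpha>: "\<alpha> \<in> carrier (sym_power R M (int k - n))" and \<omega>: "\<omega> \<in> carrier (ext_power R M n)" for \<alpha> \<omega>
    by (rule ext_pres_lift_eq[OF M K1 linear_maps_comp[OF pure_tensor_linear_right[OF S L \<alpha>] \<delta>'] eq[OF \<alpha>] \<omega>])
  have outer: "koszul_diff R M k n z = \<delta> z" if z: "z \<in> carrier (koszul_component R M k n)" for z
    unfolding koszul_complex_def module_complex.simps
    by (rule tensor_pres_lift_eq[OF S L K1 \<delta>' _ z[unfolded koszul_component_def]]) (simp add: inner)
  show "koszul_diff R M k n \<in> linear_maps R (koszul_component R M k n) (koszul_component R M k (n - 1))"
    by (rule linear_maps_cong[OF \<delta> module_koszul_component[OF M] outer])
  show "koszul_diff R M k n (kgen R M (int k - n) n xs as) = koszul_term R M k n (sym_product R M xs) as"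
    if "xs \<in> tuples M (int k - n)" "as \<in> tuples M n"
    using outer kgen_closed[OF M that] eq[OF sym_product_closed[OF M that(1)] that(2)]
    by (simp add: koszul_component_def kgen_def)
qed

context two_modules
begin

abbreviation "Kc k n \<equiv> tensor_module R (sym_power R M (int k - n)) (ext_power R M n)"

lemmas Kc_module = module_kos[OF M.module_axioms]
lemmas kdiff_linear = koszul_diff_linear[OF M.module_axioms, unfolded koszul_component_def]

lemma emb_diff:
  assumes y: "y \<in> carrier N" and z: "z \<in> carrier (Kc k n)"
  shows "emb (int k - (n - 1)) (n - 1) y (koszul_diff R M k n z) = del (emb (int k - n) n y z)"
  by (rule kos_eqI[OF M.module_axioms P.module_pres_module linear_maps_comp[OF kdiff_linear emb_linear[OF y]]
        linear_maps_comp[OF emb_linear[OF y] del_linear] _ z])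
    (use y in \<open>auto simp: koszul_diff_kgen[OF M.module_axioms] emb_koszul_term emb_kgen tuples_def\<close>)

lemma retr_del:
  assumes W: "module R W" and W': "module R W'"
    and b: "bilinear R (Kc k n) N W b" and b': "bilinear R (Kc k (n - 1)) N W' b'"
    and \<phi>: "\<phi> \<in> linear_maps R W W'"
    and nat: "\<And>z y. z \<in> carrier (Kc k n) \<Longrightarrow> y \<in> carrier N \<Longrightarrow> \<phi> (b z y) = b' (koszul_diff R M k n z) y"
    and w: "w \<in> carrier E"
  shows "retr (int k - (n - 1)) (n - 1) W' b' (del w) = \<phi> (retr (int k - n) n W b w)"
proof (rule E_eqI[OF W' linear_maps_comp[OF del_linear retr_linear[OF W' b']]
      linear_maps_comp[OF retr_linear[OF W b] \<phi>] _ w])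
  interpret W': module R W' by fact
  fix xs as y assume ok: "ok xs" "ok as" "y \<in> carrier N"
  show "retr (int k - (n - 1)) (n - 1) W' b' (del (cl xs as y)) = \<phi> (retr (int k - n) n W b (cl xs as y))"
  proof (cases "xs \<in> tuples M (int k - n) \<and> as \<in> tuples M n")
    case True
    then have kc: "kgen R M (int k - n) n xs as \<in> carrier (Kc k n)"
      by (intro kgen_closed M.module_axioms) auto
    have "retr (int k - (n - 1)) (n - 1) W' b' (del (cl xs as y)) =
        retr (int k - (n - 1)) (n - 1) W' b' (emb (int k - (n - 1)) (n - 1) y (koszul_diff R M k n (kgen R M (int k - n) n xs as)))"
      using True ok emb_diff[OF ok(3) kc] by (simp add: emb_kgen)
    also have "\<dots> = b' (koszul_diff R M k n (kgen R M (int k - n) n xs as)) y"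
      by (rule retr_emb[OF W' b' ok(3) lin_closed[OF kdiff_linear kc]])
    also have "\<dots> = \<phi> (b (kgen R M (int k - n) n xs as) y)"
      by (rule nat[OF kc ok(3), symmetric])
    finally show ?thesis
      using True by (simp add: retr_cl[OF W b ok])
  next
    case False
    have "retr (int k - (n - 1)) (n - 1) W' b' (((\<ominus> \<one>) [^] i) \<odot>\<^bsub>E\<^esub> cl (as ! i # xs) (take i as @ drop (Suc i) as) y) = \<zero>\<^bsub>W'\<^esub>"
      if i: "i < length as" for i
    proof -
      have ai: "as ! i \<in> carrier M"
        using ok i nth_mem[OF i] by blast
      then have t: "ok (as ! i # xs)" "ok (take i as @ drop (Suc i) as)"
        using ok ok_omit by auto
      have "\<not> (as ! i # xs \<in> tuples M (int k - (n - 1)) \<and> take i as @ drop (Suc i) as \<in> tuples M (n - 1))"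
        using False ok i by (auto simp: tuples_def)
      then have "retr (int k - (n - 1)) (n - 1) W' b' (cl (as ! i # xs) (take i as @ drop (Suc i) as) y) = \<zero>\<^bsub>W'\<^esub>"
        unfolding retr_cl[OF W' b' t ok(3)] by (rule if_not_P)
      then show ?thesis
        using lin_smult[OF retr_linear[OF W' b'] _ cl_closed[OF t ok(3)]] by simp
    qed
    then have "(\<Oplus>\<^bsub>W'\<^esub>i\<in>{..<length as}. retr (int k - (n - 1)) (n - 1) W' b'
        (((\<ominus> \<one>) [^] i) \<odot>\<^bsub>E\<^esub> cl (as ! i # xs) (take i as @ drop (Suc i) as) y)) = \<zero>\<^bsub>W'\<^esub>"
      by (intro W'.add.finprod_one_eqI) auto
    moreover have "cl (as ! i # xs) (take i as @ drop (Suc i) as) y \<in> carrier E" if "i < length as" for i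
      using ok ok_omit[of as i] nth_mem[OF that] by (intro cl_closed) auto
    ultimately have "retr (int k - (n - 1)) (n - 1) W' b' (dterm xs as y) = \<zero>\<^bsub>W'\<^esub>"
      unfolding dterm_finsum[OF ok]
      by (subst lin_finsum[OF P.module_pres_module W' retr_linear[OF W' b']]) auto
    moreover have "retr (int k - n) n W b (cl xs as y) = \<zero>\<^bsub>W\<^esub>"
      unfolding retr_cl[OF W b ok] using False by (rule if_not_P)
    ultimately show ?thesis
      using lin_zero[OF W W' \<phi>] ok by simp
  qed
qed

end

lemma koszul_complex_component [simp]: "component (koszul_complex R M k) = koszul_component R M k"
  by (simp add: koszul_complex_def)

lemma tensor_complex_is_complex:
  assumes C: "is_complex R C" and N: "module R N"
  shows "is_complex R (tensor_complex R C N)"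
proof -
  interpret N: module R N by fact
  have m: "module R (component C n)" and l: "differential C n \<in> linear_maps R (component C n) (component C (n - 1))"
    and z: "x \<in> carrier (component C n) \<Longrightarrow> differential C (n - 1) (differential C n x) = \<zero>\<^bsub>component C (n - 2)\<^esub>"
    for n x
    using C unfolding is_complex_def by auto
  have i: "id \<in> linear_maps R N N"
    using linear_maps_id[of R N] by (simp add: id_def)
  note tm = tensor_map_linear[OF m N m N l i]
  have dd: "tensor_map R (component C (n - 1 - 1)) N (differential C (n - 1)) id
      (tensor_map R (component C (n - 1)) N (differential C n) id t) = \<zero>\<^bsub>tensor_module R (component C (n - 1 - 1)) N\<^esub>"
    if t: "t \<in> carrier (tensor_module R (component C n) N)" for n t
  proof (rule tensor_linear_eqI[OF m N module_tensor_module[OF m N] linear_maps_comp[OF tm(1) tm(1)]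
        linear_maps_zero[OF module_tensor_module[OF m N]] _ t])
    fix x y assume x: "x \<in> carrier (component C n)" and y: "y \<in> carrier N"
    have z': "differential C (n - 1) (differential C n x) = \<zero>\<^bsub>component C (n - 1 - 1)\<^esub>"
      using z[OF x] by simp
    show "tensor_map R (component C (n - 1 - 1)) N (differential C (n - 1)) id
        (tensor_map R (component C (n - 1)) N (differential C n) id (pure_tensor R (component C n) N x y)) =
        \<zero>\<^bsub>tensor_module R (component C (n - 1 - 1)) N\<^esub>"
      unfolding tm(2)[OF x y] id_apply tm(2)[OF lin_closed[OF l x] y] z'
      by (rule lin_zero[OF m module_tensor_module[OF m N] pure_tensor_linear_left[OF m N y]])
  qed
  show ?thesis
    unfolding is_complex_def tensor_complex_def module_complex.simps
    using module_tensor_module[OF m N] tm(1) dd by simp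
qed

context two_modules
begin

lemma homotopy_emb:
  assumes y: "y \<in> carrier N" and z: "z \<in> carrier (Kc k n)"
  shows "del (hom (emb (int k - n) n y z)) \<oplus>\<^bsub>E\<^esub> hom (del (emb (int k - n) n y z)) =
    ([k] \<cdot>\<^bsub>R\<^esub> \<one>) \<odot>\<^bsub>E\<^esub> emb (int k - n) n y z"
proof -
  note e = emb_linear[OF y, of "int k - n" n]
  show ?thesis
  proof (rule kos_eqI[OF M.module_axioms P.module_pres_module
        linear_maps_add[OF P.module_pres_module
          linear_maps_comp[OF linear_maps_comp[OF e hom_linear] del_linear]
          linear_maps_comp[OF linear_maps_comp[OF e del_linear] hom_linear]]
        linear_maps_smult[OF P.module_pres_module e] _ z])
    fix xs as assume t: "xs \<in> tuples M (int k - n)" "as \<in> tuples M n"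
    then have ok: "ok xs" "ok as" and len: "length xs + length as = k"
      by (auto simp: tuples_def)
    show "del (hom (emb (int k - n) n y (kgen R M (int k - n) n xs as))) \<oplus>\<^bsub>E\<^esub>
        hom (del (emb (int k - n) n y (kgen R M (int k - n) n xs as))) =
        ([k] \<cdot>\<^bsub>R\<^esub> \<one>) \<odot>\<^bsub>E\<^esub> emb (int k - n) n y (kgen R M (int k - n) n xs as)"
      unfolding emb_kgen[OF y t] using homotopy_cl[OF ok y] len by simp
  qed simp
qed

definition iota where
  "iota k n = (SOME g. g \<in> linear_maps R (tensor_module R (Kc k n) N) E \<and>
     (\<forall>z \<in> carrier (Kc k n). \<forall>y \<in> carrier N. g (pure_tensor R (Kc k n) N z y) = emb (int k - n) n y z))"

lemma iota_linear: "iota k n \<in> linear_maps R (tensor_module R (Kc k n) N) E"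
  and iota_pure: "z \<in> carrier (Kc k n) \<Longrightarrow> y \<in> carrier N \<Longrightarrow>
    iota k n (pure_tensor R (Kc k n) N z y) = emb (int k - n) n y z"
proof -
  have b: "bilinear R (Kc k n) N E (\<lambda>z y. emb (int k - n) n y z)"
    unfolding bilinear_def by (simp add: emb_linear emb_linear_right)
  have "\<exists>g. g \<in> linear_maps R (tensor_module R (Kc k n) N) E \<and>
     (\<forall>z \<in> carrier (Kc k n). \<forall>y \<in> carrier N. g (pure_tensor R (Kc k n) N z y) = emb (int k - n) n y z)"
    by (rule tensor_lift[OF Kc_module N.module_axioms P.module_pres_module b]) auto
  then have "iota k n \<in> linear_maps R (tensor_module R (Kc k n) N) E \<and>
     (\<forall>z \<in> carrier (Kc k n). \<forall>y \<in> carrier N. iota k n (pure_tensor R (Kc k n) N z y) = emb (int k - n) n y z)"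
    unfolding iota_def by (rule someI_ex)
  then show "iota k n \<in> linear_maps R (tensor_module R (Kc k n) N) E"
    "z \<in> carrier (Kc k n) \<Longrightarrow> y \<in> carrier N \<Longrightarrow>
      iota k n (pure_tensor R (Kc k n) N z y) = emb (int k - n) n y z"
    by auto
qed

lemma kosN_eqI:
  assumes W: "module R W" and f: "f \<in> linear_maps R (tensor_module R (Kc k n) N) W"
    and g: "g \<in> linear_maps R (tensor_module R (Kc k n) N) W"
    and eq: "\<And>xs as y. xs \<in> tuples M (int k - n) \<Longrightarrow> as \<in> tuples M n \<Longrightarrow> y \<in> carrier N \<Longrightarrow>
      f (pure_tensor R (Kc k n) N (kgen R M (int k - n) n xs as) y) =
      g (pure_tensor R (Kc k n) N (kgen R M (int k - n) n xs as) y)"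
    and t: "t \<in> carrier (tensor_module R (Kc k n) N)"
  shows "f t = g t"
proof (rule tensor_linear_eqI[OF Kc_module N.module_axioms W f g _ t])
  fix z y assume z: "z \<in> carrier (Kc k n)" and y: "y \<in> carrier N"
  note l = linear_maps_comp[OF pure_tensor_linear_left[OF Kc_module N.module_axioms y]]
  show "f (pure_tensor R (Kc k n) N z y) = g (pure_tensor R (Kc k n) N z y)"
    by (rule kos_eqI[OF M.module_axioms W l[OF f] l[OF g] _ z]) (rule eq[OF _ _ y])
qed

abbreviation "tdiff k n \<equiv> tensor_map R (Kc k (n - 1)) N (koszul_diff R M k n) id"

lemma tdiff_linear: "tdiff k n \<in> linear_maps R (tensor_module R (Kc k n) N) (tensor_module R (Kc k (n - 1)) N)"
  and tdiff_pure: "z \<in> carrier (Kc k n) \<Longrightarrow> y \<in> carrier N \<Longrightarrow>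
    tdiff k n (pure_tensor R (Kc k n) N z y) = pure_tensor R (Kc k (n - 1)) N (koszul_diff R M k n z) y"
proof -
  have "id \<in> linear_maps R N N"
    using linear_maps_id[of R N] by (simp add: id_def)
  note t = tensor_map_linear[OF Kc_module N.module_axioms Kc_module N.module_axioms kdiff_linear this]
  show "tdiff k n \<in> linear_maps R (tensor_module R (Kc k n) N) (tensor_module R (Kc k (n - 1)) N)"
    by (rule t(1))
  show "z \<in> carrier (Kc k n) \<Longrightarrow> y \<in> carrier N \<Longrightarrow>
      tdiff k n (pure_tensor R (Kc k n) N z y) = pure_tensor R (Kc k (n - 1)) N (koszul_diff R M k n z) y"
    using t(2)[of z k n y] by simp
qed

lemma iota_tdiff:
  assumes "t \<in> carrier (tensor_module R (Kc k n) N)"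
  shows "iota k (n - 1) (tdiff k n t) = del (iota k n t)"
proof (rule tensor_linear_eqI[OF Kc_module N.module_axioms P.module_pres_module
      linear_maps_comp[OF tdiff_linear iota_linear] linear_maps_comp[OF iota_linear del_linear] _ assms])
  fix z y assume z: "z \<in> carrier (Kc k n)" and y: "y \<in> carrier N"
  show "iota k (n - 1) (tdiff k n (pure_tensor R (Kc k n) N z y)) = del (iota k n (pure_tensor R (Kc k n) N z y))"
    unfolding tdiff_pure[OF z y] iota_pure[OF z y] iota_pure[OF lin_closed[OF kdiff_linear z] y]
    by (rule emb_diff[OF y z])
qed

abbreviation "tretr k n \<equiv> retr (int k - n) n (tensor_module R (Kc k n) N) (pure_tensor R (Kc k n) N)"

lemmas pt_bilinear = pure_tensor_bilinear[OF Kc_module N.module_axioms]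
lemmas KcN_module = module_tensor_module[OF Kc_module N.module_axioms]

lemma tretr_iota:
  assumes "t \<in> carrier (tensor_module R (Kc k n) N)"
  shows "tretr k n (iota k n t) = t"
proof (rule tensor_linear_eqI[OF Kc_module N.module_axioms KcN_module
      linear_maps_comp[OF iota_linear retr_linear[OF KcN_module pt_bilinear]] linear_maps_id _ assms])
  fix z y assume z: "z \<in> carrier (Kc k n)" and y: "y \<in> carrier N"
  show "tretr k n (iota k n (pure_tensor R (Kc k n) N z y)) = pure_tensor R (Kc k n) N z y"
    unfolding iota_pure[OF z y] by (rule retr_emb[OF KcN_module pt_bilinear y z])
qed

lemma tretr_del:
  assumes "w \<in> carrier E"
  shows "tretr k (n - 1) (del w) = tdiff k n (tretr k n w)"
  by (rule retr_del[OF KcN_module KcN_module pt_bilinear pt_bilinear tdiff_linear tdiff_pure assms])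

end

lemma koszul_is_complex:
  assumes M: "module R M"
  shows "is_complex R (koszul_complex R M k)"
proof -
  interpret M: module R M by fact
  interpret T: two_modules R M "ring_module R"
    by (intro two_modules.intro M module_ring_module M.R.cring_axioms)
  have one: "\<one>\<^bsub>R\<^esub> \<in> carrier (ring_module R)" by simp
  note b = scalar_bilinear[OF T.Kc_module]
  have "koszul_diff R M k (n - 1) (koszul_diff R M k n z) = \<zero>\<^bsub>T.Kc k (n - 1 - 1)\<^esub>"
    if z: "z \<in> carrier (T.Kc k n)" for n z
  proof -
    let ?v = "koszul_diff R M k (n - 1) (koszul_diff R M k n z)"
    have z1: "koszul_diff R M k n z \<in> carrier (T.Kc k (n - 1))"
      by (rule lin_closed[OF T.kdiff_linear z])
    have v: "?v \<in> carrier (T.Kc k (n - 1 - 1))"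
      by (rule lin_closed[OF T.kdiff_linear z1])
    interpret K: module R "T.Kc k (n - 1 - 1)" by (rule T.Kc_module)
    have e0: "T.emb (int k - (n - 1 - 1)) (n - 1 - 1) \<one>\<^bsub>R\<^esub> ?v = \<zero>\<^bsub>T.E\<^esub>"
      unfolding T.emb_diff[OF one z1] T.emb_diff[OF one z]
      by (rule T.del_del[OF lin_closed[OF T.emb_linear[OF one] z]])
    have "?v = \<one>\<^bsub>R\<^esub> \<odot>\<^bsub>T.Kc k (n - 1 - 1)\<^esub> ?v"
      by (rule K.smult_one[OF v, symmetric])
    also have "\<dots> = T.retr (int k - (n - 1 - 1)) (n - 1 - 1) (T.Kc k (n - 1 - 1))
        (\<lambda>z r. r \<odot>\<^bsub>T.Kc k (n - 1 - 1)\<^esub> z) \<zero>\<^bsub>T.E\<^esub>"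
      using T.retr_emb[OF T.Kc_module b one v] unfolding e0 by (rule sym)
    also have "\<dots> = \<zero>\<^bsub>T.Kc k (n - 1 - 1)\<^esub>"
      by (rule lin_zero[OF T.P.module_pres_module T.Kc_module T.retr_linear[OF T.Kc_module b]])
    finally show ?thesis .
  qed
  moreover have "n - 1 - 1 = n - 2" for n :: int by simp
  ultimately show ?thesis
    unfolding is_complex_def koszul_complex_component
    using module_koszul_component[OF M] koszul_diff_linear[OF M] by (simp add: koszul_component_def)
qed

lemma koszul_contractible:
  assumes M: "module R M" and u: "[k] \<cdot>\<^bsub>R\<^esub> \<one>\<^bsub>R\<^esub> \<in> Units R"
  shows "contractible_complex R (koszul_complex R M k)"
proof -
  interpret M: module R M by fact
  interpret T: two_modules R M "ring_module R"
    by (intro two_modules.intro M module_ring_module M.R.cring_axioms)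
  have one: "\<one>\<^bsub>R\<^esub> \<in> carrier (ring_module R)" by simp
  note b = scalar_bilinear[OF T.Kc_module]
  define v where "v = inv\<^bsub>R\<^esub> ([k] \<cdot>\<^bsub>R\<^esub> \<one>\<^bsub>R\<^esub>)"
  have v: "v \<in> carrier R" "v \<otimes>\<^bsub>R\<^esub> ([k] \<cdot>\<^bsub>R\<^esub> \<one>\<^bsub>R\<^esub>) = \<one>\<^bsub>R\<^esub>"
    using u by (simp_all add: v_def)
  define rt where "rt = (\<lambda>n. T.retr (int k - n) n (T.Kc k n) (\<lambda>z r. r \<odot>\<^bsub>T.Kc k n\<^esub> z))"
  define em where "em = (\<lambda>n. T.emb (int k - n) n \<one>\<^bsub>R\<^esub>)"
  have rt: "rt n \<in> linear_maps R T.E (T.Kc k n)" for n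
    unfolding rt_def by (rule T.retr_linear[OF T.Kc_module b])
  have em: "em n \<in> linear_maps R (T.Kc k n) T.E" for n
    unfolding em_def by (rule T.emb_linear[OF one])
  have rt_em: "rt n (em n z) = z" if "z \<in> carrier (T.Kc k n)" for n z
  proof -
    interpret K: module R "T.Kc k n" by (rule T.Kc_module)
    show ?thesis
      unfolding rt_def em_def T.retr_emb[OF T.Kc_module b one that] by (rule K.smult_one[OF that])
  qed
  have em_diff: "em (n - 1) (koszul_diff R M k n z) = T.del (em n z)" if "z \<in> carrier (T.Kc k n)" for n z
    unfolding em_def by (rule T.emb_diff[OF one that])
  have rt_del: "rt (n - 1) (T.del w) = koszul_diff R M k n (rt n w)" if "w \<in> carrier T.E" for n w
    unfolding rt_def
    by (rule T.retr_del[OF T.Kc_module T.Kc_module b b T.kdiff_linear _ that])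
      (simp add: lin_smult[OF T.kdiff_linear])
  define h where "h = (\<lambda>n z. v \<odot>\<^bsub>T.Kc k (n + 1)\<^esub> rt (n + 1) (T.hom (em n z)))"
  have h: "h n \<in> linear_maps R (T.Kc k n) (T.Kc k (n + 1))" for n
    unfolding h_def
    by (rule linear_maps_smult[OF T.Kc_module linear_maps_comp[OF linear_maps_comp[OF em T.hom_linear] rt] v(1)])
  have "koszul_diff R M k (n + 1) (h n z) \<oplus>\<^bsub>T.Kc k n\<^esub> h (n - 1) (koszul_diff R M k n z) = z"
    if z: "z \<in> carrier (T.Kc k n)" for n z
  proof -
    interpret K: module R "T.Kc k n" by (rule T.Kc_module)
    have e: "em n z \<in> carrier T.E" by (rule lin_closed[OF em z])
    have c: "rt n (T.del (T.hom (em n z))) \<in> carrier (T.Kc k n)" "rt n (T.hom (T.del (em n z))) \<in> carrier (T.Kc k n)"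
      using e by (auto intro!: lin_closed[OF rt])
    have n1: "n + 1 - 1 = n" "n - 1 + 1 = n" by simp_all
    have he: "T.hom (em n z) \<in> carrier T.E" using e by simp
    have 1: "koszul_diff R M k (n + 1) (h n z) = v \<odot>\<^bsub>T.Kc k n\<^esub> rt n (T.del (T.hom (em n z)))"
      unfolding h_def
      using lin_smult[OF T.kdiff_linear[of k "n + 1"] v(1) lin_closed[OF rt[of "n + 1"] he]]
        rt_del[OF he, of "n + 1"] unfolding n1 by simp
    have 2: "h (n - 1) (koszul_diff R M k n z) = v \<odot>\<^bsub>T.Kc k n\<^esub> rt n (T.hom (T.del (em n z)))"
      unfolding h_def n1 em_diff[OF z] ..
    have "koszul_diff R M k (n + 1) (h n z) \<oplus>\<^bsub>T.Kc k n\<^esub> h (n - 1) (koszul_diff R M k n z) =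
        v \<odot>\<^bsub>T.Kc k n\<^esub> (rt n (T.del (T.hom (em n z))) \<oplus>\<^bsub>T.Kc k n\<^esub> rt n (T.hom (T.del (em n z))))"
      unfolding 1 2 using K.smult_r_distr[OF v(1) c] by simp
    also have "\<dots> = v \<odot>\<^bsub>T.Kc k n\<^esub> rt n (T.del (T.hom (em n z)) \<oplus>\<^bsub>T.E\<^esub> T.hom (T.del (em n z)))"
      using lin_add[OF rt, of "T.del (T.hom (em n z))" "T.hom (T.del (em n z))"] e by simp
    also have "\<dots> = v \<odot>\<^bsub>T.Kc k n\<^esub> rt n (([k] \<cdot>\<^bsub>R\<^esub> \<one>\<^bsub>R\<^esub>) \<odot>\<^bsub>T.E\<^esub> em n z)"
      unfolding em_def T.homotopy_emb[OF one z] ..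
    also have "\<dots> = v \<odot>\<^bsub>T.Kc k n\<^esub> (([k] \<cdot>\<^bsub>R\<^esub> \<one>\<^bsub>R\<^esub>) \<odot>\<^bsub>T.Kc k n\<^esub> z)"
      using lin_smult[OF rt _ e, of "[k] \<cdot>\<^bsub>R\<^esub> \<one>\<^bsub>R\<^esub>"] rt_em[OF z] by simp
    also have "\<dots> = z"
      using z v by (simp add: K.smult_assoc1[symmetric])
    finally show ?thesis .
  qed
  then show ?thesis
    unfolding contractible_complex_def koszul_complex_component koszul_component_def
    using koszul_is_complex[OF M] h by blast
qed

context two_modules
begin

lemma acyclicI:
  assumes "\<And>n t. t \<in> carrier (tensor_module R (Kc k n) N) \<Longrightarrow> del (iota k n t) = \<zero>\<^bsub>E\<^esub> \<Longrightarrow>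
    \<exists>w \<in> carrier E. iota k n t = del w"
  shows "acyclic_complex R (tensor_complex R (koszul_complex R M k) N)"
proof -
  note C = tensor_complex_is_complex[OF koszul_is_complex[OF M.module_axioms] N.module_axioms, of k]
  have comp: "component (tensor_complex R (koszul_complex R M k) N) n = tensor_module R (Kc k n) N" for n
    by (simp add: tensor_complex_def koszul_component_def)
  have diff: "differential (tensor_complex R (koszul_complex R M k) N) n = tdiff k n" for n
    by (simp add: tensor_complex_def koszul_component_def)
  have dd: "tdiff k (n - 1) (tdiff k n t) = \<zero>\<^bsub>tensor_module R (Kc k (n - 2)) N\<^esub>"
    if "t \<in> carrier (tensor_module R (Kc k n) N)" for n t
    using C that unfolding is_complex_def comp diff by blast
  have "a_kernel (tensor_module R (Kc k n) N) (tensor_module R (Kc k (n - 1)) N) (tdiff k n) =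
      tdiff k (n + 1) ` carrier (tensor_module R (Kc k (n + 1)) N)" for n
  proof (intro equalityI subsetI)
    fix t assume "t \<in> a_kernel (tensor_module R (Kc k n) N) (tensor_module R (Kc k (n - 1)) N) (tdiff k n)"
    then have t: "t \<in> carrier (tensor_module R (Kc k n) N)"
      and dt: "tdiff k n t = \<zero>\<^bsub>tensor_module R (Kc k (n - 1)) N\<^esub>"
      by (simp_all add: a_kernel_def')
    have "del (iota k n t) = \<zero>\<^bsub>E\<^esub>"
      using iota_tdiff[OF t] lin_zero[OF KcN_module P.module_pres_module iota_linear] unfolding dt by simp
    from assms[OF t this] obtain w where w: "w \<in> carrier E" "iota k n t = del w"
      by (elim bexE)
    have "t = tretr k n (del w)"
      using tretr_iota[OF t] w(2) by simp
    also have "\<dots> = tdiff k (n + 1) (tretr k (n + 1) w)"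
      using tretr_del[OF w(1), of k "n + 1"] by simp
    finally show "t \<in> tdiff k (n + 1) ` carrier (tensor_module R (Kc k (n + 1)) N)"
      using lin_closed[OF retr_linear[OF KcN_module pt_bilinear] w(1)] by (rule image_eqI)
  next
    fix t assume "t \<in> tdiff k (n + 1) ` carrier (tensor_module R (Kc k (n + 1)) N)"
    then obtain s where s: "s \<in> carrier (tensor_module R (Kc k (n + 1)) N)" and t: "t = tdiff k (n + 1) s"
      by (elim imageE)
    have "t \<in> carrier (tensor_module R (Kc k n) N)"
      using lin_closed[OF tdiff_linear s] unfolding t by simp
    moreover have "tdiff k n t = \<zero>\<^bsub>tensor_module R (Kc k (n - 1)) N\<^esub>"
      using dd[OF s] unfolding t by simp
    ultimately show "t \<in> a_kernel (tensor_module R (Kc k n) N) (tensor_module R (Kc k (n - 1)) N) (tdiff k n)"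
      by (simp add: a_kernel_def')
  qed
  then show ?thesis
    unfolding acyclic_complex_def comp diff using C by blast
qed

lemma acyclic_if_unit:
  assumes u: "[k] \<cdot>\<^bsub>R\<^esub> \<one> \<in> Units R"
  shows "acyclic_complex R (tensor_complex R (koszul_complex R M k) N)"
proof (rule acyclicI)
  fix n t assume t: "t \<in> carrier (tensor_module R (Kc k n) N)" and d0: "del (iota k n t) = \<zero>\<^bsub>E\<^esub>"
  let ?k = "[k] \<cdot>\<^bsub>R\<^esub> \<one>"
  have it: "iota k n t \<in> carrier E" by (rule lin_closed[OF iota_linear t])
  have "del (hom (iota k n t)) \<oplus>\<^bsub>E\<^esub> hom (del (iota k n t)) = ?k \<odot>\<^bsub>E\<^esub> iota k n t"
  proof (rule tensor_linear_eqI[OF Kc_module N.module_axioms P.module_pres_module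
        linear_maps_add[OF P.module_pres_module
          linear_maps_comp[OF linear_maps_comp[OF iota_linear hom_linear] del_linear]
          linear_maps_comp[OF linear_maps_comp[OF iota_linear del_linear] hom_linear]]
        linear_maps_smult[OF P.module_pres_module iota_linear] _ t])
    fix z y assume z: "z \<in> carrier (Kc k n)" and y: "y \<in> carrier N"
    show "del (hom (iota k n (pure_tensor R (Kc k n) N z y))) \<oplus>\<^bsub>E\<^esub>
        hom (del (iota k n (pure_tensor R (Kc k n) N z y))) = ?k \<odot>\<^bsub>E\<^esub> iota k n (pure_tensor R (Kc k n) N z y)"
      unfolding iota_pure[OF z y] by (rule homotopy_emb[OF y z])
  qed simp
  then have "del (hom (iota k n t)) = ?k \<odot>\<^bsub>E\<^esub> iota k n t"
    using it d0 by (simp add: hom_simps)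
  then have "del (inv ?k \<odot>\<^bsub>E\<^esub> hom (iota k n t)) = iota k n t"
    using it u by (simp add: del_simps P.P.smult_assoc1[symmetric])
  then show "\<exists>w \<in> carrier E. iota k n t = del w"
    using it u by (intro bexI[of _ "inv ?k \<odot>\<^bsub>E\<^esub> hom (iota k n t)"]) auto
qed

lemma kml_kmap:
  assumes pl: "partially_linear R M A B f"
  shows "kml R M N A B E (kmap f)"
proof -
  have f: "f \<in> carrier M \<rightarrow> carrier M"
    using partially_linearD(1)[OF pl] by auto
  note m = ok_map[OF f]
  show ?thesis
  proof (unfold_locales, goal_cases)
    case (1 xs as)
    then show ?case by (rule kmap_linear[OF f])
  next
    case (2 a b xs as y)
    then show ?case
      unfolding kmap_def list.map partially_linearD(2)[OF pl 2(1-3)]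
      by (intro K.add_x m) (auto simp: funcset_mem[OF f])
  next
    case (3 r a xs as y)
    then show ?case
      unfolding kmap_def list.map partially_linearD(3)[OF pl 3(1-3)]
      by (intro K.smult_x m) (auto simp: funcset_mem[OF f])
  next
    case (4 xs xs' as y)
    then show ?case
      unfolding kmap_def by (intro K.sym m) auto
  next
    case (5 a b xs ps qs y)
    then show ?case
      unfolding kmap_def map_append list.map partially_linearD(2)[OF pl 5(1-3)]
      by (intro K.add_as m) (auto simp: funcset_mem[OF f])
  next
    case (6 r a xs ps qs y)
    then show ?case
      unfolding kmap_def map_append list.map partially_linearD(3)[OF pl 6(1-3)]
      by (intro K.smult_as m) (auto simp: funcset_mem[OF f])
  next
    case (7 as xs y)
    then show ?case
      unfolding kmap_def by (intro K.alt m) (auto simp: distinct_map)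
  qed
qed

lemma sig_zero: "z \<in> carrier E \<Longrightarrow> sig \<zero>\<^bsub>M\<^esub> z = \<zero>\<^bsub>E\<^esub>"
  and lam_zero: "z \<in> carrier E \<Longrightarrow> lam \<zero>\<^bsub>M\<^esub> z = \<zero>\<^bsub>E\<^esub>"
  using sig_smult[of \<zero> "\<zero>\<^bsub>M\<^esub>" z] lam_smult[of \<zero> "\<zero>\<^bsub>M\<^esub>" z] by simp_all

lemma kmap_zero:
  assumes "ok xs" "ok as" "y \<in> carrier N" "length xs + length as > 0"
  shows "kmap (\<lambda>_. \<zero>\<^bsub>M\<^esub>) xs as y = \<zero>\<^bsub>E\<^esub>"
proof (cases xs)
  case (Cons x xs')
  then show ?thesis
    using assms kmap_Cons_x[of "\<lambda>_. \<zero>\<^bsub>M\<^esub>" x xs' as y] by (simp add: sig_zero)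
next
  case Nil
  then obtain a as' where "as = a # as'" using assms(4) by (cases as) auto
  then show ?thesis
    using assms Nil kmap_Cons_as[of "\<lambda>_. \<zero>\<^bsub>M\<^esub>" a "[]" as' y] by (simp add: lam_zero)
qed

lemma acyclic_if_locally_split:
  assumes ls: "locally_split R M" and k: "k \<ge> 1"
  shows "acyclic_complex R (tensor_complex R (koszul_complex R M k) N)"
proof (rule acyclicI)
  fix n t assume t: "t \<in> carrier (tensor_module R (Kc k n) N)" and d0: "del (iota k n t) = \<zero>\<^bsub>E\<^esub>"
  let ?z = "\<lambda>_. \<zero>\<^bsub>M\<^esub>"
  have zf: "?z \<in> carrier M \<rightarrow> carrier M" by simp
  have kz: "kml R M N AM BM E (kmap ?z)"
    by (rule kml_kmap) (auto simp: partially_linear_def)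
  have "iota k n t \<in> carrier E" by (rule lin_closed[OF iota_linear t])
  then obtain Z where Z: "Z \<in> carrier FT" "iota k n t = proj Z"
    by (rule P.pres_carrierE)
  have "flft E (kmap ?z) Z = lft E (kmap ?z) (proj Z)"
    by (rule FT_eqI[OF P.module_pres_module flft_kmap_linear[OF zf]
          linear_maps_comp[OF P.pres_proj_linear lft_linear[OF P.module_pres_module kz]] _ Z(1)])
      (simp add: flft_kmap_gen[OF zf] proj_gen lft_cl[OF P.module_pres_module kz])
  also have "\<dots> = \<zero>\<^bsub>E\<^esub>"
    unfolding Z(2)[symmetric]
  proof (rule kosN_eqI[OF P.module_pres_module
        linear_maps_comp[OF iota_linear lft_linear[OF P.module_pres_module kz]]
        linear_maps_zero[OF P.module_pres_module] _ t])
    fix xs as y assume xa: "xs \<in> tuples M (int k - n)" "as \<in> tuples M n" and y: "y \<in> carrier N"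
    then have ok: "ok xs" "ok as" and len: "length xs + length as > 0"
      using k by (auto simp: tuples_def)
    show "lft E (kmap ?z) (iota k n (pure_tensor R (Kc k n) N (kgen R M (int k - n) n xs as) y)) = \<zero>\<^bsub>E\<^esub>"
      unfolding iota_pure[OF kgen_closed[OF M.module_axioms xa] y] emb_kgen[OF y xa]
        lft_cl[OF P.module_pres_module kz ok y]
      by (rule kmap_zero[OF ok y len])
  qed
  finally show "\<exists>w \<in> carrier E. iota k n t = del w"
    using locally_split_exact[OF ls Z(1)] d0 Z(2) by simp
qed

end

section \<open>Locally split modules\<close>

lemma reachable_coefficients:
  assumes M: "module R M" and e: "\<And>i. i < (s :: nat) \<Longrightarrow> e i \<in> carrier M"
    and C: "\<And>x i. x \<in> carrier M \<Longrightarrow> i < s \<Longrightarrow> C x i \<in> carrier R"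
    and A: "A \<subseteq> carrier M \<times> carrier M"
      "\<And>a b i. (a, b) \<in> A \<Longrightarrow> i < s \<Longrightarrow> C (a \<oplus>\<^bsub>M\<^esub> b) i \<odot>\<^bsub>M\<^esub> e i = C a i \<odot>\<^bsub>M\<^esub> e i \<oplus>\<^bsub>M\<^esub> C b i \<odot>\<^bsub>M\<^esub> e i"
    and B: "B \<subseteq> carrier R \<times> carrier M"
      "\<And>r a i. (r, a) \<in> B \<Longrightarrow> i < s \<Longrightarrow> C (r \<odot>\<^bsub>M\<^esub> a) i \<odot>\<^bsub>M\<^esub> e i = r \<odot>\<^bsub>M\<^esub> (C a i \<odot>\<^bsub>M\<^esub> e i)"
  shows "reachable R M A B (\<lambda>x. if x \<in> carrier M then \<Oplus>\<^bsub>M\<^esub>i\<in>{..<s}. C x i \<odot>\<^bsub>M\<^esub> e i else \<zero>\<^bsub>M\<^esub>)"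
proof -
  interpret M: module R M by fact
  have Ce: "C x i \<odot>\<^bsub>M\<^esub> e i \<in> carrier M" if "x \<in> carrier M" "i < n" "n \<le> s" for x i n
  proof -
    have "i < s" using that by simp
    then show ?thesis using that(1) C e by simp
  qed
  have cl: "(\<Oplus>\<^bsub>M\<^esub>i\<in>{..<n}. C x i \<odot>\<^bsub>M\<^esub> e i) \<in> carrier M" if "x \<in> carrier M" "n \<le> s" for x n
    using that Ce by (intro M.M.finsum_closed) auto
  have pl: "partially_linear R M A B (\<lambda>x. if x \<in> carrier M then \<Oplus>\<^bsub>M\<^esub>i\<in>{..<n}. C x i \<odot>\<^bsub>M\<^esub> e i else \<zero>\<^bsub>M\<^esub>)"
    if n: "n \<le> s" for n
    unfolding partially_linear_def
  proof (intro conjI ballI funcsetI)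
    fix x show "(if x \<in> carrier M then \<Oplus>\<^bsub>M\<^esub>i\<in>{..<n}. C x i \<odot>\<^bsub>M\<^esub> e i else \<zero>\<^bsub>M\<^esub>) \<in> carrier M"
      using cl n by simp
  next
    fix p assume p: "p \<in> A"
    obtain a b where ab: "p = (a, b)" "a \<in> carrier M" "b \<in> carrier M" using A(1) p by auto
    have "(\<Oplus>\<^bsub>M\<^esub>i\<in>{..<n}. C (a \<oplus>\<^bsub>M\<^esub> b) i \<odot>\<^bsub>M\<^esub> e i) = (\<Oplus>\<^bsub>M\<^esub>i\<in>{..<n}. C a i \<odot>\<^bsub>M\<^esub> e i \<oplus>\<^bsub>M\<^esub> C b i \<odot>\<^bsub>M\<^esub> e i)"
      by (rule M.M.finsum_cong') (use A(2) p ab n Ce in auto)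
    also have "\<dots> = (\<Oplus>\<^bsub>M\<^esub>i\<in>{..<n}. C a i \<odot>\<^bsub>M\<^esub> e i) \<oplus>\<^bsub>M\<^esub> (\<Oplus>\<^bsub>M\<^esub>i\<in>{..<n}. C b i \<odot>\<^bsub>M\<^esub> e i)"
      by (rule M.M.finsum_addf) (use ab n Ce in auto)
    finally show "case p of (a, b) \<Rightarrow> a \<in> carrier M \<longrightarrow> b \<in> carrier M \<longrightarrow>
        (if a \<oplus>\<^bsub>M\<^esub> b \<in> carrier M then \<Oplus>\<^bsub>M\<^esub>i\<in>{..<n}. C (a \<oplus>\<^bsub>M\<^esub> b) i \<odot>\<^bsub>M\<^esub> e i else \<zero>\<^bsub>M\<^esub>) =
        (if a \<in> carrier M then \<Oplus>\<^bsub>M\<^esub>i\<in>{..<n}. C a i \<odot>\<^bsub>M\<^esub> e i else \<zero>\<^bsub>M\<^esub>) \<oplus>\<^bsub>M\<^esub>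
        (if b \<in> carrier M then \<Oplus>\<^bsub>M\<^esub>i\<in>{..<n}. C b i \<odot>\<^bsub>M\<^esub> e i else \<zero>\<^bsub>M\<^esub>)"
      using ab by simp
  next
    fix p assume p: "p \<in> B"
    obtain r a where ab: "p = (r, a)" "r \<in> carrier R" "a \<in> carrier M" using B(1) p by auto
    have "r \<odot>\<^bsub>M\<^esub> (\<Oplus>\<^bsub>M\<^esub>i\<in>{..<n}. C a i \<odot>\<^bsub>M\<^esub> e i) = (\<Oplus>\<^bsub>M\<^esub>i\<in>{..<n}. r \<odot>\<^bsub>M\<^esub> (C a i \<odot>\<^bsub>M\<^esub> e i))"
      by (rule M.finsum_smult_ldistr) (use ab n Ce in auto)
    also have "\<dots> = (\<Oplus>\<^bsub>M\<^esub>i\<in>{..<n}. C (r \<odot>\<^bsub>M\<^esub> a) i \<odot>\<^bsub>M\<^esub> e i)"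
      by (rule M.M.finsum_cong') (use B(2) p ab n Ce in auto)
    finally show "case p of (r, a) \<Rightarrow> r \<in> carrier R \<longrightarrow> a \<in> carrier M \<longrightarrow>
        (if r \<odot>\<^bsub>M\<^esub> a \<in> carrier M then \<Oplus>\<^bsub>M\<^esub>i\<in>{..<n}. C (r \<odot>\<^bsub>M\<^esub> a) i \<odot>\<^bsub>M\<^esub> e i else \<zero>\<^bsub>M\<^esub>) =
        r \<odot>\<^bsub>M\<^esub> (if a \<in> carrier M then \<Oplus>\<^bsub>M\<^esub>i\<in>{..<n}. C a i \<odot>\<^bsub>M\<^esub> e i else \<zero>\<^bsub>M\<^esub>)"
      using ab by simp
  qed
  have "reachable R M A B (\<lambda>x. if x \<in> carrier M then \<Oplus>\<^bsub>M\<^esub>i\<in>{..<n}. C x i \<odot>\<^bsub>M\<^esub> e i else \<zero>\<^bsub>M\<^esub>)"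
    if "n \<le> s" for n
    using that
  proof (induction n)
    case 0
    show ?case using reachable.zero[of R M A B] by (simp cong: if_cong)
  next
    case (Suc n)
    show ?case
    proof (rule reachable.step[OF Suc.IH pl[OF Suc.prems]])
      show "e n \<in> carrier M" using e Suc.prems by simp
      fix x assume x: "x \<in> carrier M"
      have "(\<Oplus>\<^bsub>M\<^esub>i\<in>{..<Suc n}. C x i \<odot>\<^bsub>M\<^esub> e i) = C x n \<odot>\<^bsub>M\<^esub> e n \<oplus>\<^bsub>M\<^esub> (\<Oplus>\<^bsub>M\<^esub>i\<in>{..<n}. C x i \<odot>\<^bsub>M\<^esub> e i)"
        by (rule finsum_insert_lessThan[OF M.M.abelian_monoid_axioms]) (use x Ce Suc.prems in auto)
      then show "\<exists>c \<in> carrier R. (if x \<in> carrier M then \<Oplus>\<^bsub>M\<^esub>i\<in>{..<Suc n}. C x i \<odot>\<^bsub>M\<^esub> e i else \<zero>\<^bsub>M\<^esub>) =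
          (if x \<in> carrier M then \<Oplus>\<^bsub>M\<^esub>i\<in>{..<n}. C x i \<odot>\<^bsub>M\<^esub> e i else \<zero>\<^bsub>M\<^esub>) \<oplus>\<^bsub>M\<^esub> c \<odot>\<^bsub>M\<^esub> e n"
        using x e C Suc.prems cl[OF x, of n] by (intro bexI[of _ "C x n"]) (auto simp: M.M.a_comm)
    qed (use Suc.prems in simp)
  qed
  then show ?thesis by blast
qed

definition splitting where
  "splitting R M U A B (s::nat) e C \<longleftrightarrow> (\<forall>i<s. e i \<in> carrier M) \<and> (\<forall>x\<in>U. \<forall>i<s. C x i \<in> carrier R) \<and>
     (\<forall>x\<in>U. (\<Oplus>\<^bsub>M\<^esub>i\<in>{..<s}. C x i \<odot>\<^bsub>M\<^esub> e i) = x) \<and>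
     (\<forall>(a, b)\<in>A. \<forall>i<s. C (a \<oplus>\<^bsub>M\<^esub> b) i \<odot>\<^bsub>M\<^esub> e i = C a i \<odot>\<^bsub>M\<^esub> e i \<oplus>\<^bsub>M\<^esub> C b i \<odot>\<^bsub>M\<^esub> e i) \<and>
     (\<forall>(r, a)\<in>B. \<forall>i<s. C (r \<odot>\<^bsub>M\<^esub> a) i \<odot>\<^bsub>M\<^esub> e i = r \<odot>\<^bsub>M\<^esub> (C a i \<odot>\<^bsub>M\<^esub> e i))"

lemma locally_splitI:
  assumes M: "module R M"
    and *: "\<And>U A B. finite U \<Longrightarrow> U \<subseteq> carrier M \<Longrightarrow> finite A \<Longrightarrow> finite B \<Longrightarrow> A \<subseteq> U \<times> U \<Longrightarrow> B \<subseteq> carrier R \<times> U \<Longrightarrow>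
      \<forall>(a, b)\<in>A. a \<oplus>\<^bsub>M\<^esub> b \<in> U \<Longrightarrow> \<forall>(r, a)\<in>B. r \<odot>\<^bsub>M\<^esub> a \<in> U \<Longrightarrow>
      \<exists>s e C. splitting R M U A B s e C"
  shows "locally_split R M"
  unfolding locally_split_def
proof (intro allI impI)
  interpret M: module R M by fact
  fix T A B assume fin: "finite T" "finite A" "finite B" and sub: "T \<subseteq> carrier M"
    "A \<subseteq> carrier M \<times> carrier M" "B \<subseteq> carrier R \<times> carrier M"
  define U where "U = T \<union> fst ` A \<union> snd ` A \<union> (\<lambda>(a, b). a \<oplus>\<^bsub>M\<^esub> b) ` A \<union> snd ` B \<union> (\<lambda>(r, a). r \<odot>\<^bsub>M\<^esub> a) ` B"
  have fU: "finite U" using fin by (simp add: U_def)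
  have UM: "U \<subseteq> carrier M" using sub unfolding U_def by auto
  have AU: "A \<subseteq> U \<times> U"
  proof
    fix p assume "p \<in> A"
    then have "fst p \<in> U" "snd p \<in> U" unfolding U_def by blast+
    then show "p \<in> U \<times> U" by (simp add: mem_Times_iff)
  qed
  have BU: "B \<subseteq> carrier R \<times> U"
  proof
    fix p assume p: "p \<in> B"
    then have "snd p \<in> U" unfolding U_def by blast
    then show "p \<in> carrier R \<times> U" using p sub(3) by (auto simp: mem_Times_iff)
  qed
  have sU: "a \<oplus>\<^bsub>M\<^esub> b \<in> U" if "(a, b) \<in> A" for a b
    using that unfolding U_def by force
  have mU: "r \<odot>\<^bsub>M\<^esub> a \<in> U" if "(r, a) \<in> B" for r a
    using that unfolding U_def by force
  have sU': "\<forall>(a, b)\<in>A. a \<oplus>\<^bsub>M\<^esub> b \<in> U" and mU': "\<forall>(r, a)\<in>B. r \<odot>\<^bsub>M\<^esub> a \<in> U"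
    using sU mU by auto
  obtain s e C where "splitting R M U A B s e C"
    using *[OF fU UM fin(2,3) AU BU sU' mU'] by (elim exE)
  then have e: "\<And>i. i < s \<Longrightarrow> e i \<in> carrier M"
    and C: "\<And>x i. x \<in> U \<Longrightarrow> i < s \<Longrightarrow> C x i \<in> carrier R"
    and x: "\<And>x. x \<in> U \<Longrightarrow> (\<Oplus>\<^bsub>M\<^esub>i\<in>{..<s}. C x i \<odot>\<^bsub>M\<^esub> e i) = x"
    and A: "\<And>a b i. (a, b) \<in> A \<Longrightarrow> i < s \<Longrightarrow> C (a \<oplus>\<^bsub>M\<^esub> b) i \<odot>\<^bsub>M\<^esub> e i = C a i \<odot>\<^bsub>M\<^esub> e i \<oplus>\<^bsub>M\<^esub> C b i \<odot>\<^bsub>M\<^esub> e i"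
    and B: "\<And>r a i. (r, a) \<in> B \<Longrightarrow> i < s \<Longrightarrow> C (r \<odot>\<^bsub>M\<^esub> a) i \<odot>\<^bsub>M\<^esub> e i = r \<odot>\<^bsub>M\<^esub> (C a i \<odot>\<^bsub>M\<^esub> e i)"
    unfolding splitting_def by auto
  define D where "D = (\<lambda>x i. if x \<in> U then C x i else \<zero>\<^bsub>R\<^esub>)"
  let ?f = "\<lambda>x. if x \<in> carrier M then \<Oplus>\<^bsub>M\<^esub>i\<in>{..<s}. D x i \<odot>\<^bsub>M\<^esub> e i else \<zero>\<^bsub>M\<^esub>"
  have "reachable R M A B ?f"
  proof (rule reachable_coefficients[OF M e _ sub(2) _ sub(3)])
    show "D x i \<in> carrier R" if "i < s" for x i
      using C that by (simp add: D_def)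
    show "D (a \<oplus>\<^bsub>M\<^esub> b) i \<odot>\<^bsub>M\<^esub> e i = D a i \<odot>\<^bsub>M\<^esub> e i \<oplus>\<^bsub>M\<^esub> D b i \<odot>\<^bsub>M\<^esub> e i" if ab: "(a, b) \<in> A" "i < s" for a b i
      using A[OF ab] sU[OF ab(1)] AU ab(1) by (auto simp: D_def)
    show "D (r \<odot>\<^bsub>M\<^esub> a) i \<odot>\<^bsub>M\<^esub> e i = r \<odot>\<^bsub>M\<^esub> (D a i \<odot>\<^bsub>M\<^esub> e i)" if ab: "(r, a) \<in> B" "i < s" for r a i
      using B[OF ab] mU[OF ab(1)] BU ab(1) by (auto simp: D_def)
  qed
  moreover have "\<forall>x \<in> T. ?f x = x"
  proof
    fix y assume y: "y \<in> T"
    then have yU: "y \<in> U" by (simp add: U_def)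
    have "D y = C y" using yU by (simp add: D_def)
    then show "?f y = y" using x[OF yU] y sub(1) by auto
  qed
  ultimately show "\<exists>f. reachable R M A B f \<and> (\<forall>x \<in> T. f x = x)" by (intro exI conjI)
qed

section \<open>Modules over principal ideal domains\<close>

definition lc where
  "lc M c es = (\<Oplus>\<^bsub>M\<^esub>i\<in>{..<length es}. c i \<odot>\<^bsub>M\<^esub> es ! i)"

context module
begin

lemma lc_closed: "\<forall>i. c i \<in> carrier R \<Longrightarrow> set es \<subseteq> carrier M \<Longrightarrow> lc M c es \<in> carrier M"
  unfolding lc_def using subsetD[OF _ nth_mem] by (intro M.finsum_closed funcsetI smult_closed) auto

lemma lc_Nil [simp]: "lc M c [] = \<zero>\<^bsub>M\<^esub>"
  by (simp add: lc_def)

lemma lc_Cons: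
  assumes "\<forall>i. c i \<in> carrier R" "e \<in> carrier M" "set es \<subseteq> carrier M"
  shows "lc M c (e # es) = c 0 \<odot>\<^bsub>M\<^esub> e \<oplus>\<^bsub>M\<^esub> lc M (\<lambda>i. c (Suc i)) es"
proof -
  have "c i \<odot>\<^bsub>M\<^esub> (e # es) ! i \<in> carrier M" if "i < Suc (length es)" for i
    using assms nth_mem[of i "e # es"] that by (intro smult_closed) auto
  then show ?thesis
    unfolding lc_def by (simp add: finsum_lessThan_Suc2[OF M.abelian_group_axioms])
qed

lemma lc_add:
  assumes "\<forall>i. c i \<in> carrier R" "\<forall>i. d i \<in> carrier R" "set es \<subseteq> carrier M"
  shows "lc M (\<lambda>i. c i \<oplus> d i) es = lc M c es \<oplus>\<^bsub>M\<^esub> lc M d es"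
  using assms
proof (induction es arbitrary: c d)
  case (Cons e es)
  have cl: "lc M (\<lambda>i. c (Suc i)) es \<in> carrier M" "lc M (\<lambda>i. d (Suc i)) es \<in> carrier M"
    using Cons.prems by (auto intro!: lc_closed)
  show ?case
    using Cons.prems cl Cons.IH[of "\<lambda>i. c (Suc i)" "\<lambda>i. d (Suc i)"]
    by (simp add: lc_Cons smult_l_distr M.a_ac)
qed simp

lemma lc_smult:
  assumes "r \<in> carrier R" "\<forall>i. c i \<in> carrier R" "set es \<subseteq> carrier M"
  shows "lc M (\<lambda>i. r \<otimes> c i) es = r \<odot>\<^bsub>M\<^esub> lc M c es"
  using assms
proof (induction es arbitrary: c)
  case (Cons e es)
  have cl: "lc M (\<lambda>i. c (Suc i)) es \<in> carrier M"
    using Cons.prems by (auto intro!: lc_closed)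
  show ?case
    using Cons.prems cl Cons.IH[of "\<lambda>i. c (Suc i)"]
    by (simp add: lc_Cons smult_assoc1 smult_r_distr)
qed simp

abbreviation "sp es \<equiv> submodule_generated R M (set es)"

lemma sp_submodule: "set es \<subseteq> carrier M \<Longrightarrow> submodule (sp es) R M"
  by (rule submodule_generated_submodule)

lemma sp_incl: "e \<in> set es \<Longrightarrow> e \<in> sp es"
  using submodule_generated_incl by fast

lemma sp_mono: "set es \<subseteq> sp es' \<Longrightarrow> set es' \<subseteq> carrier M \<Longrightarrow> sp es \<subseteq> sp es'"
  by (rule submodule_generated_minimal[OF sp_submodule])

lemma sp_tail: "set (e # es) \<subseteq> carrier M \<Longrightarrow> sp es \<subseteq> sp (e # es)"
  by (rule sp_mono) (use sp_incl[of _ "e # es"] in auto)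

lemmas sp_neg = submoduleE(3)[OF sp_submodule]
lemmas sp_smult = submoduleE(4)[OF sp_submodule]
lemmas sp_add = submoduleE(5)[OF sp_submodule]

lemma lc_in_sp: "\<forall>i. c i \<in> carrier R \<Longrightarrow> set es \<subseteq> carrier M \<Longrightarrow> lc M c es \<in> sp es"
proof (induction es arbitrary: c)
  case Nil
  show ?case
    using subgroup.one_closed[OF submodule.axioms(1)[OF sp_submodule[of "[]"]]] by simp
next
  case (Cons e es)
  have "sp es \<subseteq> sp (e # es)"
    by (rule sp_tail[OF Cons.prems(2)])
  moreover have "lc M (\<lambda>i. c (Suc i)) es \<in> sp es"
    using Cons by simp
  ultimately have "lc M (\<lambda>i. c (Suc i)) es \<in> sp (e # es)" by blast
  moreover have "c 0 \<odot>\<^bsub>M\<^esub> e \<in> sp (e # es)"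
    using Cons.prems by (intro sp_smult sp_incl) auto
  ultimately have "c 0 \<odot>\<^bsub>M\<^esub> e \<oplus>\<^bsub>M\<^esub> lc M (\<lambda>i. c (Suc i)) es \<in> sp (e # es)"
    by (intro sp_add[OF Cons.prems(2)])
  then show ?case
    using Cons.prems lc_Cons[of c e es] by simp
qed

lemma sp_lc:
  assumes "x \<in> sp es" "set es \<subseteq> carrier M"
  shows "\<exists>c. (\<forall>i. c i \<in> carrier R) \<and> x = lc M c es"
  using assms(2,1)
proof (induction rule: submodule_generated_induct)
  case (incl x)
  then have "x \<in> set es" by simp
  then show ?case
    using assms(2)
  proof (induction es)
    case (Cons e es)
    have z: "lc M (\<lambda>_. \<zero>) es = \<zero>\<^bsub>M\<^esub>" if "set es \<subseteq> carrier M" for es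
      using that by (induction es) (auto simp: lc_Cons)
    show ?case
    proof (cases "x = e")
      case True
      then show ?thesis
        using Cons.prems z[of es]
        by (intro exI[of _ "case_nat \<one> (\<lambda>_. \<zero>)"]) (auto simp: lc_Cons split: nat.split)
    next
      case False
      then obtain c where c: "\<forall>i. c i \<in> carrier R" "x = lc M c es"
        using Cons by auto
      then have "lc M c es \<in> carrier M"
        using Cons.prems by (intro lc_closed) auto
      then show ?thesis
        using Cons.prems c
        by (intro exI[of _ "case_nat \<zero> c"]) (auto simp: lc_Cons split: nat.split)
    qed
  qed simp
next
  case zero
  have "lc M (\<lambda>_. \<zero> \<otimes> \<zero>) es = \<zero> \<odot>\<^bsub>M\<^esub> lc M (\<lambda>_. \<zero>) es"
    by (rule lc_smult) (use assms in auto)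
  then show ?case
    using lc_closed[of "\<lambda>_. \<zero>" es] assms by (intro exI[of _ "\<lambda>_. \<zero>"]) simp
next
  case (add x y)
  then obtain c d where "\<forall>i. c i \<in> carrier R" "x = lc M c es" "\<forall>i. d i \<in> carrier R" "y = lc M d es"
    by blast
  then show ?case
    using assms by (intro exI[of _ "\<lambda>i. c i \<oplus> d i"]) (auto simp: lc_add)
next
  case (smult r x)
  then obtain c where "\<forall>i. c i \<in> carrier R" "x = lc M c es"
    by blast
  then show ?case
    using assms smult by (intro exI[of _ "\<lambda>i. r \<otimes> c i"]) (auto simp: lc_smult)
qed

end

lemma (in principal_domain) bezout:
  assumes "a \<in> carrier R" "b \<in> carrier R"
  obtains g u v p q where "g \<in> carrier R" "u \<in> carrier R" "v \<in> carrier R" "p \<in> carrier R" "q \<in> carrier R"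
    and "a = g \<otimes> p" "b = g \<otimes> q" "u \<otimes> p \<oplus> v \<otimes> q = \<one>"
proof -
  have I: "ideal (PIdl a <+> PIdl b) R"
    by (intro add_ideals cgenideal_ideal assms)
  then obtain g where g: "g \<in> carrier R" "PIdl a <+> PIdl b = PIdl g"
    using exists_gen by blast
  have mem: "x \<in> PIdl g \<longleftrightarrow> (\<exists>u\<in>carrier R. \<exists>v\<in>carrier R. x = u \<otimes> a \<oplus> v \<otimes> b)" for x
  proof -
    have "x \<in> PIdl g \<longleftrightarrow> x \<in> PIdl a <+> PIdl b"
      using g(2) by simp
    also have "\<dots> \<longleftrightarrow> (\<exists>u\<in>carrier R. \<exists>v\<in>carrier R. x = u \<otimes> a \<oplus> v \<otimes> b)"
      unfolding set_add_def' cgenideal_def by blast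
    finally show ?thesis .
  qed
  have "a \<in> PIdl g"
    unfolding mem using assms by (intro bexI[of _ \<one>] bexI[of _ \<zero>]) simp_all
  then obtain p where p: "p \<in> carrier R" "a = g \<otimes> p"
    using g(1) unfolding cgenideal_def by (auto simp: m_comm)
  have "b \<in> PIdl g"
    unfolding mem using assms by (intro bexI[of _ \<zero>] bexI[of _ \<one>]) simp_all
  then obtain q where q: "q \<in> carrier R" "b = g \<otimes> q"
    using g(1) unfolding cgenideal_def by (auto simp: m_comm)
  show ?thesis
  proof (cases "g = \<zero>")
    case True
    then have "a = \<zero> \<otimes> \<one>" "b = \<zero> \<otimes> \<zero>"
      using p q by simp_all
    then show ?thesis
      by (intro that[of \<zero> \<one> \<zero> \<one> \<zero>]) simp_all
  next
    case False
    have "g \<in> PIdl g" using g(1) by (rule cgenideal_self)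
    then obtain u v where uv: "u \<in> carrier R" "v \<in> carrier R" "g = u \<otimes> a \<oplus> v \<otimes> b"
      unfolding mem by blast
    have "g \<otimes> (u \<otimes> p \<oplus> v \<otimes> q) = u \<otimes> (g \<otimes> p) \<oplus> v \<otimes> (g \<otimes> q)"
      using g(1) p(1) q(1) uv(1,2) by (simp add: r_distr m_lcomm)
    also have "\<dots> = g \<otimes> \<one>"
      using uv(3) g(1) unfolding p(2)[symmetric] q(2)[symmetric] by simp
    finally have "u \<otimes> p \<oplus> v \<otimes> q = \<one>"
      using m_lcancel[OF False g(1), of "u \<otimes> p \<oplus> v \<otimes> q" \<one>] p(1) q(1) uv(1,2) by simp
    then show ?thesis
      using that[of g u v p q] g(1) p q uv by blast
  qed
qed

lemma (in principal_domain) maximal_principal_ideal: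
  assumes "G \<subseteq> carrier R" "G \<noteq> {}"
  obtains d where "d \<in> G" "\<And>x. x \<in> G \<Longrightarrow> PIdl d \<subseteq> PIdl x \<Longrightarrow> PIdl x = PIdl d"
proof -
  have "\<exists>I\<in>(\<lambda>x. PIdl x) ` G. \<forall>J\<in>(\<lambda>x. PIdl x) ` G. I \<subseteq> J \<longrightarrow> J = I"
  proof (rule subset_Zorn_nonempty)
    show "(\<lambda>x. PIdl x) ` G \<noteq> {}" using assms(2) by simp
    fix C assume "C \<noteq> {}" and C: "subset.chain ((\<lambda>x. PIdl x) ` G) C"
    then have sub: "C \<subseteq> (\<lambda>x. PIdl x) ` G"
      by (auto simp: subset_chain_def)
    have "C \<subseteq> {I. ideal I R}"
    proof
      fix I assume "I \<in> C"
      then have "I \<in> (\<lambda>x. PIdl x) ` G" by (rule subsetD[OF sub])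
      then obtain x where "x \<in> G" "I = PIdl x" by (elim imageE)
      then show "I \<in> {I. ideal I R}" using assms(1) cgenideal_ideal[of x] by auto
    qed
    then have ch: "subset.chain {I. ideal I R} C"
      using C by (simp add: subset_chain_def)
    show "\<Union>C \<in> (\<lambda>x. PIdl x) ` G"
      using ideal_chain_is_trivial[OF \<open>C \<noteq> {}\<close> ch] sub by (rule rev_subsetD)
  qed
  then obtain d where "d \<in> G" "\<forall>J\<in>(\<lambda>x. PIdl x) ` G. PIdl d \<subseteq> J \<longrightarrow> J = PIdl d"
    by (elim bexE imageE) simp
  then show ?thesis
    by (intro that[of d]) simp_all
qed

locale pid_module = principal_domain R + module R M for R (structure) and M
begin

lemma gcd_generator:
  assumes "\<forall>i. c i \<in> carrier R" "set (e # es) \<subseteq> carrier M"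
  shows "\<exists>d e' es'. d \<in> carrier R \<and> set (e' # es') \<subseteq> carrier M \<and> length es' = length es \<and>
    sp (e' # es') = sp (e # es) \<and> lc M c (e # es) = d \<odot>\<^bsub>M\<^esub> e' \<and> (\<exists>x \<in> carrier R. c 0 = d \<otimes> x)"
  using assms
proof (induction es arbitrary: e c)
  case Nil
  then show ?case
    by (intro exI[of _ "c 0"] exI[of _ e] exI[of _ "[]"] conjI bexI[of _ \<one>]) (auto simp: lc_Cons)
next
  case (Cons e1 es)
  have cs: "\<forall>i. c (Suc i) \<in> carrier R" and c0: "c 0 \<in> carrier R"
    and M1: "set (e1 # es) \<subseteq> carrier M" and eM: "e \<in> carrier M"
    using Cons.prems by auto
  obtain d1 f fs where d1: "d1 \<in> carrier R" and fM: "set (f # fs) \<subseteq> carrier M" and len: "length fs = length es"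
    and spf: "sp (f # fs) = sp (e1 # es)" and lcf: "lc M (\<lambda>i. c (Suc i)) (e1 # es) = d1 \<odot>\<^bsub>M\<^esub> f"
    using Cons.IH[OF cs M1] by blast
  obtain g u v p q where R: "g \<in> carrier R" "u \<in> carrier R" "v \<in> carrier R" "p \<in> carrier R" "q \<in> carrier R"
    and gp: "c 0 = g \<otimes> p" and gq: "d1 = g \<otimes> q" and bz: "u \<otimes> p \<oplus> v \<otimes> q = \<one>"
    using bezout[OF c0 d1] by metis
  define e' where "e' = p \<odot>\<^bsub>M\<^esub> e \<oplus>\<^bsub>M\<^esub> q \<odot>\<^bsub>M\<^esub> f"
  define f' where "f' = u \<odot>\<^bsub>M\<^esub> f \<ominus>\<^bsub>M\<^esub> v \<odot>\<^bsub>M\<^esub> e"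
  have f: "f \<in> carrier M" using fM by simp
  have M': "e' \<in> carrier M" "f' \<in> carrier M"
    using R eM f by (auto simp: e'_def f'_def)
  have e_eq: "e = u \<odot>\<^bsub>M\<^esub> e' \<ominus>\<^bsub>M\<^esub> q \<odot>\<^bsub>M\<^esub> f'"
  proof -
    have "u \<odot>\<^bsub>M\<^esub> e' \<ominus>\<^bsub>M\<^esub> q \<odot>\<^bsub>M\<^esub> f' = (u \<otimes> p) \<odot>\<^bsub>M\<^esub> e \<oplus>\<^bsub>M\<^esub> (v \<otimes> q) \<odot>\<^bsub>M\<^esub> e"
      using R eM f unfolding e'_def f'_def
      by (simp add: smult_r_distr smult_r_minus M.minus_eq M.minus_add smult_assoc1[symmetric]
          m_comm[of q] M.a_ac M.cancel_simps M.r_neg M.minus_minus)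
    also have "\<dots> = e"
      using R eM bz by (simp add: smult_l_distr[symmetric])
    finally show ?thesis by simp
  qed
  have f_eq: "f = v \<odot>\<^bsub>M\<^esub> e' \<oplus>\<^bsub>M\<^esub> p \<odot>\<^bsub>M\<^esub> f'"
  proof -
    have "v \<odot>\<^bsub>M\<^esub> e' \<oplus>\<^bsub>M\<^esub> p \<odot>\<^bsub>M\<^esub> f' = (u \<otimes> p) \<odot>\<^bsub>M\<^esub> f \<oplus>\<^bsub>M\<^esub> (v \<otimes> q) \<odot>\<^bsub>M\<^esub> f"
      using R eM f unfolding e'_def f'_def
      by (simp add: smult_r_distr smult_r_minus M.minus_eq M.minus_add smult_assoc1[symmetric]
          m_comm[of p] M.a_ac M.cancel_simps M.r_neg M.minus_minus)
    also have "\<dots> = f"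
      using R f bz by (simp add: smult_l_distr[symmetric])
    finally show ?thesis by simp
  qed
  have newM: "set (e' # f' # fs) \<subseteq> carrier M" using M' fM by simp
  have oldM: "set (e # e1 # es) \<subseteq> carrier M" using Cons.prems by simp
  have "sp (e1 # es) \<subseteq> sp (e # e1 # es)"
    by (rule sp_tail[OF oldM])
  then have in_old: "f \<in> sp (e # e1 # es)" "set fs \<subseteq> sp (e # e1 # es)"
    using sp_incl[of _ "f # fs"] unfolding spf by auto
  have e_old: "e \<in> sp (e # e1 # es)" by (rule sp_incl) simp
  have "e' \<in> sp (e # e1 # es)" "f' \<in> sp (e # e1 # es)"
    unfolding e'_def f'_def M.minus_eq
    by (intro sp_add[OF oldM] sp_smult[OF oldM] sp_neg[OF oldM] R in_old e_old)+
  then have 1: "sp (e' # f' # fs) \<subseteq> sp (e # e1 # es)"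
    using in_old oldM by (intro sp_mono) auto
  have n: "e' \<in> sp (e' # f' # fs)" "f' \<in> sp (e' # f' # fs)" "set fs \<subseteq> sp (e' # f' # fs)"
    using sp_incl[of _ "e' # f' # fs"] by auto
  have "e \<in> sp (e' # f' # fs)"
    by (subst e_eq, unfold M.minus_eq) (intro sp_add[OF newM] sp_smult[OF newM] sp_neg[OF newM] R n)
  moreover have "f \<in> sp (e' # f' # fs)"
    by (subst f_eq) (intro sp_add[OF newM] sp_smult[OF newM] R n)
  moreover from this n have "sp (f # fs) \<subseteq> sp (e' # f' # fs)"
    using newM by (intro sp_mono) auto
  then have "set (e1 # es) \<subseteq> sp (e' # f' # fs)"
    using sp_incl[of _ "e1 # es"] unfolding spf by blast
  ultimately have 2: "sp (e # e1 # es) \<subseteq> sp (e' # f' # fs)"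
    using newM by (intro sp_mono) auto
  have "lc M c (e # e1 # es) = g \<odot>\<^bsub>M\<^esub> e'"
    using Cons.prems lcf R eM f
    by (simp add: lc_Cons[of c] gp gq e'_def smult_assoc1 smult_r_distr)
  then show ?case
    using R gp newM len 1 2
    by (intro exI[of _ g] exI[of _ e'] exI[of _ "f' # fs"] conjI bexI[of _ p]) auto
qed

text \<open>
  Among all pairs of a generating tuple and a scalar \<open>d\<close> that kills its first member choose one for
  which the ideal \<open>(d)\<close> is maximal; then that member spans a direct summand.
\<close>

lemma cyclic_decomposition:
  "set es \<subseteq> carrier M \<Longrightarrow> \<exists>es'. length es' = length es \<and> set es' \<subseteq> carrier M \<and> sp es' = sp es \<and>
     (\<forall>c. (\<forall>i. c i \<in> carrier R) \<longrightarrow> lc M c es' = \<zero>\<^bsub>M\<^esub> \<longrightarrow> (\<forall>i<length es'. c i \<odot>\<^bsub>M\<^esub> es' ! i = \<zero>\<^bsub>M\<^esub>))"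
proof (induction "length es" arbitrary: es)
  case 0
  then show ?case by (intro exI[of _ "[]"]) auto
next
  case (Suc s)
  define G where "G = {d \<in> carrier R. \<exists>e es1. length es1 = s \<and> set (e # es1) \<subseteq> carrier M \<and>
    sp (e # es1) = sp es \<and> d \<odot>\<^bsub>M\<^esub> e = \<zero>\<^bsub>M\<^esub>}"
  obtain e0 es0 where es: "es = e0 # es0" using Suc.hyps(2) by (cases es) auto
  have "\<zero> \<in> G"
    unfolding G_def using Suc es by (auto intro!: exI[of _ e0] exI[of _ es0])
  then obtain d where d: "d \<in> G" and dmax: "\<And>x. x \<in> G \<Longrightarrow> PIdl d \<subseteq> PIdl x \<Longrightarrow> PIdl x = PIdl d"
    using maximal_principal_ideal[of G] unfolding G_def by blast
  obtain e es1 where dR: "d \<in> carrier R" and len: "length es1 = s" and eM: "set (e # es1) \<subseteq> carrier M"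
    and spe: "sp (e # es1) = sp es" and de: "d \<odot>\<^bsub>M\<^esub> e = \<zero>\<^bsub>M\<^esub>"
    using d unfolding G_def by blast
  have e: "e \<in> carrier M" and es1: "set es1 \<subseteq> carrier M" using eM by auto
  have key: "b \<odot>\<^bsub>M\<^esub> e = \<zero>\<^bsub>M\<^esub>"
    if b: "b \<in> carrier R" and c: "\<forall>i. c i \<in> carrier R" and z: "b \<odot>\<^bsub>M\<^esub> e \<oplus>\<^bsub>M\<^esub> lc M c es1 = \<zero>\<^bsub>M\<^esub>" for b c
  proof -
    obtain g u v p q where R: "g \<in> carrier R" "u \<in> carrier R" "v \<in> carrier R" "p \<in> carrier R" "q \<in> carrier R"
      and gp: "d = g \<otimes> p" and gq: "b = g \<otimes> q" and bz: "u \<otimes> p \<oplus> v \<otimes> q = \<one>"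
      using bezout[OF dR b] by metis
    have g: "g = u \<otimes> d \<oplus> v \<otimes> b"
    proof -
      have "u \<otimes> d \<oplus> v \<otimes> b = g \<otimes> (u \<otimes> p \<oplus> v \<otimes> q)"
        unfolding gp gq using R by (simp add: r_distr m_lcomm)
      then show ?thesis using bz R by simp
    qed
    define c' where "c' = case_nat g (\<lambda>i. v \<otimes> c i)"
    have c': "\<forall>i. c' i \<in> carrier R"
      using R c by (auto simp: c'_def split: nat.split)
    have lcM: "lc M c es1 \<in> carrier M" by (rule lc_closed[OF c es1])
    have "lc M c' (e # es1) = g \<odot>\<^bsub>M\<^esub> e \<oplus>\<^bsub>M\<^esub> v \<odot>\<^bsub>M\<^esub> lc M c es1"
      using lc_Cons[OF c' e es1] lc_smult[OF R(3) c es1] by (simp add: c'_def)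
    also have "g \<odot>\<^bsub>M\<^esub> e = u \<odot>\<^bsub>M\<^esub> (d \<odot>\<^bsub>M\<^esub> e) \<oplus>\<^bsub>M\<^esub> v \<odot>\<^bsub>M\<^esub> (b \<odot>\<^bsub>M\<^esub> e)"
      using R dR b e by (subst g) (simp add: smult_l_distr smult_assoc1)
    also have "\<dots> = v \<odot>\<^bsub>M\<^esub> (b \<odot>\<^bsub>M\<^esub> e)"
      using de R b e by simp
    also have "v \<odot>\<^bsub>M\<^esub> (b \<odot>\<^bsub>M\<^esub> e) \<oplus>\<^bsub>M\<^esub> v \<odot>\<^bsub>M\<^esub> lc M c es1 = \<zero>\<^bsub>M\<^esub>"
      using R b e lcM z by (simp add: smult_r_distr[symmetric])
    finally have lc0: "lc M c' (e # es1) = \<zero>\<^bsub>M\<^esub>" .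
    obtain d2 e2 es2 x where d2: "d2 \<in> carrier R" "set (e2 # es2) \<subseteq> carrier M" "length es2 = length es1"
      "sp (e2 # es2) = sp (e # es1)" "lc M c' (e # es1) = d2 \<odot>\<^bsub>M\<^esub> e2" and x: "x \<in> carrier R" "c' 0 = d2 \<otimes> x"
      using gcd_generator[OF c' eM] by blast
    have "d2 \<in> G"
      unfolding G_def using d2 lc0 len spe by auto
    moreover have gx: "g = d2 \<otimes> x" using x(2) by (simp add: c'_def)
    have "PIdl d \<subseteq> PIdl d2"
    proof -
      have "d = (x \<otimes> p) \<otimes> d2"
        unfolding gp gx using d2(1) x(1) R by (simp add: m_ac)
      then have "d \<in> PIdl d2"
        unfolding cgenideal_def using x(1) R by auto
      then show ?thesis
        by (rule cgenideal_minimal[OF cgenideal_ideal[OF d2(1)]])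
    qed
    ultimately have "PIdl d2 = PIdl d" by (rule dmax)
    then have "d2 \<in> PIdl d" using cgenideal_self[OF d2(1)] by simp
    then obtain y where y: "y \<in> carrier R" "d2 = y \<otimes> d"
      unfolding cgenideal_def by auto
    have "b = (y \<otimes> x \<otimes> q) \<otimes> d"
      unfolding gq gx y(2) using y(1) x(1) R dR by (simp add: m_ac)
    then show ?thesis
      using y(1) x(1) R dR e de by (simp add: smult_assoc1)
  qed
  obtain es2 where len2: "length es2 = length es1" and es2: "set es2 \<subseteq> carrier M" and sp2: "sp es2 = sp es1"
    and ind: "\<And>c i. \<forall>i. c i \<in> carrier R \<Longrightarrow> lc M c es2 = \<zero>\<^bsub>M\<^esub> \<Longrightarrow> i < length es2 \<Longrightarrow> c i \<odot>\<^bsub>M\<^esub> es2 ! i = \<zero>\<^bsub>M\<^esub>"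
    using Suc.hyps(1)[OF len[symmetric] es1] by blast
  have newM: "set (e # es2) \<subseteq> carrier M" using e es2 by simp
  have "sp (e # es2) = sp (e # es1)"
  proof
    have "sp es1 \<subseteq> sp (e # es1)" "sp es2 \<subseteq> sp (e # es2)"
      by (rule sp_tail[OF eM], rule sp_tail[OF newM])
    then have "set es2 \<subseteq> sp (e # es1)" "set es1 \<subseteq> sp (e # es2)"
      using sp_incl[of _ es1] sp_incl[of _ es2] sp2 by blast+
    then show "sp (e # es2) \<subseteq> sp (e # es1)" "sp (e # es1) \<subseteq> sp (e # es2)"
      using sp_incl[of e "e # es1"] sp_incl[of e "e # es2"]
      by (intro sp_mono[OF _ eM] sp_mono[OF _ newM]; simp)+
  qed
  moreover have "c i \<odot>\<^bsub>M\<^esub> (e # es2) ! i = \<zero>\<^bsub>M\<^esub>"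
    if c: "\<forall>i. c i \<in> carrier R" and z: "lc M c (e # es2) = \<zero>\<^bsub>M\<^esub>" and i: "i < length (e # es2)" for c i
  proof -
    have cS: "\<forall>i. c (Suc i) \<in> carrier R" using c by simp
    have z': "c 0 \<odot>\<^bsub>M\<^esub> e \<oplus>\<^bsub>M\<^esub> lc M (\<lambda>i. c (Suc i)) es2 = \<zero>\<^bsub>M\<^esub>"
      using z lc_Cons[OF c e es2] by simp
    have l2: "lc M (\<lambda>i. c (Suc i)) es2 \<in> carrier M" by (rule lc_closed[OF cS es2])
    obtain c2 where c2: "\<forall>i. c2 i \<in> carrier R" "lc M (\<lambda>i. c (Suc i)) es2 = lc M c2 es1"
      using sp_lc[OF _ es1] lc_in_sp[OF cS es2] sp2 by blast
    have "c 0 \<odot>\<^bsub>M\<^esub> e = \<zero>\<^bsub>M\<^esub>"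
      using key[of "c 0" c2] c c2 z' by simp
    moreover from this have "lc M (\<lambda>i. c (Suc i)) es2 = \<zero>\<^bsub>M\<^esub>"
      using z' l2 by simp
    ultimately show ?thesis
      using ind[OF cS] i by (cases i) auto
  qed
  ultimately show ?case
    using newM len2 len Suc.hyps(2) spe by (intro exI[of _ "e # es2"]) auto
qed

lemma locally_split_pid: "locally_split R M"
proof (rule locally_splitI[OF module_axioms])
  fix U A B assume U: "finite U" "U \<subseteq> carrier M" and A: "A \<subseteq> U \<times> U" and B: "B \<subseteq> carrier R \<times> U"
    and AU: "\<forall>(a, b)\<in>A. a \<oplus>\<^bsub>M\<^esub> b \<in> U" and BU: "\<forall>(r, a)\<in>B. r \<odot>\<^bsub>M\<^esub> a \<in> U"
  obtain us where us: "set us = U" using finite_list[OF U(1)] by blast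
  obtain es where es: "set es \<subseteq> carrier M" and sp: "sp es = sp us"
    and ind: "\<And>c i. \<forall>i. c i \<in> carrier R \<Longrightarrow> lc M c es = \<zero>\<^bsub>M\<^esub> \<Longrightarrow> i < length es \<Longrightarrow> c i \<odot>\<^bsub>M\<^esub> es ! i = \<zero>\<^bsub>M\<^esub>"
    using cyclic_decomposition[of us] U(2) us by blast
  have "\<forall>x\<in>U. \<exists>c. (\<forall>i. c i \<in> carrier R) \<and> x = lc M c es"
    using sp_lc[OF _ es] sp sp_incl[of _ us] us by blast
  then obtain C where C: "\<And>x. x \<in> U \<Longrightarrow> \<forall>i. C x i \<in> carrier R" and x: "\<And>x. x \<in> U \<Longrightarrow> lc M (C x) es = x"
    by metis
  have uniq: "c i \<odot>\<^bsub>M\<^esub> es ! i = d i \<odot>\<^bsub>M\<^esub> es ! i"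
    if c: "\<forall>i. c i \<in> carrier R" and d: "\<forall>i. d i \<in> carrier R" and eq: "lc M c es = lc M d es" and i: "i < length es" for c d i
  proof -
    have cd: "\<forall>i. c i \<oplus> \<ominus> \<one> \<otimes> d i \<in> carrier R" using c d by simp
    have ei: "es ! i \<in> carrier M" using es i by auto
    have "lc M (\<lambda>i. c i \<oplus> \<ominus> \<one> \<otimes> d i) es = lc M c es \<oplus>\<^bsub>M\<^esub> \<ominus> \<one> \<odot>\<^bsub>M\<^esub> lc M d es"
      using c d es lc_add[of c "\<lambda>i. \<ominus> \<one> \<otimes> d i" es] lc_smult[of "\<ominus> \<one>" d es] by simp
    also have "\<dots> = \<zero>\<^bsub>M\<^esub>"
      using lc_closed[OF d es] eq by (simp add: uminus_eq_smult[symmetric] M.r_neg)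
    finally have "(c i \<oplus> \<ominus> \<one> \<otimes> d i) \<odot>\<^bsub>M\<^esub> es ! i = \<zero>\<^bsub>M\<^esub>"
      using ind[OF cd _ i] by blast
    then have "c i \<odot>\<^bsub>M\<^esub> es ! i \<ominus>\<^bsub>M\<^esub> d i \<odot>\<^bsub>M\<^esub> es ! i = \<zero>\<^bsub>M\<^esub>"
      using c d ei by (simp add: smult_l_distr smult_assoc1 M.minus_eq uminus_eq_smult)
    then show ?thesis
      using c d ei by (simp add: M.minus_eq_zero_iff)
  qed
  show "\<exists>s e C. splitting R M U A B s e C"
    unfolding splitting_def
  proof (intro exI conjI)
    show "\<forall>i<length es. es ! i \<in> carrier M" using es by auto
    show "\<forall>x\<in>U. \<forall>i<length es. C x i \<in> carrier R" using C by blast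
    show "\<forall>x\<in>U. (\<Oplus>\<^bsub>M\<^esub>i\<in>{..<length es}. C x i \<odot>\<^bsub>M\<^esub> es ! i) = x"
      using x by (simp add: lc_def)
    show "\<forall>(a, b)\<in>A. \<forall>i<length es. C (a \<oplus>\<^bsub>M\<^esub> b) i \<odot>\<^bsub>M\<^esub> es ! i = C a i \<odot>\<^bsub>M\<^esub> es ! i \<oplus>\<^bsub>M\<^esub> C b i \<odot>\<^bsub>M\<^esub> es ! i"
    proof (clarify)
      fix a b i assume ab: "(a, b) \<in> A" and i: "i < length es"
      then have m: "a \<in> U" "b \<in> U" "a \<oplus>\<^bsub>M\<^esub> b \<in> U" using A AU by auto
      have "lc M (C (a \<oplus>\<^bsub>M\<^esub> b)) es = lc M (\<lambda>i. C a i \<oplus> C b i) es"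
        using lc_add[OF C[OF m(1)] C[OF m(2)] es] x m by simp
      then have "C (a \<oplus>\<^bsub>M\<^esub> b) i \<odot>\<^bsub>M\<^esub> es ! i = (C a i \<oplus> C b i) \<odot>\<^bsub>M\<^esub> es ! i"
        using C m i by (intro uniq) auto
      then show "C (a \<oplus>\<^bsub>M\<^esub> b) i \<odot>\<^bsub>M\<^esub> es ! i = C a i \<odot>\<^bsub>M\<^esub> es ! i \<oplus>\<^bsub>M\<^esub> C b i \<odot>\<^bsub>M\<^esub> es ! i"
        using C m es i by (simp add: smult_l_distr subset_iff)
    qed
    show "\<forall>(r, a)\<in>B. \<forall>i<length es. C (r \<odot>\<^bsub>M\<^esub> a) i \<odot>\<^bsub>M\<^esub> es ! i = r \<odot>\<^bsub>M\<^esub> (C a i \<odot>\<^bsub>M\<^esub> es ! i)"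
    proof (clarify)
      fix r a i assume ra: "(r, a) \<in> B" and i: "i < length es"
      then have m: "r \<in> carrier R" "a \<in> U" "r \<odot>\<^bsub>M\<^esub> a \<in> U" using B BU by auto
      have "lc M (C (r \<odot>\<^bsub>M\<^esub> a)) es = lc M (\<lambda>i. r \<otimes> C a i) es"
        using lc_smult[OF m(1) C[OF m(2)] es] x m by simp
      then have "C (r \<odot>\<^bsub>M\<^esub> a) i \<odot>\<^bsub>M\<^esub> es ! i = (r \<otimes> C a i) \<odot>\<^bsub>M\<^esub> es ! i"
        using C m i by (intro uniq) auto
      then show "C (r \<odot>\<^bsub>M\<^esub> a) i \<odot>\<^bsub>M\<^esub> es ! i = r \<odot>\<^bsub>M\<^esub> (C a i \<odot>\<^bsub>M\<^esub> es ! i)"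
        using C m es i by (simp add: smult_assoc1 subset_iff)
    qed
  qed
qed

end

section \<open>Flat modules\<close>

text \<open>
  The submodule \<open>K M\<close> of \<open>M\<^sup>J\<close>, where \<open>K\<close> consists of the solutions \<open>c\<close> of \<open>\<Sum> r\<^sub>j c\<^sub>j = 0\<close> in \<open>R\<^sup>J\<close>.
\<close>

inductive solution_span for R M J r where
  zero: "solution_span R M J r (\<lambda>_. \<zero>\<^bsub>M\<^esub>)"
| add: "solution_span R M J r v \<Longrightarrow> (\<And>j. j \<in> J \<Longrightarrow> c j \<in> carrier R) \<Longrightarrow>
    (\<Oplus>\<^bsub>R\<^esub>j\<in>J. r j \<otimes>\<^bsub>R\<^esub> c j) = \<zero>\<^bsub>R\<^esub> \<Longrightarrow> e \<in> carrier M \<Longrightarrow>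
    solution_span R M J r (\<lambda>j. c j \<odot>\<^bsub>M\<^esub> e \<oplus>\<^bsub>M\<^esub> v j)"
| cong: "solution_span R M J r v \<Longrightarrow> (\<And>j. j \<in> J \<Longrightarrow> w j = v j) \<Longrightarrow> solution_span R M J r w"

context module
begin

lemma solution_span_closed: "solution_span R M J r v \<Longrightarrow> j \<in> J \<Longrightarrow> v j \<in> carrier M"
  by (induction rule: solution_span.induct) auto

lemma solution_span_single:
  assumes "\<And>j. j \<in> J \<Longrightarrow> c j \<in> carrier R" "(\<Oplus>j\<in>J. r j \<otimes> c j) = \<zero>" "e \<in> carrier M"
    "\<And>j. j \<in> J \<Longrightarrow> w j = c j \<odot>\<^bsub>M\<^esub> e"
  shows "solution_span R M J r w"
  by (rule solution_span.cong[OF solution_span.add[OF solution_span.zero assms(1-3)]])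
    (use assms in auto)

lemma solution_span_sum:
  assumes "solution_span R M J r v" "solution_span R M J r w"
  shows "solution_span R M J r (\<lambda>j. v j \<oplus>\<^bsub>M\<^esub> w j)"
  using assms(1)
proof (induction rule: solution_span.induct)
  case zero
  show ?case
    by (rule solution_span.cong[OF assms(2)]) (use solution_span_closed[OF assms(2)] in simp)
next
  case (add v c e)
  show ?case
    by (rule solution_span.cong[OF solution_span.add[OF add.IH add.hyps(2-4)]])
      (use add.hyps solution_span_closed[OF add.hyps(1)] solution_span_closed[OF assms(2)] in \<open>simp_all add: M.a_assoc\<close>)
next
  case (cong v w')
  show ?case
    by (rule solution_span.cong[OF cong.IH]) (simp add: cong.hyps)
qed

lemma solution_span_smult:
  assumes "solution_span R M J r v" "a \<in> carrier R"
  shows "solution_span R M J r (\<lambda>j. a \<odot>\<^bsub>M\<^esub> v j)"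
  using assms(1)
proof (induction rule: solution_span.induct)
  case zero
  show ?case
    by (rule solution_span.cong[OF solution_span.zero]) (use assms in simp)
next
  case (add v c e)
  have ae: "a \<odot>\<^bsub>M\<^esub> e \<in> carrier M" using assms add.hyps by simp
  show ?case
    by (rule solution_span.cong[OF solution_span.add[OF add.IH add.hyps(2,3) ae]])
      (use assms add.hyps solution_span_closed[OF add.hyps(1)] in
        \<open>simp_all add: smult_r_distr smult_assoc1[symmetric] R.m_comm\<close>)
next
  case (cong v w')
  show ?case
    by (rule solution_span.cong[OF cong.IH]) (simp add: cong.hyps)
qed

lemma solution_span_finsum:
  assumes "finite I" "\<And>i. i \<in> I \<Longrightarrow> solution_span R M J r (v i)"
  shows "solution_span R M J r (\<lambda>j. \<Oplus>\<^bsub>M\<^esub>i\<in>I. v i j)"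
  using assms
proof (induction I)
  case empty
  show ?case
    by (rule solution_span.cong[OF solution_span.zero]) simp
next
  case (insert i I)
  have "solution_span R M J r (\<lambda>j. v i j \<oplus>\<^bsub>M\<^esub> (\<Oplus>\<^bsub>M\<^esub>i\<in>I. v i j))"
    using insert by (intro solution_span_sum) auto
  then show ?case
    by (rule solution_span.cong)
      (use insert.hyps solution_span_closed[OF insert.prems] in \<open>auto intro!: M.finsum_insert\<close>)
qed

lemma solution_span_representation:
  assumes "solution_span R M J r v" "\<And>j. j \<in> J \<Longrightarrow> r j \<in> carrier R"
  shows "\<exists>(s::nat) e C. (\<forall>i<s. e i \<in> carrier M) \<and> (\<forall>j\<in>J. \<forall>i<s. C j i \<in> carrier R) \<and>
    (\<forall>j\<in>J. (\<Oplus>\<^bsub>M\<^esub>i\<in>{..<s}. C j i \<odot>\<^bsub>M\<^esub> e i) = v j) \<and> (\<forall>i<s. (\<Oplus>j\<in>J. r j \<otimes> C j i) = \<zero>)"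
  using assms(1)
proof (induction rule: solution_span.induct)
  case zero
  show ?case by (rule exI[of _ 0]) simp
next
  case (add v c e)
  then obtain s :: nat and e' C where IH: "\<forall>i<s. e' i \<in> carrier M" "\<forall>j\<in>J. \<forall>i<s. C j i \<in> carrier R"
    "\<forall>j\<in>J. (\<Oplus>\<^bsub>M\<^esub>i\<in>{..<s}. C j i \<odot>\<^bsub>M\<^esub> e' i) = v j" "\<forall>i<s. (\<Oplus>j\<in>J. r j \<otimes> C j i) = \<zero>"
    by (elim exE conjE) (rule that, assumption+)
  define f where "f = e'(s := e)"
  define D where "D = (\<lambda>j. (C j)(s := c j))"
  have fD: "f i \<in> carrier M" "j \<in> J \<Longrightarrow> D j i \<in> carrier R" if "i < Suc s" for i j
    using that IH add.hyps unfolding f_def D_def by (auto simp: less_Suc_eq)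
  show ?case
  proof (intro exI conjI allI impI ballI)
    show "f i \<in> carrier M" if "i < Suc s" for i using fD that by simp
    show "D j i \<in> carrier R" if "j \<in> J" "i < Suc s" for j i using fD that by simp
    show "(\<Oplus>j\<in>J. r j \<otimes> D j i) = \<zero>" if "i < Suc s" for i
      using that IH add.hyps unfolding D_def by (auto simp: less_Suc_eq)
    fix j assume j: "j \<in> J"
    have "(\<Oplus>\<^bsub>M\<^esub>i\<in>{..<Suc s}. D j i \<odot>\<^bsub>M\<^esub> f i) = D j s \<odot>\<^bsub>M\<^esub> f s \<oplus>\<^bsub>M\<^esub> (\<Oplus>\<^bsub>M\<^esub>i\<in>{..<s}. D j i \<odot>\<^bsub>M\<^esub> f i)"
      by (rule finsum_insert_lessThan[OF M.abelian_monoid_axioms]) (use fD j in simp)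
    also have "(\<Oplus>\<^bsub>M\<^esub>i\<in>{..<s}. D j i \<odot>\<^bsub>M\<^esub> f i) = (\<Oplus>\<^bsub>M\<^esub>i\<in>{..<s}. C j i \<odot>\<^bsub>M\<^esub> e' i)"
      by (rule M.finsum_cong') (use IH j in \<open>auto simp: D_def f_def\<close>)
    finally show "(\<Oplus>\<^bsub>M\<^esub>i\<in>{..<Suc s}. D j i \<odot>\<^bsub>M\<^esub> f i) = c j \<odot>\<^bsub>M\<^esub> e \<oplus>\<^bsub>M\<^esub> v j"
      using IH j by (simp add: D_def f_def)
  qed
next
  case (cong v w)
  then show ?case by (elim exE) (rule exI, rule exI, rule exI, simp)
qed

end

lemma flat_solution_span:
  fixes R :: "('r, 's) ring_scheme" (structure)
  assumes flat: "flat_module TYPE(nat \<Rightarrow> 'r) R M" and J: "finite J"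
    and r: "\<And>j. j \<in> J \<Longrightarrow> r j \<in> carrier R" and m: "\<And>j. j \<in> J \<Longrightarrow> m j \<in> carrier M"
    and rel: "(\<Oplus>\<^bsub>M\<^esub>j\<in>J. r j \<odot>\<^bsub>M\<^esub> m j) = \<zero>\<^bsub>M\<^esub>"
  shows "solution_span R M J r m"
proof -
  have M: "module R M" using flat unfolding flat_module_def by simp
  interpret M: module R M by (rule M)
  define F where "F = free_module R {0::nat}"
  have Fm: "module R F" unfolding F_def by (rule module_free_module[OF M.R.cring_axioms])
  interpret F: module R F by (rule Fm)
  define u where "u = free_gen R (0::nat)"
  have u: "u \<in> carrier F" unfolding F_def u_def by (rule free_gen_closed[OF M.R.cring_axioms]) simp
  have ev: "(\<lambda>a. a 0) \<in> linear_maps R F (ring_module R)"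
    unfolding F_def by (rule linear_mapsI) (auto simp: free_module_carrier free_module_simps)
  have evc: "a 0 \<in> carrier R" if "a \<in> carrier F" for a
    using lin_closed[OF ev that] by simp
  have eva: "(a \<oplus>\<^bsub>F\<^esub> b) 0 = a 0 \<oplus> b 0" and evs: "(x \<odot>\<^bsub>F\<^esub> a) 0 = x \<otimes> a 0" for a b x
    unfolding F_def free_module_simps by simp_all
  define I where "I = {a \<in> carrier F. \<exists>c. (\<forall>j\<in>J. c j \<in> carrier R) \<and> (\<Oplus>j\<in>J. r j \<otimes> c j) = a 0}"
  have lin: "(\<Oplus>j\<in>J. r j \<otimes> (x \<otimes> c j \<oplus> d j)) = x \<otimes> (\<Oplus>j\<in>J. r j \<otimes> c j) \<oplus> (\<Oplus>j\<in>J. r j \<otimes> d j)"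
    if "\<And>j. j \<in> J \<Longrightarrow> c j \<in> carrier R" "\<And>j. j \<in> J \<Longrightarrow> d j \<in> carrier R" "x \<in> carrier R" for c d x
  proof -
    have "(\<Oplus>j\<in>J. r j \<otimes> (x \<otimes> c j \<oplus> d j)) = (\<Oplus>j\<in>J. x \<otimes> (r j \<otimes> c j) \<oplus> r j \<otimes> d j)"
      by (rule M.R.finsum_cong') (use that r in \<open>auto simp: M.R.r_distr M.R.m_lcomm\<close>)
    also have "\<dots> = (\<Oplus>j\<in>J. x \<otimes> (r j \<otimes> c j)) \<oplus> (\<Oplus>j\<in>J. r j \<otimes> d j)"
      by (rule M.R.finsum_addf) (use that r in auto)
    also have "(\<Oplus>j\<in>J. x \<otimes> (r j \<otimes> c j)) = x \<otimes> (\<Oplus>j\<in>J. r j \<otimes> c j)"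
      by (rule M.R.finsum_rdistr[symmetric]) (use that r J in auto)
    finally show ?thesis .
  qed
  have zero: "(\<Oplus>j\<in>J. r j \<otimes> \<zero>) = \<zero>"
    using r by (intro M.R.add.finprod_one_eqI) auto
  have "submodule I R F"
  proof (rule F.submoduleI')
    show "I \<subseteq> carrier F" unfolding I_def by auto
    show "\<zero>\<^bsub>F\<^esub> \<in> I"
      unfolding I_def using zero by (auto simp: F_def free_module_simps free_module_carrier intro!: exI[of _ "\<lambda>_. \<zero>"])
  next
    fix a b assume "a \<in> I" "b \<in> I"
    then obtain c d where c: "a \<in> carrier F" "\<forall>j\<in>J. c j \<in> carrier R" "(\<Oplus>j\<in>J. r j \<otimes> c j) = a 0"
      and d: "b \<in> carrier F" "\<forall>j\<in>J. d j \<in> carrier R" "(\<Oplus>j\<in>J. r j \<otimes> d j) = b 0"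
      unfolding I_def by auto
    show "a \<oplus>\<^bsub>F\<^esub> b \<in> I"
      unfolding I_def using lin[of c d \<one>] c d evc
      by (auto simp: eva intro!: exI[of _ "\<lambda>j. \<one> \<otimes> c j \<oplus> d j"])
  next
    fix x a assume x: "x \<in> carrier R" and "a \<in> I"
    then obtain c where c: "a \<in> carrier F" "\<forall>j\<in>J. c j \<in> carrier R" "(\<Oplus>j\<in>J. r j \<otimes> c j) = a 0"
      unfolding I_def by auto
    show "x \<odot>\<^bsub>F\<^esub> a \<in> I"
      unfolding I_def using lin[of c "\<lambda>_. \<zero>" x] c evc x zero
      by (auto simp: evs intro!: exI[of _ "\<lambda>j. x \<otimes> c j \<oplus> \<zero>"])
  qed
  then interpret I: submodule I R F .
  define A where "A = F\<lparr>carrier := I\<rparr>"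
  have Am: "module R A" unfolding A_def by (rule I.submodule_is_module[OF Fm])
  interpret A: module R A by (rule Am)
  have A_simps: "carrier A = I" "add A = add F" "smult A = smult F" "zero A = zero F"
    by (simp_all add: A_def)
  have IF: "a \<in> carrier F" if "a \<in> I" for a
    using that unfolding I_def by auto
  have incl: "(\<lambda>x. x) \<in> linear_maps R A F"
    by (rule linear_mapsI) (auto simp: A_simps IF)
  have inj: "inj_on (tensor_map R M F id (\<lambda>x. x)) (carrier (tensor_module R M A))"
    by (rule flat[unfolded flat_module_def, THEN conjunct2, rule_format, of A F "\<lambda>x. x"])
      (simp add: Am Fm incl)
  note idl = linear_maps_id[of R M, folded id_def]
  note tm = tensor_map_linear[OF M Am M Fm idl incl]
  define \<rho> where "\<rho> = (\<lambda>j. r j \<odot>\<^bsub>F\<^esub> u)"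
  have \<rho>0: "\<rho> j 0 = r j" if "j \<in> J" for j
    using r[OF that] by (simp add: \<rho>_def evs u_def free_gen_def)
  have delta: "(\<Oplus>i\<in>J. r i \<otimes> (if i = j then \<one> else \<zero>)) = r j" if "j \<in> J" for j
  proof -
    have "(\<Oplus>i\<in>J. r i \<otimes> (if i = j then \<one> else \<zero>)) = (\<Oplus>i\<in>J. if j = i then r i else \<zero>)"
      by (rule M.R.finsum_cong') (use r in auto)
    also have "\<dots> = r j"
      by (rule M.R.finsum_singleton) (use that J r in auto)
    finally show ?thesis .
  qed
  have \<rho>: "\<rho> j \<in> I" if "j \<in> J" for j
    unfolding I_def using delta[OF that] \<rho>0[OF that] r[OF that] u
    by (auto simp: \<rho>_def intro!: exI[of _ "\<lambda>i. if i = j then \<one> else \<zero>"])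
  interpret T: presentation R "carrier M \<times> carrier A" "bilinear_rels R M A"
    by (rule presentation_tensor[OF M Am])
  note TAm = module_tensor_module[OF M Am] and TFm = module_tensor_module[OF M Fm]
  interpret TA: module R "tensor_module R M A" by (rule TAm)
  interpret TF: module R "tensor_module R M F" by (rule TFm)
  define t where "t = (\<Oplus>\<^bsub>tensor_module R M A\<^esub>j\<in>J. pure_tensor R M A (m j) (\<rho> j))"
  have ptA: "pure_tensor R M A (m j) (\<rho> j) \<in> carrier (tensor_module R M A)" if "j \<in> J" for j
    using that m \<rho> by (intro pure_tensor_closed[OF M Am]) (auto simp: A_simps)
  have t: "t \<in> carrier (tensor_module R M A)"
    unfolding t_def using ptA by (intro TA.finsum_closed) auto
  have "tensor_map R M F id (\<lambda>x. x) t =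
      (\<Oplus>\<^bsub>tensor_module R M F\<^esub>j\<in>J. tensor_map R M F id (\<lambda>x. x) (pure_tensor R M A (m j) (\<rho> j)))"
    unfolding t_def by (rule lin_finsum[OF TAm TFm tm(1)]) (use ptA J in auto)
  also have "\<dots> = (\<Oplus>\<^bsub>tensor_module R M F\<^esub>j\<in>J. pure_tensor R M F (r j \<odot>\<^bsub>M\<^esub> m j) u)"
  proof (rule TF.finsum_cong')
    fix j assume j: "j \<in> J"
    have "tensor_map R M F id (\<lambda>x. x) (pure_tensor R M A (m j) (\<rho> j)) = pure_tensor R M F (m j) (\<rho> j)"
      using tm(2)[of "m j" "\<rho> j"] m j \<rho> by (simp add: A_simps)
    then show "tensor_map R M F id (\<lambda>x. x) (pure_tensor R M A (m j) (\<rho> j)) = pure_tensor R M F (r j \<odot>\<^bsub>M\<^esub> m j) u"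
      using lin_smult[OF pure_tensor_linear_right[OF M Fm m[OF j]] r[OF j] u]
        lin_smult[OF pure_tensor_linear_left[OF M Fm u] r[OF j] m[OF j]]
      unfolding \<rho>_def by simp
  qed (use m r u in \<open>auto intro!: pure_tensor_closed[OF M Fm]\<close>)
  also have "\<dots> = pure_tensor R M F (\<Oplus>\<^bsub>M\<^esub>j\<in>J. r j \<odot>\<^bsub>M\<^esub> m j) u"
    by (rule lin_finsum[OF M TFm pure_tensor_linear_left[OF M Fm u], symmetric]) (use m r J in auto)
  also have "\<dots> = \<zero>\<^bsub>tensor_module R M F\<^esub>"
    unfolding rel by (rule lin_zero[OF M TFm pure_tensor_linear_left[OF M Fm u]])
  also have "\<dots> = tensor_map R M F id (\<lambda>x. x) \<zero>\<^bsub>tensor_module R M A\<^esub>"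
    by (rule lin_zero[OF TAm TFm tm(1), symmetric])
  finally have t0: "t = \<zero>\<^bsub>tensor_module R M A\<^esub>"
    using inj t by (auto dest: inj_onD)
  define Z where "Z = (\<Oplus>\<^bsub>T.FM\<^esub>j\<in>J. free_gen R (m j, \<rho> j))"
  have gF: "free_gen R (m j, \<rho> j) \<in> carrier T.FM" if "j \<in> J" for j
    using that m \<rho> by (intro free_gen_closed[OF M.R.cring_axioms]) (auto simp: A_simps)
  have Z: "Z \<in> carrier T.FM"
    unfolding Z_def using gF by (intro T.F.finsum_closed) auto
  have "pres_proj R (carrier M \<times> carrier A) (bilinear_rels R M A) Z = t"
    unfolding Z_def t_def tensor_module_def pure_tensor_def T.pres_proj_gen[symmetric]
    by (rule lin_finsum[OF T.F.module_axioms T.module_pres_module T.pres_proj_linear]) (use gF J in auto)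
  then have Zsub: "Z \<in> submodule_generated R T.FM (bilinear_rels R M A)"
    using T.pres_proj_eq_zero_iff[OF Z] t0 unfolding tensor_module_def by simp
  define \<sigma> where "\<sigma> = (\<lambda>a :: nat \<Rightarrow> 'r. SOME c. (\<forall>j\<in>J. c j \<in> carrier R) \<and> (\<Oplus>j\<in>J. r j \<otimes> c j) = a 0)"
  have \<sigma>: "(\<forall>j\<in>J. \<sigma> a j \<in> carrier R) \<and> (\<Oplus>j\<in>J. r j \<otimes> \<sigma> a j) = a 0" if "a \<in> I" for a
  proof -
    have "\<exists>c. (\<forall>j\<in>J. c j \<in> carrier R) \<and> (\<Oplus>j\<in>J. r j \<otimes> c j) = a 0"
      using that unfolding I_def by simp
    then show ?thesis unfolding \<sigma>_def by (rule someI_ex)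
  qed
  then have \<sigma>c: "\<sigma> a j \<in> carrier R" and \<sigma>s: "(\<Oplus>j\<in>J. r j \<otimes> \<sigma> a j) = a 0" if "a \<in> I" "j \<in> J" for a j
    using that by auto
  define L where "L = (\<lambda>j. free_lift R M (\<lambda>(x, a). \<sigma> a j \<odot>\<^bsub>M\<^esub> x))"
  have Lc: "(\<lambda>(x, a). \<sigma> a j \<odot>\<^bsub>M\<^esub> x) \<in> carrier M \<times> carrier A \<rightarrow> carrier M" if "j \<in> J" for j
    using that \<sigma>c by (auto simp: A_simps)
  have Ll: "L j \<in> linear_maps R T.FM M" if "j \<in> J" for j
    unfolding L_def by (rule free_lift_linear[OF M Lc[OF that]])
  have Lg: "L j (free_gen R (x, a)) = \<sigma> a j \<odot>\<^bsub>M\<^esub> x" if "j \<in> J" "x \<in> carrier M" "a \<in> I" for j x a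
    unfolding L_def using free_lift_gen[OF M Lc[OF that(1)], of "(x, a)"] that by (simp add: A_simps)
  have gc: "free_gen R (x, a) \<in> carrier T.FM" if "x \<in> carrier M" "a \<in> I" for x a
    using that by (intro free_gen_closed[OF M.R.cring_axioms]) (simp add: A_simps)
  have incl_rels: "solution_span R M J r (\<lambda>j. L j \<tau>)" if \<tau>: "\<tau> \<in> bilinear_rels R M A" for \<tau>
  proof -
    show ?thesis
      using \<tau> unfolding bilinear_rels_def Let_def A_simps(2,3)
    proof (elim UnE CollectE exE conjE, goal_cases)
      case (1 x x' a)
      have "L j \<tau> = \<zero>\<^bsub>M\<^esub>" if j: "j \<in> J" for j
        unfolding 1(1) L_def
        by (rule T.free_lift_add_rel[OF M Lc[OF j]]) (use 1 \<sigma>c j in \<open>auto simp: A_simps M.smult_r_distr\<close>)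
      then show ?case by (rule solution_span.cong[OF solution_span.zero])
    next
      case (3 s x a)
      have "L j \<tau> = \<zero>\<^bsub>M\<^esub>" if j: "j \<in> J" for j
        unfolding 3(1) L_def
        by (rule T.free_lift_smult_rel[OF M Lc[OF j]])
          (use 3 \<sigma>c j in \<open>auto simp: A_simps M.smult_assoc1[symmetric] M.R.m_comm\<close>)
      then show ?case by (rule solution_span.cong[OF solution_span.zero])
    next
      case (2 x a a')
      note aI = 2(3,4)[unfolded A_simps(1)]
      have s: "a \<oplus>\<^bsub>F\<^esub> a' \<in> I" using A.a_closed[of a a'] 2 by (simp add: A_simps)
      let ?c = "\<lambda>j. \<ominus> \<one> \<otimes> (\<one> \<otimes> \<sigma> a j \<oplus> \<sigma> a' j) \<oplus> \<sigma> (a \<oplus>\<^bsub>F\<^esub> a') j"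
      have c1: "(\<Oplus>j\<in>J. r j \<otimes> (\<one> \<otimes> \<sigma> a j \<oplus> \<sigma> a' j)) = \<one> \<otimes> a 0 \<oplus> a' 0"
        using lin[of "\<sigma> a" "\<sigma> a'" \<one>] \<sigma>[OF aI(1)] \<sigma>[OF aI(2)] by simp
      have c2: "(\<Oplus>j\<in>J. r j \<otimes> ?c j) = \<ominus> \<one> \<otimes> (\<one> \<otimes> a 0 \<oplus> a' 0) \<oplus> (a 0 \<oplus> a' 0)"
        using lin[of "\<lambda>j. \<one> \<otimes> \<sigma> a j \<oplus> \<sigma> a' j" "\<sigma> (a \<oplus>\<^bsub>F\<^esub> a')" "\<ominus> \<one>"] \<sigma>[OF aI(1)] \<sigma>[OF aI(2)] \<sigma>[OF s]
        unfolding c1 by (simp add: eva)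
      have c3: "(\<Oplus>j\<in>J. r j \<otimes> ?c j) = \<zero>"
        unfolding c2 using evc IF aI by (simp add: M.R.l_minus M.R.l_neg)
      show ?case
      proof (rule M.solution_span_single[OF _ c3 2(2)])
        fix j assume j: "j \<in> J"
        note sc = \<sigma>c[OF aI(1) j] \<sigma>c[OF aI(2) j] \<sigma>c[OF s j]
        show "?c j \<in> carrier R" using sc by simp
        have "L j \<tau> = \<sigma> (a \<oplus>\<^bsub>F\<^esub> a') j \<odot>\<^bsub>M\<^esub> x \<ominus>\<^bsub>M\<^esub> (\<sigma> a j \<odot>\<^bsub>M\<^esub> x \<oplus>\<^bsub>M\<^esub> \<sigma> a' j \<odot>\<^bsub>M\<^esub> x)"
          unfolding 2(1)
          using lin_minus[OF T.F.module_axioms M Ll[OF j] gc[OF 2(2) s] T.F.a_closed[OF gc[OF 2(2) aI(1)] gc[OF 2(2) aI(2)]]]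
            lin_add[OF Ll[OF j] gc[OF 2(2) aI(1)] gc[OF 2(2) aI(2)]] Lg[OF j 2(2)] aI s by simp
        also have "\<dots> = ?c j \<odot>\<^bsub>M\<^esub> x"
          using sc 2(2) by (simp add: M.smult_l_distr M.smult_assoc1 M.uminus_eq_smult[symmetric]
              M.M.minus_eq M.M.a_comm M.smult_l_minus M.R.l_minus)
        finally show "L j \<tau> = ?c j \<odot>\<^bsub>M\<^esub> x" .
      qed
    next
      case (4 s x a)
      note aI = 4(4)[unfolded A_simps(1)]
      have s: "s \<odot>\<^bsub>F\<^esub> a \<in> I" using A.smult_closed[of s a] 4 by (simp add: A_simps)
      let ?c = "\<lambda>j. \<ominus> s \<otimes> \<sigma> a j \<oplus> \<sigma> (s \<odot>\<^bsub>F\<^esub> a) j"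
      have c2: "(\<Oplus>j\<in>J. r j \<otimes> ?c j) = \<ominus> s \<otimes> a 0 \<oplus> s \<otimes> a 0"
        using lin[of "\<sigma> a" "\<sigma> (s \<odot>\<^bsub>F\<^esub> a)" "\<ominus> s"] \<sigma>[OF aI] \<sigma>[OF s] 4(2) by (simp add: evs)
      have c3: "(\<Oplus>j\<in>J. r j \<otimes> ?c j) = \<zero>"
        unfolding c2 using evc IF aI 4 by (simp add: M.R.l_minus M.R.l_neg)
      show ?case
      proof (rule M.solution_span_single[OF _ c3 4(3)])
        fix j assume j: "j \<in> J"
        note sc = \<sigma>c[OF aI j] \<sigma>c[OF s j]
        show "?c j \<in> carrier R" using sc 4 by simp
        have "L j \<tau> = \<sigma> (s \<odot>\<^bsub>F\<^esub> a) j \<odot>\<^bsub>M\<^esub> x \<ominus>\<^bsub>M\<^esub> s \<odot>\<^bsub>M\<^esub> (\<sigma> a j \<odot>\<^bsub>M\<^esub> x)"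
          unfolding 4(1)
          using lin_minus[OF T.F.module_axioms M Ll[OF j] gc[OF 4(3) s] T.F.smult_closed[OF 4(2) gc[OF 4(3) aI]]]
            lin_smult[OF Ll[OF j] 4(2) gc[OF 4(3) aI]] Lg[OF j 4(3)] aI s by simp
        also have "\<dots> = ?c j \<odot>\<^bsub>M\<^esub> x"
          using sc 4(2,3) by (simp add: M.smult_l_distr M.smult_assoc1 M.smult_l_minus M.M.minus_eq
              M.M.a_comm M.R.l_minus)
        finally show "L j \<tau> = ?c j \<odot>\<^bsub>M\<^esub> x" .
      qed
    qed
  qed
  have LZ: "solution_span R M J r (\<lambda>j. L j Z)"
    using T.rels_closed Zsub
  proof (induction rule: T.F.submodule_generated_induct)
    case (incl \<tau>)
    then show ?case by (rule incl_rels)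
  next
    case zero
    show ?case
      by (rule solution_span.cong[OF solution_span.zero]) (rule lin_zero[OF T.F.module_axioms M Ll])
  next
    case (add X Y)
    show ?case
      by (rule solution_span.cong[OF M.solution_span_sum[OF add(3,4)]]) (rule lin_add[OF Ll add(1,2)])
  next
    case (smult s X)
    show ?case
      by (rule solution_span.cong[OF M.solution_span_smult[OF smult(3,1)]]) (rule lin_smult[OF Ll smult(1,2)])
  qed
  define \<delta> where "\<delta> = (\<lambda>i j. \<ominus> \<one> \<otimes> \<sigma> (\<rho> i) j \<oplus> (if j = i then \<one> else \<zero>))"
  have \<delta>c: "\<delta> i j \<in> carrier R" if "i \<in> J" "j \<in> J" for i j
    using \<sigma>c[OF \<rho>[OF that(1)] that(2)] by (simp add: \<delta>_def)
  have \<delta>s: "solution_span R M J r (\<lambda>j. \<delta> i j \<odot>\<^bsub>M\<^esub> m i)" if i: "i \<in> J" for i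
  proof (rule M.solution_span_single[OF \<delta>c[OF i] _ m[OF i]])
    have "(\<Oplus>j\<in>J. r j \<otimes> \<delta> i j) = \<ominus> \<one> \<otimes> r i \<oplus> r i"
      unfolding \<delta>_def using lin[of "\<sigma> (\<rho> i)" "\<lambda>j. if j = i then \<one> else \<zero>" "\<ominus> \<one>"] \<sigma>[OF \<rho>[OF i]] delta[OF i] \<rho>0[OF i] by simp
    then show "(\<Oplus>j\<in>J. r j \<otimes> \<delta> i j) = \<zero>"
      using r[OF i] by (simp add: M.R.l_minus M.R.l_neg)
  qed simp_all
  have "solution_span R M J r (\<lambda>j. L j Z \<oplus>\<^bsub>M\<^esub> (\<Oplus>\<^bsub>M\<^esub>i\<in>J. \<delta> i j \<odot>\<^bsub>M\<^esub> m i))"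
    by (intro M.solution_span_sum LZ M.solution_span_finsum J \<delta>s)
  then show ?thesis
  proof (rule solution_span.cong)
    fix j assume j: "j \<in> J"
    have sc: "\<sigma> (\<rho> i) j \<odot>\<^bsub>M\<^esub> m i \<in> carrier M" if "i \<in> J" for i
      using \<sigma>c[OF \<rho>[OF that] j] m[OF that] by simp
    have dc: "\<delta> i j \<odot>\<^bsub>M\<^esub> m i \<in> carrier M" if "i \<in> J" for i
      using \<delta>c[OF that j] m[OF that] by simp
    have "L j Z = (\<Oplus>\<^bsub>M\<^esub>i\<in>J. L j (free_gen R (m i, \<rho> i)))"
      unfolding Z_def by (rule lin_finsum[OF T.F.module_axioms M Ll[OF j]]) (use gF J in auto)
    also have "\<dots> = (\<Oplus>\<^bsub>M\<^esub>i\<in>J. \<sigma> (\<rho> i) j \<odot>\<^bsub>M\<^esub> m i)"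
      by (rule M.M.finsum_cong') (use sc Lg[OF j m \<rho>] in auto)
    finally have "L j Z \<oplus>\<^bsub>M\<^esub> (\<Oplus>\<^bsub>M\<^esub>i\<in>J. \<delta> i j \<odot>\<^bsub>M\<^esub> m i) =
        (\<Oplus>\<^bsub>M\<^esub>i\<in>J. \<sigma> (\<rho> i) j \<odot>\<^bsub>M\<^esub> m i \<oplus>\<^bsub>M\<^esub> \<delta> i j \<odot>\<^bsub>M\<^esub> m i)"
      using sc dc by (subst M.M.finsum_addf) auto
    also have "\<dots> = (\<Oplus>\<^bsub>M\<^esub>i\<in>J. if j = i then m i else \<zero>\<^bsub>M\<^esub>)"
    proof (rule M.M.finsum_cong')
      fix i assume i: "i \<in> J"
      have "\<sigma> (\<rho> i) j \<oplus> \<delta> i j = (if j = i then \<one> else \<zero>)"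
        using \<sigma>c[OF \<rho>[OF i] j] by (simp add: \<delta>_def M.R.l_minus M.cancel_simps M.R.a_assoc[symmetric] M.R.r_neg)
      then have "(\<sigma> (\<rho> i) j \<oplus> \<delta> i j) \<odot>\<^bsub>M\<^esub> m i = (if j = i then m i else \<zero>\<^bsub>M\<^esub>)"
        using m[OF i] by simp
      then show "\<sigma> (\<rho> i) j \<odot>\<^bsub>M\<^esub> m i \<oplus>\<^bsub>M\<^esub> \<delta> i j \<odot>\<^bsub>M\<^esub> m i = (if j = i then m i else \<zero>\<^bsub>M\<^esub>)"
        using M.smult_l_distr[OF \<sigma>c[OF \<rho>[OF i] j] \<delta>c[OF i j] m[OF i]] by simp
    qed (use m in auto)
    also have "\<dots> = m j"
      by (rule M.M.finsum_singleton) (use j J m in auto)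
    finally show "m j = L j Z \<oplus>\<^bsub>M\<^esub> (\<Oplus>\<^bsub>M\<^esub>i\<in>J. \<delta> i j \<odot>\<^bsub>M\<^esub> m i)" by simp
  qed
qed

definition factorization where
  "factorization R M J m Q (s::nat) e C \<longleftrightarrow> (\<forall>i<s. e i \<in> carrier M) \<and> (\<forall>j\<in>J. \<forall>i<s. C j i \<in> carrier R) \<and>
     (\<forall>j\<in>J. (\<Oplus>\<^bsub>M\<^esub>i\<in>{..<s}. C j i \<odot>\<^bsub>M\<^esub> e i) = m j) \<and>
     (\<forall>q\<in>Q. \<forall>i<s. (\<Oplus>\<^bsub>R\<^esub>j\<in>J. q j \<otimes>\<^bsub>R\<^esub> C j i) = \<zero>\<^bsub>R\<^esub>)"

lemma flat_factorization_single:
  fixes R :: "('r, 's) ring_scheme" (structure)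
  assumes flat: "flat_module TYPE(nat \<Rightarrow> 'r) R M" and J: "finite J"
    and r: "\<And>j. j \<in> J \<Longrightarrow> r j \<in> carrier R" and m: "\<And>j. j \<in> J \<Longrightarrow> m j \<in> carrier M"
    and rel: "(\<Oplus>\<^bsub>M\<^esub>j\<in>J. r j \<odot>\<^bsub>M\<^esub> m j) = \<zero>\<^bsub>M\<^esub>"
  shows "\<exists>s e C. factorization R M J m {r} s e C"
proof -
  have "module R M" using flat unfolding flat_module_def by simp
  then interpret M: module R M .
  show ?thesis
    using M.solution_span_representation[OF flat_solution_span[OF flat J r m rel] r]
    unfolding factorization_def by simp
qed

lemma flat_factorization:
  fixes R :: "('r, 's) ring_scheme" (structure)
  assumes flat: "flat_module TYPE(nat \<Rightarrow> 'r) R M" and J: "finite J"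
    and m: "\<And>j. j \<in> J \<Longrightarrow> m j \<in> carrier M" and Q: "finite Q"
    and q: "\<And>q j. q \<in> Q \<Longrightarrow> j \<in> J \<Longrightarrow> q j \<in> carrier R"
    and rel: "\<And>q. q \<in> Q \<Longrightarrow> (\<Oplus>\<^bsub>M\<^esub>j\<in>J. q j \<odot>\<^bsub>M\<^esub> m j) = \<zero>\<^bsub>M\<^esub>"
  shows "\<exists>s e C. factorization R M J m Q s e C"
  using Q q rel
proof (induction Q rule: finite_induct)
  case empty
  have "module R M" using flat unfolding flat_module_def by simp
  then interpret M: module R M .
  have "(\<Oplus>\<^bsub>M\<^esub>j\<in>J. \<zero> \<odot>\<^bsub>M\<^esub> m j) = \<zero>\<^bsub>M\<^esub>"
    using m by (intro M.M.add.finprod_one_eqI) auto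
  then have "\<exists>s e C. factorization R M J m {\<lambda>_. \<zero>} s e C"
    by (intro flat_factorization_single[OF flat J _ m]) simp_all
  then obtain s e C where "factorization R M J m {\<lambda>_. \<zero>} s e C"
    by (elim exE)
  then have "factorization R M J m {} s e C"
    unfolding factorization_def by simp
  then show ?case by (intro exI)
next
  case (insert r Q)
  have "module R M" using flat unfolding flat_module_def by simp
  then interpret M: module R M .
  have r: "r j \<in> carrier R" if "j \<in> J" for j using insert.prems(1)[of r j] that by simp
  have qQ: "p j \<in> carrier R" if "p \<in> insert r Q" "j \<in> J" for p j using insert.prems(1)[OF that] .
  have "\<exists>s e C. factorization R M J m Q s e C"
    by (rule insert.IH) (use insert.prems in auto)
  then obtain s e C where IH: "factorization R M J m Q s e C" by (elim exE)
  have e: "e i \<in> carrier M" if "i < s" for i using IH that unfolding factorization_def by simp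
  have C: "C j i \<in> carrier R" if "j \<in> J" "i < s" for j i using IH that unfolding factorization_def by simp
  have mC: "(\<Oplus>\<^bsub>M\<^esub>i\<in>{..<s}. C j i \<odot>\<^bsub>M\<^esub> e i) = m j" if "j \<in> J" for j
    using IH that unfolding factorization_def by simp
  have QC: "(\<Oplus>j\<in>J. p j \<otimes> C j i) = \<zero>" if "p \<in> Q" "i < s" for p i
    using IH that unfolding factorization_def by simp
  define r' where "r' = (\<lambda>i. \<Oplus>j\<in>J. r j \<otimes> C j i)"
  have r': "r' i \<in> carrier R" if "i < s" for i
    unfolding r'_def using r C that by (intro M.R.finsum_closed) auto
  have "(\<Oplus>\<^bsub>M\<^esub>i\<in>{..<s}. r' i \<odot>\<^bsub>M\<^esub> e i) = (\<Oplus>\<^bsub>M\<^esub>i\<in>{..<s}. \<Oplus>\<^bsub>M\<^esub>j\<in>J. r j \<odot>\<^bsub>M\<^esub> (C j i \<odot>\<^bsub>M\<^esub> e i))"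
  proof (rule M.M.finsum_cong')
    fix i assume "i \<in> {..<s}"
    then have i: "i < s" by simp
    have "r' i \<odot>\<^bsub>M\<^esub> e i = (\<Oplus>\<^bsub>M\<^esub>j\<in>J. (r j \<otimes> C j i) \<odot>\<^bsub>M\<^esub> e i)"
      unfolding r'_def by (rule M.finsum_smult_rdistr) (use J r C i e in auto)
    also have "\<dots> = (\<Oplus>\<^bsub>M\<^esub>j\<in>J. r j \<odot>\<^bsub>M\<^esub> (C j i \<odot>\<^bsub>M\<^esub> e i))"
      by (rule M.M.finsum_cong') (use r C i e in \<open>auto simp: M.smult_assoc1\<close>)
    finally show "r' i \<odot>\<^bsub>M\<^esub> e i = (\<Oplus>\<^bsub>M\<^esub>j\<in>J. r j \<odot>\<^bsub>M\<^esub> (C j i \<odot>\<^bsub>M\<^esub> e i))" .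
  qed (use r C e in \<open>auto intro!: M.M.finsum_closed\<close>)
  also have "\<dots> = (\<Oplus>\<^bsub>M\<^esub>j\<in>J. \<Oplus>\<^bsub>M\<^esub>i\<in>{..<s}. r j \<odot>\<^bsub>M\<^esub> (C j i \<odot>\<^bsub>M\<^esub> e i))"
    by (rule M.M.finsum_swap) (use J r C e in auto)
  also have "\<dots> = (\<Oplus>\<^bsub>M\<^esub>j\<in>J. r j \<odot>\<^bsub>M\<^esub> m j)"
  proof (rule M.M.finsum_cong')
    fix j assume j: "j \<in> J"
    have "(\<Oplus>\<^bsub>M\<^esub>i\<in>{..<s}. r j \<odot>\<^bsub>M\<^esub> (C j i \<odot>\<^bsub>M\<^esub> e i)) = r j \<odot>\<^bsub>M\<^esub> (\<Oplus>\<^bsub>M\<^esub>i\<in>{..<s}. C j i \<odot>\<^bsub>M\<^esub> e i)"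
      by (rule M.finsum_smult_ldistr[symmetric]) (use j r C e in auto)
    then show "(\<Oplus>\<^bsub>M\<^esub>i\<in>{..<s}. r j \<odot>\<^bsub>M\<^esub> (C j i \<odot>\<^bsub>M\<^esub> e i)) = r j \<odot>\<^bsub>M\<^esub> m j"
      using mC[OF j] by simp
  qed (use r m in auto)
  also have "\<dots> = \<zero>\<^bsub>M\<^esub>"
    by (rule insert.prems(2)) simp
  finally have "\<exists>s' f D. factorization R M {..<s} e {r'} s' f D"
    by (intro flat_factorization_single[OF flat]) (use r' e in auto)
  then obtain s' f D where fD: "factorization R M {..<s} e {r'} s' f D" by (elim exE)
  have f: "f l \<in> carrier M" if "l < s'" for l using fD that unfolding factorization_def by simp
  have D: "D i l \<in> carrier R" if "i < s" "l < s'" for i l using fD that unfolding factorization_def by simp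
  have eD: "(\<Oplus>\<^bsub>M\<^esub>l\<in>{..<s'}. D i l \<odot>\<^bsub>M\<^esub> f l) = e i" if "i < s" for i
    using fD that unfolding factorization_def by simp
  have rD: "(\<Oplus>i\<in>{..<s}. r' i \<otimes> D i l) = \<zero>" if "l < s'" for l
    using fD that unfolding factorization_def by simp
  define C' where "C' = (\<lambda>j l. \<Oplus>i\<in>{..<s}. C j i \<otimes> D i l)"
  have C': "C' j l \<in> carrier R" if "j \<in> J" "l < s'" for j l
    unfolding C'_def using C D that by (intro M.R.finsum_closed) auto
  have "factorization R M J m (insert r Q) s' f C'"
    unfolding factorization_def
  proof (intro conjI allI impI ballI f C')
    fix j assume j: "j \<in> J"
    have "(\<Oplus>\<^bsub>M\<^esub>l\<in>{..<s'}. C' j l \<odot>\<^bsub>M\<^esub> f l) = (\<Oplus>\<^bsub>M\<^esub>l\<in>{..<s'}. \<Oplus>\<^bsub>M\<^esub>i\<in>{..<s}. C j i \<odot>\<^bsub>M\<^esub> (D i l \<odot>\<^bsub>M\<^esub> f l))"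
    proof (rule M.M.finsum_cong')
      fix l assume "l \<in> {..<s'}"
      then have l: "l < s'" by simp
      have "C' j l \<odot>\<^bsub>M\<^esub> f l = (\<Oplus>\<^bsub>M\<^esub>i\<in>{..<s}. (C j i \<otimes> D i l) \<odot>\<^bsub>M\<^esub> f l)"
        unfolding C'_def by (rule M.finsum_smult_rdistr) (use C D f j l in auto)
      also have "\<dots> = (\<Oplus>\<^bsub>M\<^esub>i\<in>{..<s}. C j i \<odot>\<^bsub>M\<^esub> (D i l \<odot>\<^bsub>M\<^esub> f l))"
        by (rule M.M.finsum_cong') (use C D f j l in \<open>auto simp: M.smult_assoc1\<close>)
      finally show "C' j l \<odot>\<^bsub>M\<^esub> f l = (\<Oplus>\<^bsub>M\<^esub>i\<in>{..<s}. C j i \<odot>\<^bsub>M\<^esub> (D i l \<odot>\<^bsub>M\<^esub> f l))" .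
    qed (use C D f j in \<open>auto intro!: M.M.finsum_closed\<close>)
    also have "\<dots> = (\<Oplus>\<^bsub>M\<^esub>i\<in>{..<s}. \<Oplus>\<^bsub>M\<^esub>l\<in>{..<s'}. C j i \<odot>\<^bsub>M\<^esub> (D i l \<odot>\<^bsub>M\<^esub> f l))"
      by (rule M.M.finsum_swap) (use C D f j in auto)
    also have "\<dots> = (\<Oplus>\<^bsub>M\<^esub>i\<in>{..<s}. C j i \<odot>\<^bsub>M\<^esub> e i)"
    proof (rule M.M.finsum_cong')
      fix i assume "i \<in> {..<s}"
      then have i: "i < s" by simp
      have "(\<Oplus>\<^bsub>M\<^esub>l\<in>{..<s'}. C j i \<odot>\<^bsub>M\<^esub> (D i l \<odot>\<^bsub>M\<^esub> f l)) = C j i \<odot>\<^bsub>M\<^esub> (\<Oplus>\<^bsub>M\<^esub>l\<in>{..<s'}. D i l \<odot>\<^bsub>M\<^esub> f l)"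
        by (rule M.finsum_smult_ldistr[symmetric]) (use C D f i j in auto)
      then show "(\<Oplus>\<^bsub>M\<^esub>l\<in>{..<s'}. C j i \<odot>\<^bsub>M\<^esub> (D i l \<odot>\<^bsub>M\<^esub> f l)) = C j i \<odot>\<^bsub>M\<^esub> e i"
        using eD[OF i] by simp
    qed (use C e j in auto)
    finally show "(\<Oplus>\<^bsub>M\<^esub>l\<in>{..<s'}. C' j l \<odot>\<^bsub>M\<^esub> f l) = m j"
      using mC[OF j] by simp
  next
    fix p l assume p: "p \<in> insert r Q" and l: "l < s'"
    have "(\<Oplus>j\<in>J. p j \<otimes> C' j l) = (\<Oplus>j\<in>J. \<Oplus>i\<in>{..<s}. p j \<otimes> C j i \<otimes> D i l)"
    proof (rule M.R.finsum_cong')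
      fix j assume j: "j \<in> J"
      have "p j \<otimes> C' j l = (\<Oplus>i\<in>{..<s}. p j \<otimes> (C j i \<otimes> D i l))"
        unfolding C'_def by (rule M.R.finsum_rdistr) (use C D j l qQ[OF p] in auto)
      also have "\<dots> = (\<Oplus>i\<in>{..<s}. p j \<otimes> C j i \<otimes> D i l)"
        by (rule M.R.finsum_cong') (use C D j l qQ[OF p] in \<open>auto simp: M.R.m_assoc\<close>)
      finally show "p j \<otimes> C' j l = (\<Oplus>i\<in>{..<s}. p j \<otimes> C j i \<otimes> D i l)" .
    qed (use C D l qQ[OF p] in \<open>auto intro!: M.R.finsum_closed\<close>)
    also have "\<dots> = (\<Oplus>i\<in>{..<s}. \<Oplus>j\<in>J. p j \<otimes> C j i \<otimes> D i l)"
      by (rule M.R.finsum_swap) (use C D l J qQ[OF p] in auto)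
    also have "\<dots> = (\<Oplus>i\<in>{..<s}. (\<Oplus>j\<in>J. p j \<otimes> C j i) \<otimes> D i l)"
    proof (rule M.R.finsum_cong')
      fix i assume i: "i \<in> {..<s}"
      show "(\<Oplus>j\<in>J. p j \<otimes> C j i \<otimes> D i l) = (\<Oplus>j\<in>J. p j \<otimes> C j i) \<otimes> D i l"
        by (rule M.R.finsum_ldistr[symmetric]) (use C D l J i qQ[OF p] in auto)
    qed (use C D l qQ[OF p] in \<open>auto intro!: M.R.finsum_closed M.R.m_closed\<close>)
    also have "\<dots> = \<zero>"
    proof (cases "p = r")
      case True
      then show ?thesis using rD[OF l] by (simp add: r'_def)
    next
      case False
      then have "p \<in> Q" using p by simp
      then show ?thesis
        using QC D l by (intro M.R.add.finprod_one_eqI) auto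
    qed
    finally show "(\<Oplus>j\<in>J. p j \<otimes> C' j l) = \<zero>" .
  qed
  then show ?case by (intro exI)
qed

lemma locally_split_flat:
  fixes R :: "('r, 's) ring_scheme" (structure)
  assumes flat: "flat_module TYPE(nat \<Rightarrow> 'r) R M"
  shows "locally_split R M"
proof -
  have M: "module R M" using flat unfolding flat_module_def by simp
  interpret M: module R M by (rule M)
  note cr = M.R.cring_axioms
  have N: "module R (ring_module R)" by (rule module_ring_module[OF cr])
  interpret N: module R "ring_module R" by (rule N)
  show ?thesis
  proof (rule locally_splitI[OF M])
    fix U A B assume U: "finite U" "U \<subseteq> carrier M" and fin: "finite A" "finite B"
      and A: "A \<subseteq> U \<times> U" and B: "B \<subseteq> carrier R \<times> U"
      and AU: "\<forall>(a, b)\<in>A. a \<oplus>\<^bsub>M\<^esub> b \<in> U" and BU: "\<forall>(r, a)\<in>B. r \<odot>\<^bsub>M\<^esub> a \<in> U"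
    interpret P: presentation R U "{}" by unfold_locales simp
    note g = free_gen_closed[OF cr, of _ U]
    define qa where "qa = (\<lambda>(a, b). free_gen R (a \<oplus>\<^bsub>M\<^esub> b) \<ominus>\<^bsub>P.FM\<^esub> (free_gen R a \<oplus>\<^bsub>P.FM\<^esub> free_gen R b))"
    define qb where "qb = (\<lambda>(r, a). free_gen R (r \<odot>\<^bsub>M\<^esub> a) \<ominus>\<^bsub>P.FM\<^esub> r \<odot>\<^bsub>P.FM\<^esub> free_gen R a)"
    have Am: "a \<in> U" "b \<in> U" "a \<oplus>\<^bsub>M\<^esub> b \<in> U" if "(a, b) \<in> A" for a b using that A AU by auto
    have Bm: "r \<in> carrier R" "a \<in> U" "r \<odot>\<^bsub>M\<^esub> a \<in> U" if "(r, a) \<in> B" for r a using that B BU by auto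
    have qaF: "qa p \<in> carrier P.FM" if "p \<in> A" for p
      using that Am g unfolding qa_def by (cases p) auto
    have qbF: "qb p \<in> carrier P.FM" if "p \<in> B" for p
      using that Bm g unfolding qb_def by (cases p) auto
    let ?Q = "qa ` A \<union> qb ` B"
    have QF: "q \<in> carrier P.FM" if "q \<in> ?Q" for q using that qaF qbF by auto
    have idU: "(\<lambda>x. x) \<in> U \<rightarrow> carrier M" using U by auto
    have "\<exists>s e C. factorization R M U (\<lambda>x. x) ?Q s e C"
    proof (rule flat_factorization[OF flat U(1)])
      show "finite ?Q" using fin by simp
      show "q j \<in> carrier R" if "q \<in> ?Q" for q j using QF[OF that] by (simp add: free_module_carrier)
      fix q assume q: "q \<in> ?Q"
      have "free_lift R M (\<lambda>x. x) (qa (a, b)) = \<zero>\<^bsub>M\<^esub>" if "(a, b) \<in> A" for a b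
        unfolding qa_def prod.case using Am[OF that] by (intro P.free_lift_add_rel[OF M idU]) simp_all
      moreover have "free_lift R M (\<lambda>x. x) (qb (r, a)) = \<zero>\<^bsub>M\<^esub>" if "(r, a) \<in> B" for r a
        unfolding qb_def prod.case using Bm[OF that] by (intro P.free_lift_smult_rel[OF M idU]) simp_all
      ultimately have "free_lift R M (\<lambda>x. x) q = \<zero>\<^bsub>M\<^esub>" using q by auto
      then show "(\<Oplus>\<^bsub>M\<^esub>x\<in>U. q x \<odot>\<^bsub>M\<^esub> x) = \<zero>\<^bsub>M\<^esub>" using free_lift_finsum[OF M idU QF[OF q] U(1)] by simp
    qed (use U in auto)
    then obtain s e C where F: "factorization R M U (\<lambda>x. x) ?Q s e C" by (elim exE)
    have e: "e i \<in> carrier M" if "i < s" for i using F that unfolding factorization_def by simp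
    have C: "C j i \<in> carrier R" if "j \<in> U" "i < s" for j i using F that unfolding factorization_def by simp
    have vC: "(\<lambda>x. C x i) \<in> U \<rightarrow> carrier (ring_module R)" if "i < s" for i using C that by auto
    have zero: "free_lift R (ring_module R) (\<lambda>x. C x i) q = \<zero>" if q: "q \<in> ?Q" and i: "i < s" for q i
    proof -
      have "free_lift R (ring_module R) (\<lambda>x. C x i) q = (\<Oplus>\<^bsub>ring_module R\<^esub>x\<in>U. q x \<otimes> C x i)"
        using free_lift_finsum[OF N vC[OF i] QF[OF q] U(1)] by simp
      also have "\<dots> = (\<Oplus>x\<in>U. q x \<otimes> C x i)"
        using QF[OF q] C i by (intro finsum_ring_module[OF cr U(1)]) (simp add: free_module_carrier)
      also have "\<dots> = \<zero>"
        using F q i unfolding factorization_def by blast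
      finally show ?thesis .
    qed
    have "splitting R M U A B s e C"
      unfolding splitting_def
    proof (intro conjI)
      show "\<forall>i<s. e i \<in> carrier M" "\<forall>x\<in>U. \<forall>i<s. C x i \<in> carrier R" using e C by auto
      show "\<forall>x\<in>U. (\<Oplus>\<^bsub>M\<^esub>i\<in>{..<s}. C x i \<odot>\<^bsub>M\<^esub> e i) = x"
        using F unfolding factorization_def by simp
      show "\<forall>(a, b)\<in>A. \<forall>i<s. C (a \<oplus>\<^bsub>M\<^esub> b) i \<odot>\<^bsub>M\<^esub> e i = C a i \<odot>\<^bsub>M\<^esub> e i \<oplus>\<^bsub>M\<^esub> C b i \<odot>\<^bsub>M\<^esub> e i"
      proof (clarify)
        fix a b i assume ab: "(a, b) \<in> A" and i: "i < s"
        note L = free_lift_linear[OF N vC[OF i]]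
        note ms = Am[OF ab]
        have "\<zero>\<^bsub>ring_module R\<^esub> = free_lift R (ring_module R) (\<lambda>x. C x i) (qa (a, b))"
          using zero[OF _ i] ab by simp
        also have "\<dots> = C (a \<oplus>\<^bsub>M\<^esub> b) i \<ominus>\<^bsub>ring_module R\<^esub> (C a i \<oplus>\<^bsub>ring_module R\<^esub> C b i)"
          unfolding qa_def prod.case
          using lin_minus[OF P.F.module_axioms N L g[OF ms(3)] P.F.a_closed[OF g[OF ms(1)] g[OF ms(2)]]]
            lin_add[OF L g[OF ms(1)] g[OF ms(2)]] free_lift_gen[OF N vC[OF i]] ms by simp
        finally have "C (a \<oplus>\<^bsub>M\<^esub> b) i = C a i \<oplus> C b i"
          using N.M.minus_eq_zero_iff[of "C (a \<oplus>\<^bsub>M\<^esub> b) i" "C a i \<oplus> C b i"] C ms i by simp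
        then show "C (a \<oplus>\<^bsub>M\<^esub> b) i \<odot>\<^bsub>M\<^esub> e i = C a i \<odot>\<^bsub>M\<^esub> e i \<oplus>\<^bsub>M\<^esub> C b i \<odot>\<^bsub>M\<^esub> e i"
          using C ms i e by (simp add: M.smult_l_distr)
      qed
      show "\<forall>(r, a)\<in>B. \<forall>i<s. C (r \<odot>\<^bsub>M\<^esub> a) i \<odot>\<^bsub>M\<^esub> e i = r \<odot>\<^bsub>M\<^esub> (C a i \<odot>\<^bsub>M\<^esub> e i)"
      proof (clarify)
        fix r a i assume ra: "(r, a) \<in> B" and i: "i < s"
        note L = free_lift_linear[OF N vC[OF i]]
        note ms = Bm[OF ra]
        have "\<zero>\<^bsub>ring_module R\<^esub> = free_lift R (ring_module R) (\<lambda>x. C x i) (qb (r, a))"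
          using zero[OF _ i] ra by simp
        also have "\<dots> = C (r \<odot>\<^bsub>M\<^esub> a) i \<ominus>\<^bsub>ring_module R\<^esub> r \<otimes> C a i"
          unfolding qb_def prod.case
          using lin_minus[OF P.F.module_axioms N L g[OF ms(3)] P.F.smult_closed[OF ms(1) g[OF ms(2)]]]
            lin_smult[OF L ms(1) g[OF ms(2)]] free_lift_gen[OF N vC[OF i]] ms by simp
        finally have "C (r \<odot>\<^bsub>M\<^esub> a) i = r \<otimes> C a i"
          using N.M.minus_eq_zero_iff[of "C (r \<odot>\<^bsub>M\<^esub> a) i" "r \<otimes> C a i"] C ms i by simp
        then show "C (r \<odot>\<^bsub>M\<^esub> a) i \<odot>\<^bsub>M\<^esub> e i = r \<odot>\<^bsub>M\<^esub> (C a i \<odot>\<^bsub>M\<^esub> e i)"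
          using C ms i e by (simp add: M.smult_assoc1)
      qed
    qed
    then show "\<exists>s e C. splitting R M U A B s e C" by (intro exI)
  qed
qed

theorem theorem5p7:
  fixes R :: "('r, 's) ring_scheme"
    and M :: "('r, 'm, 't) module_scheme"
    and k :: nat
  assumes "cring R" and "module R M" and "k \<ge> 1"
    and "principal_domain R \<or> flat_module TYPE(nat \<Rightarrow> 'r) R M \<or> [k] \<cdot>\<^bsub>R\<^esub> \<one>\<^bsub>R\<^esub> \<in> Units R"
  shows "pure_acyclic TYPE('n) R (koszul_complex R M k) \<and>
    ([k] \<cdot>\<^bsub>R\<^esub> \<one>\<^bsub>R\<^esub> \<in> Units R \<longrightarrow> contractible_complex R (koszul_complex R M k))"
proof (intro conjI impI)
  show "contractible_complex R (koszul_complex R M k)" if "[k] \<cdot>\<^bsub>R\<^esub> \<one>\<^bsub>R\<^esub> \<in> Units R"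
    by (rule koszul_contractible[OF assms(2) that])
  have "acyclic_complex R (tensor_complex R (koszul_complex R M k) N)" if N: "module R N"
    for N :: "('r, 'n) module"
  proof -
    interpret T: two_modules R M N by (intro two_modules.intro assms(2) N)
    show ?thesis
      using assms(4)
    proof (elim disjE)
      assume "principal_domain R"
      then have "pid_module R M" by (intro pid_module.intro assms(2))
      then show ?thesis
        by (intro T.acyclic_if_locally_split pid_module.locally_split_pid assms(3))
    next
      assume "flat_module TYPE(nat \<Rightarrow> 'r) R M"
      then show ?thesis
        by (intro T.acyclic_if_locally_split locally_split_flat assms(3))
    next
      assume "[k] \<cdot>\<^bsub>R\<^esub> \<one>\<^bsub>R\<^esub> \<in> Units R"
      then show ?thesis by (rule T.acyclic_if_unit)
    qed
  qed
  then show "pure_acyclic TYPE('n) R (koszul_complex R M k)"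
    unfolding pure_acyclic_def using koszul_is_complex[OF assms(2)] by simp
qed

end
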